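(* Let $d\ge3$ be a fixed integer and let $\Gamma_n$ be the sandpile group of the random directed $d$-regular graph $D_n$. For any finite abelian group $V$, we have $$\lim_{n\to\infty}\mathbb{E}|\mathrm{Sur}(\Gamma_n,V)|=1.$$
   Context: Random directed graph $D_n$: the union (with multiplicity, loops allowed) of the graphs of $d$ independent uniform random permutations of $\{1,\dots,n\}$, where the graph of $\pi$ consists of the directed edges $i\to\pi(i)$. Its adjacency matrix is $A_n=P_1+\dots+P_d$ with $P_1,\dots,P_d$ independent uniform random $n\times n$ permutation matrices. The reduced Laplacian $\Delta_n$ is obtained from $A_n-dI$ by deleting its last row and last column; the sandpile group is $\Gamma_n=\mathbb{Z}^{n-1}/\mathrm{RowSpace}(\Delta_n)$, where $\mathrm{RowSpace}(\Delta_n)$ is the subgroup of $\mathbb{Z}^{n-1}$ generated by the rows of $\Delta_n$. $\mathrm{Sur}(\Gamma,V)$ is the set of surjective homomorphisms $\Gamma\to V$. *)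

theory Defs
  imports
    "HOL-Probability.Probability"
    "Jordan_Normal_Form.Determinant"
    "HOL-Algebra.Generated_Groups"
    "Graph_Theory.Digraph"
begin

text \<open>
  Vertices are numbered from \<open>0\<close> to \<open>n - 1\<close>, in line with the indexing of matrices, so the last
  row and column have index \<open>n - 1\<close>.
\<close>

text \<open>
  The union of the graphs of the permutations \<open>\<pi> 0, \<dots>, \<pi> (d - 1)\<close>. The arc \<open>(k, i)\<close> is
  the edge from \<open>i\<close> to \<open>\<pi> k i\<close>, so parallel arcs are kept apart and loops may occur.
\<close>

definition perm_digraph :: "nat \<Rightarrow> nat \<Rightarrow> (nat \<Rightarrow> nat \<Rightarrow> nat) \<Rightarrow> (nat, nat \<times> nat) pre_digraph"
  where "perm_digraph d n \<pi> =
    \<lparr>verts = {0..<n}, arcs = {0..<d} \<times> {0..<n}, tail = snd, head = (\<lambda>(k, i). \<pi> k i)\<rparr>"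

definition random_digraph :: "nat \<Rightarrow> nat \<Rightarrow> (nat, nat \<times> nat) pre_digraph pmf"
  where "random_digraph d n =
    map_pmf (perm_digraph d n) (Pi_pmf {0..<d} id (\<lambda>_. pmf_of_set {p. p permutes {0..<n}}))"

definition adj_mat :: "nat \<Rightarrow> (nat, 'e) pre_digraph \<Rightarrow> int mat"
  where "adj_mat n D =
    mat n n (\<lambda>(i, j). int (card {e \<in> arcs D. tail D e = i \<and> head D e = j}))"

definition perm_mat :: "nat \<Rightarrow> (nat \<Rightarrow> nat) \<Rightarrow> int mat"
  where "perm_mat n p = mat n n (\<lambda>(i, j). if p i = j then 1 else 0)"

lemma adj_mat_perm_digraph_index:
  assumes "i < n" "j < n"
  shows "adj_mat n (perm_digraph d n \<pi>) $$ (i, j) = (\<Sum>k<d. perm_mat n (\<pi> k) $$ (i, j))"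
proof -
  have "{e \<in> {0..<d} \<times> {0..<n}. snd e = i \<and> (case e of (k, i) \<Rightarrow> \<pi> k i) = j}
      = (\<lambda>k. (k, i)) ` {k \<in> {..<d}. \<pi> k i = j}"
    using assms by auto
  moreover have "inj_on (\<lambda>k. (k, i)) {k \<in> {..<d}. \<pi> k i = j}"
    by (auto simp: inj_on_def)
  ultimately have "card {e \<in> {0..<d} \<times> {0..<n}. snd e = i \<and> (case e of (k, i) \<Rightarrow> \<pi> k i) = j}
      = card {k \<in> {..<d}. \<pi> k i = j}"
    by (simp only: card_image)
  also have "int \<dots> = (\<Sum>k<d. if \<pi> k i = j then 1 else 0)"
    by (simp flip: sum.inter_filter)
  finally show ?thesis
    using assms by (simp add: adj_mat_def perm_digraph_def perm_mat_def)
qed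

definition reduced_laplacian :: "nat \<Rightarrow> nat \<Rightarrow> (nat, 'e) pre_digraph \<Rightarrow> int mat"
  where "reduced_laplacian d n D = mat_delete (adj_mat n D - int d \<cdot>\<^sub>m 1\<^sub>m n) (n - 1) (n - 1)"

definition sandpile_group :: "nat \<Rightarrow> nat \<Rightarrow> (nat, 'e) pre_digraph \<Rightarrow> int vec set monoid"
  where "sandpile_group d n D =
    (let Z = monoid_vec TYPE(int) (n - 1)
     in Z Mod generate Z (set (rows (reduced_laplacian d n D))))"

lemma comm_group_sandpile_group: "comm_group (sandpile_group d n D)"
proof -
  let ?Z = "monoid_vec TYPE(int) (n - 1)"
  interpret Z: comm_group ?Z
    by (rule comm_group_vec)
  have "set (rows (reduced_laplacian d n D)) \<subseteq> carrier ?Z"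
    using rows_carrier[of "reduced_laplacian d n D"]
    by (simp add: monoid_vec_simps reduced_laplacian_def adj_mat_def)
  then have "subgroup (generate ?Z (set (rows (reduced_laplacian d n D)))) ?Z"
    by (rule Z.generate_is_subgroup)
  then show ?thesis
    unfolding sandpile_group_def Let_def by (rule Z.abelian_FactGroup)
qed

text \<open>
  \<^const>\<open>epi\<close> leaves the values outside the carrier arbitrary. They are fixed here so that
  each surjective homomorphism is counted once.
\<close>

definition Sur :: "('a, 'm) monoid_scheme \<Rightarrow> ('b, 'k) monoid_scheme \<Rightarrow> ('a \<Rightarrow> 'b) set"
  where "Sur G V = epi G V \<inter> extensional (carrier G)"

end

theory Submission
  imports Defs "HOL-Algebra.Multiplicative_Group" "HOL-Combinatorics.Multiset_Permutations" "HOL-Real_Asymp.Real_Asymp"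
begin

text \<open>
  Why the expectation tends to one. A homomorphism from the sandpile group to a finite abelian
  group \<open>V\<close> is a function \<open>g\<close> from the vertices to \<open>V\<close> that
  vanishes at the deleted vertex and satisfies \<open>A g = d g\<close> for the adjacency matrix
  \<open>A\<close>; it is onto iff the values of \<open>g\<close> generate \<open>V\<close>
  (\<open>card_Sur_sandpile_group\<close>). Regard \<open>g\<close> as a word of length
  \<open>n\<close> over the alphabet \<open>V\<close>. A uniform permutation turns
  \<open>g\<close> into a uniform rearrangement of itself, so the expectation is the sum over all
  such \<open>g\<close> of the probability that \<open>d\<close> independent uniform
  rearrangements of \<open>g\<close> add up to \<open>d g\<close>
  (\<open>expectation_Sur\<close>). There are about \<open>card V ^ (n - 1)\<close> words, and for
  most of them this probability is about \<open>card V ^ (1 - n)\<close>: the sum is what it would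
  be if it were equidistributed among the words with the right total.

  Let \<open>a\<close> be the modulus of the mean of a character over the letters of
  \<open>g\<close>. The words are divided into three classes according to these numbers
  (\<open>flat_or_near_coset\<close>).

  Flat words: \<open>a\<close> is of the order \<open>n ^ (-2/5)\<close> at most for all
  nontrivial characters. By Fourier inversion on the group of all words, the probability is
  \<open>card V ^ - n\<close> times a sum over families of characters, one for each position, of
  \<open>d\<close>-th powers of Fourier coefficients of a uniform rearrangement, up to phases. The
  constant families give the main term. The others are negligible for \<open>d \<ge> 3\<close>
  (\<open>ft_cube_sum_eventually_small\<close>): a family that is constant up to few positions has
  a small coefficient because sampling letters without replacement is nearly sampling them
  independently, and any other family shares its coefficient with so many rearrangements that
  Parseval forces it to be tiny.

  Intermediate words: \<open>a\<close> is away from 0 and from 1 for some character. The equation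
  would force a sum of independent rearrangements, for which \<open>a ^ 2\<close> is expected, to
  have the mean \<open>a\<close> again. This has a superpolynomially small probability, even after
  summing over all words of the same type (\<open>atypical_type_sum\<close>), and there are only
  polynomially many types.

  Words near a coset: \<open>a\<close> is near 1 for some nontrivial character. Then
  \<open>g\<close> is, after a translation, in a proper subgroup \<open>W\<close> except at
  \<open>m\<close> positions, and \<open>m \<ge> 1\<close> because \<open>g\<close> generates
  \<open>V\<close>. In the quotient by \<open>W\<close> the \<open>d\<close> random sets of
  exceptional positions may not cover any point outside of the exceptional positions of
  \<open>g\<close> exactly once, which is unlikely for \<open>d \<ge> 3\<close>
  (\<open>covering_count\<close>); inside \<open>W\<close> the word is flat and is treated as
  before. The sum over all words with \<open>m\<close> exceptional positions is at most a power
  with exponent \<open>m\<close> of a multiple of \<open>sqrt (m / n)\<close>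
  (\<open>near_coset_sum\<close>).
\<close>

section \<open>Words with prescribed letter counts\<close>

text \<open>
  The words are functions on an arbitrary finite index set that are undefined outside of it, so
  that they can be counted, restricted to a subset of the positions and glued together. The
  multiset of letters is called the type of the word.
\<close>

definition words :: "'i set \<Rightarrow> 'a multiset \<Rightarrow> ('i \<Rightarrow> 'a) set"
  where "words I M = {w \<in> extensional I. image_mset w (mset_set I) = M}"

lemma words_eval:
  assumes "finite I" "w \<in> words I M" "i \<in> I"
  shows "w i \<in># M"
  using assms unfolding words_def by force

lemma words_PiE:
  assumes "finite I" "set_mset M \<subseteq> A"
  shows "words I M \<subseteq> PiE I (\<lambda>_. A)"
proof
  fix w assume w: "w \<in> words I M"
  then show "w \<in> PiE I (\<lambda>_. A)"
    using words_eval[OF assms(1) w] assms(2) by (auto simp: PiE_def words_def)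
qed

lemma finite_words:
  assumes "finite I"
  shows "finite (words I M)"
  by (rule finite_subset[OF words_PiE[OF assms subset_refl]]) (auto intro!: finite_PiE assms)

lemma words_prod_mset:
  fixes f :: "'a \<Rightarrow> 'b :: comm_monoid_mult"
  assumes "w \<in> words I M"
  shows "(\<Prod>i\<in>I. f (w i)) = (\<Prod>v\<in>#M. f v)"
  using assms unfolding words_def prod_unfold_prod_mset by (auto simp: multiset.map_comp o_def)

lemma words_sum_mset:
  fixes f :: "'a \<Rightarrow> 'b :: comm_monoid_add"
  assumes "w \<in> words I M"
  shows "(\<Sum>i\<in>I. f (w i)) = (\<Sum>v\<in>#M. f v)"
  using assms unfolding words_def sum_unfold_sum_mset by (auto simp: multiset.map_comp o_def)

lemma self_in_words:
  assumes "g \<in> extensional I"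
  shows "g \<in> words I (image_mset g (mset_set I))"
  using assms by (simp add: words_def)

text \<open>
  Permuting the positions is the symmetry that makes the positions of a uniform word exchangeable.
\<close>

lemma words_permute:
  assumes "finite I" "p permutes I"
  shows "bij_betw (\<lambda>w. restrict (w \<circ> p) I) (words I M) (words I M)"
proof -
  have 1: "restrict (w \<circ> p) I \<in> words I M" if "w \<in> words I M" "p permutes I" for w p
  proof -
    have "image_mset (restrict (w \<circ> p) I) (mset_set I) = image_mset (w \<circ> p) (mset_set I)"
      by (rule image_mset_cong) (use assms in auto)
    also have "\<dots> = image_mset w (image_mset p (mset_set I))"
      by (simp add: multiset.map_comp)
    also have "image_mset p (mset_set I) = mset_set I"
      using that by (simp add: image_mset_mset_set permutes_inj_on permutes_image)
    finally have "image_mset (restrict (w \<circ> p) I) (mset_set I) = M"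
      using that(1) by (simp only: words_def mem_Collect_eq)
    then show ?thesis by (simp only: words_def mem_Collect_eq restrict_extensional)
  qed
  have inv: "inv_into UNIV p permutes I" using assms permutes_inv by blast
  have 2: "restrict (restrict (w \<circ> p) I \<circ> q) I = w" if "w \<in> words I M" "q permutes I" "\<And>x. p (q x) = x" for w p q
    using that by (auto simp: words_def fun_eq_iff extensional_def permutes_in_image)
  show ?thesis
  proof (rule bij_betwI[where g = "\<lambda>w. restrict (w \<circ> inv_into UNIV p) I"])
    show "(\<lambda>w. restrict (w \<circ> p) I) \<in> words I M \<rightarrow> words I M"
      using 1[OF _ assms(2)] by blast
    show "(\<lambda>w. restrict (w \<circ> inv_into UNIV p) I) \<in> words I M \<rightarrow> words I M"
      using 1[OF _ inv] by blast
    show "restrict (restrict (w \<circ> p) I \<circ> inv_into UNIV p) I = w" if "w \<in> words I M" for w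
      by (rule 2[OF that inv]) (rule permutes_inverses(1)[OF assms(2)])
    show "restrict (restrict (w \<circ> inv_into UNIV p) I \<circ> p) I = w" if "w \<in> words I M" for w
      by (rule 2[OF that assms(2)]) (rule permutes_inverses(2)[OF assms(2)])
  qed
qed

lemma words_transitive:
  assumes "finite I" "w \<in> words I M" "w' \<in> words I M"
  obtains p where "p permutes I" "\<And>i. i \<in> I \<Longrightarrow> w i = w' (p i)"
proof -
  have "image_mset w (mset_set I) = image_mset w' (mset_set I)"
    using assms by (auto simp: words_def)
  then obtain p where "p permutes I" "\<forall>i\<in>I. w i = w' (p i)"
    by (rule image_mset_eq_implies_permutes[OF assms(1)])
  with that show ?thesis by simp
qed

text \<open>
  Listing the values of a word along an enumeration of the index set turns words into multiset
  permutations.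
\<close>

lemma card_words_multinomial:
  assumes "finite I" "size M = card I"
  shows "card (words I M) * (\<Prod>x\<in>set_mset M. fact (count M x)) = fact (card I)"
proof -
  obtain xs where xs: "set xs = I" "distinct xs"
    using finite_distinct_list[OF assms(1)] by blast
  have mxs: "mset xs = mset_set I"
    using xs mset_set_set by metis
  have "bij_betw (\<lambda>w. map w xs) (words I M) (permutations_of_multiset M)"
  proof (rule bij_betwI[where g = "\<lambda>ys. (\<lambda>i. if i \<in> I then ys ! (SOME k. k < length xs \<and> xs ! k = i) else undefined)"])
    show "(\<lambda>w. map w xs) \<in> words I M \<rightarrow> permutations_of_multiset M"
      by (auto simp: words_def permutations_of_multiset_def mxs)
    have len: "length ys = length xs" if "ys \<in> permutations_of_multiset M" for ys
      using that assms xs distinct_card[of xs] by (metis permutations_of_multisetD size_mset)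
    have idx: "(SOME k. k < length xs \<and> xs ! k = xs ! j) = j" if "j < length xs" for j
      by (rule some_equality) (use that xs in \<open>auto simp: nth_eq_iff_index_eq\<close>)
    have mp: "map (\<lambda>i. if i \<in> I then ys ! (SOME k. k < length xs \<and> xs ! k = i) else undefined) xs = ys"
      if "ys \<in> permutations_of_multiset M" for ys
      by (rule nth_equalityI) (use len[OF that] idx xs in \<open>auto simp: in_set_conv_nth\<close>)
    show "(\<lambda>ys i. if i \<in> I then ys ! (SOME k. k < length xs \<and> xs ! k = i) else undefined)
        \<in> permutations_of_multiset M \<rightarrow> words I M"
    proof
      fix ys assume ys: "ys \<in> permutations_of_multiset M"
      let ?f = "\<lambda>i. if i \<in> I then ys ! (SOME k. k < length xs \<and> xs ! k = i) else undefined"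
      have "image_mset ?f (mset xs) = mset ys"
        using mp[OF ys] by (metis mset_map)
      then show "?f \<in> words I M"
        using permutations_of_multisetD[OF ys] by (simp only: words_def mxs mem_Collect_eq) (simp add: extensional_def)
    qed
    show "map (\<lambda>i. if i \<in> I then ys ! (SOME k. k < length xs \<and> xs ! k = i) else undefined) xs = ys"
      if "ys \<in> permutations_of_multiset M" for ys using mp that by blast
    show "(\<lambda>i. if i \<in> I then map w xs ! (SOME k. k < length xs \<and> xs ! k = i) else undefined) = w"
      if w: "w \<in> words I M" for w
    proof
      fix i show "(if i \<in> I then map w xs ! (SOME k. k < length xs \<and> xs ! k = i) else undefined) = w i"
      proof (cases "i \<in> I")
        case True
        then obtain k where k: "k < length xs" "xs ! k = i" using xs by (auto simp: in_set_conv_nth)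
        show ?thesis using True k idx[OF k(1)] by simp
      qed (use w in \<open>auto simp: words_def extensional_def\<close>)
    qed
  qed
  then have "card (words I M) = card (permutations_of_multiset M)"
    by (rule bij_betw_same_card)
  then show ?thesis
    using card_permutations_of_multiset_aux[of M] assms by simp
qed

lemma card_words_pos:
  assumes "finite I" "size M = card I"
  shows "card (words I M) > 0"
  using card_words_multinomial[OF assms] by (metis fact_nonzero gr0I mult_0)

text \<open>
  There is equality at \<open>k = l\<close>. Raising \<open>k\<close> by one multiplies the left
  side by \<open>l\<close> and the right side by \<open>k + 1\<close>, so the right side gains as
  long as \<open>k \<ge> l\<close> and the left side loses on the way down.
\<close>

lemma fact_power_ineq: "fact l * real l ^ k \<le> fact k * real l ^ l"
proof (cases "k \<le> l")
  case True
  then show ?thesis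
  proof (induction rule: inc_induct)
    case (step m)
    have "fact l * real l ^ m * real l \<le> fact m * real (Suc m) * real l ^ l"
      using step.IH by (simp add: algebra_simps)
    also have "\<dots> \<le> fact m * real l * real l ^ l"
      using step.hyps by (intro mult_mono) auto
    finally have "(fact l * real l ^ m) * real l \<le> (fact m * real l ^ l) * real l" by (simp add: algebra_simps)
    moreover have "real l > 0" using step.hyps by auto
    ultimately show ?case by (simp add: mult_le_cancel_right)
  qed simp
next
  case False
  then have "l \<le> k" by simp
  then show ?thesis
  proof (induction rule: dec_induct)
    case (step m)
    have "fact l * real l ^ Suc m = (fact l * real l ^ m) * real l" by simp
    also have "\<dots> \<le> (fact m * real l ^ l) * real (Suc m)"
      using step by (intro mult_mono[of "fact l * real l ^ m" "fact m * real l ^ l" "real l"]) auto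
    also have "\<dots> = fact (Suc m) * real l ^ l" by simp
    finally show ?case .
  qed simp
qed

text \<open>
  Up to the common factor \<open>card I ^ card I\<close>, the two sides are the probabilities that
  independent letters with the letter frequencies of \<open>M\<close> produce a word of type
  \<open>N\<close> or of type \<open>M\<close>. With the multinomial formula for the numbers of
  words, the claim is \<open>fact_power_ineq\<close>, letter by letter.
\<close>

lemma own_type_most_likely:
  assumes "finite I" "finite A" "set_mset M \<subseteq> A" "set_mset N \<subseteq> A" "size M = card I" "size N = card I"
  shows "real (card (words I N)) * (\<Prod>v\<in>A. real (count M v) ^ count N v)
    \<le> real (card (words I M)) * (\<Prod>v\<in>A. real (count M v) ^ count M v)"
proof -
  have multi: "real (card (words I K)) = fact (card I) / (\<Prod>v\<in>A. fact (count K v))"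
    if "set_mset K \<subseteq> A" "size K = card I" for K
  proof -
    have "(\<Prod>x\<in>set_mset K. fact (count K x)) = (\<Prod>x\<in>A. fact (count K x) :: nat)"
      by (rule prod.mono_neutral_left) (use that assms in \<open>auto simp: not_in_iff\<close>)
    then have "card (words I K) * (\<Prod>x\<in>A. fact (count K x)) = fact (card I)"
      using card_words_multinomial[OF assms(1) that(2)] by simp
    then have "real (card (words I K) * (\<Prod>x\<in>A. fact (count K x))) = real (fact (card I))"
      by (simp only:)
    then have "real (card (words I K)) * (\<Prod>x\<in>A. fact (count K x)) = fact (card I)"
      unfolding of_nat_mult of_nat_prod of_nat_fact .
    moreover have "(\<Prod>v\<in>A. fact (count K v)) \<noteq> (0::real)"
      using assms(2) by simp
    ultimately show ?thesis by (metis nonzero_mult_div_cancel_right)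
  qed
  have "(\<Prod>v\<in>A. fact (count M v) * real (count M v) ^ count N v) \<le> (\<Prod>v\<in>A. fact (count N v) * real (count M v) ^ count M v)"
    by (intro prod_mono conjI fact_power_ineq) auto
  then show ?thesis
    unfolding multi[OF assms(3,5)] multi[OF assms(4,6)] prod.distrib
    by (simp add: field_simps prod_pos)
qed

lemma count_le_size: "count N x \<le> size N"
  by (induction N) auto

text \<open>
  A type is determined by its letter counts, each of which is at most \<open>n\<close>.
\<close>

lemma card_types:
  assumes "finite A"
  shows "finite {N. set_mset N \<subseteq> A \<and> size N = n}" "card {N. set_mset N \<subseteq> A \<and> size N = n} \<le> (n + 1) ^ card A"
proof -
  let ?T = "{N. set_mset N \<subseteq> A \<and> size N = n}"
  have inj: "inj_on (\<lambda>N. restrict (count N) A) ?T"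
  proof (rule inj_onI)
    fix N N' assume h: "N \<in> ?T" "N' \<in> ?T" "restrict (count N) A = restrict (count N') A"
    show "N = N'"
    proof (rule multiset_eqI)
      fix x show "count N x = count N' x"
      proof (cases "x \<in> A")
        case True
        then show ?thesis using fun_cong[OF h(3), of x] by simp
      next
        case False
        then have "x \<notin># N" "x \<notin># N'" using h(1,2) by auto
        then show ?thesis by (simp add: not_in_iff)
      qed
    qed
  qed
  have img: "(\<lambda>N. restrict (count N) A) ` ?T \<subseteq> PiE A (\<lambda>_. {..n})"
  proof (intro image_subsetI)
    fix N assume "N \<in> ?T"
    then show "restrict (count N) A \<in> PiE A (\<lambda>_. {..n})"
      using count_le_size[of N] by auto
  qed
  show "finite ?T"
    using finite_subset[OF img] assms by (auto intro: finite_imageD[OF _ inj] finite_PiE)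
  have "card ?T \<le> card (PiE A (\<lambda>_. {..n}))"
    using card_inj_on_le[OF inj img] assms by (auto intro: finite_PiE)
  then show "card ?T \<le> (n + 1) ^ card A"
    using assms by (simp add: card_PiE)
qed

text \<open>
  The types of independent letters are polynomially many, and none is likelier than the one whose
  frequencies the letters follow. Hence a uniform word of type \<open>M\<close> can be replaced by
  independent letters at a polynomial cost; read backwards, this is a lower bound for the number
  of words.
\<close>

lemma method_of_types:
  assumes "finite I" "finite A" "set_mset M \<subseteq> A" "size M = card I" "I \<noteq> {}"
  shows "1 \<le> (real (card I) + 1) ^ card A *
    (real (card (words I M)) * (\<Prod>v\<in>A. (real (count M v) / card I) ^ count M v))"
proof -
  let ?n = "card I"
  let ?p = "\<lambda>v. real (count M v) / ?n"
  let ?T = "{N. set_mset N \<subseteq> A \<and> size N = ?n}"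
  have n: "?n > 0" using assms by (simp add: card_gt_0_iff)
  have finT: "finite ?T" and cT: "card ?T \<le> (?n + 1) ^ card A"
    by (rule card_types[OF assms(2)])+
  have sz: "(\<Sum>v\<in>A. count N v) = size N" if "set_mset N \<subseteq> A" for N
  proof -
    have "(\<Sum>v\<in>set_mset N. count N v) = (\<Sum>v\<in>A. count N v)"
      by (rule sum.mono_neutral_left) (use that assms in \<open>auto simp: not_in_iff\<close>)
    then show ?thesis by (simp add: size_multiset_overloaded_eq)
  qed
  have "(\<Sum>v\<in>A. ?p v) = 1"
    using sz[OF assms(3)] n assms(4) by (simp flip: sum_divide_distrib of_nat_sum)
  then have "1 = (\<Prod>i\<in>I. \<Sum>v\<in>A. ?p v)" by simp
  also have "\<dots> = (\<Sum>w\<in>PiE I (\<lambda>_. A). \<Prod>i\<in>I. ?p (w i))"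
    by (rule prod_sum_PiE) (use assms in auto)
  also have "\<dots> = (\<Sum>N\<in>?T. \<Sum>w\<in>{w \<in> PiE I (\<lambda>_. A). image_mset w (mset_set I) = N}. \<Prod>i\<in>I. ?p (w i))"
    by (rule sum.group[symmetric]) (use assms finT in \<open>auto intro!: finite_PiE\<close>)
  also have "\<dots> \<le> (\<Sum>N\<in>?T. real (card (words I M)) * (\<Prod>v\<in>A. ?p v ^ count M v))"
  proof (rule sum_mono)
    fix N assume N: "N \<in> ?T"
    have eq: "{w \<in> PiE I (\<lambda>_. A). image_mset w (mset_set I) = N} = words I N"
      using words_PiE[OF assms(1), of N A] N by (auto simp: words_def PiE_def)
    have pr: "(\<Prod>i\<in>I. ?p (w i)) = (\<Prod>v\<in>A. ?p v ^ count N v)" if "w \<in> words I N" for w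
    proof -
      have "(\<Prod>i\<in>I. ?p (w i)) = (\<Prod>v\<in>#N. ?p v)" using words_prod_mset[OF that] .
      also have "\<dots> = (\<Prod>v\<in>set_mset N. ?p v ^ count N v)" by (rule image_prod_mset_multiplicity)
      also have "\<dots> = (\<Prod>v\<in>A. ?p v ^ count N v)"
        by (rule prod.mono_neutral_left) (use N assms in \<open>auto simp: not_in_iff\<close>)
      finally show ?thesis .
    qed
    have dv: "(\<Prod>v\<in>A. ?p v ^ count K v) = (\<Prod>v\<in>A. real (count M v) ^ count K v) / real ?n ^ ?n"
      if "set_mset K \<subseteq> A" "size K = ?n" for K
      using sz[OF that(1)] that(2) by (simp add: power_divide prod_dividef flip: power_sum)
    show "(\<Sum>w\<in>{w \<in> PiE I (\<lambda>_. A). image_mset w (mset_set I) = N}. \<Prod>i\<in>I. ?p (w i))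
      \<le> real (card (words I M)) * (\<Prod>v\<in>A. ?p v ^ count M v)"
      unfolding eq using own_type_most_likely[OF assms(1,2,3) _ assms(4), of N] N assms dv[of N] dv[of M]
      by (simp add: pr divide_right_mono)
  qed
  also have "\<dots> = real (card ?T) * (real (card (words I M)) * (\<Prod>v\<in>A. ?p v ^ count M v))" by simp
  also have "\<dots> \<le> real ((?n + 1) ^ card A) * (real (card (words I M)) * (\<Prod>v\<in>A. ?p v ^ count M v))"
    by (intro mult_right_mono of_nat_mono cT) (auto intro!: mult_nonneg_nonneg prod_nonneg)
  finally show ?thesis by (simp add: add.commute)
qed

section \<open>Characters of finite abelian groups\<close>

locale finite_comm_group = comm_group G for G (structure) +
  assumes finite_carrier: "finite (carrier G)"

text \<open>
  Being zero outside of the carrier makes equality of characters equality of functions and keeps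
  the set closed under pointwise products and conjugation.
\<close>

definition chars :: "('a, 'm) monoid_scheme \<Rightarrow> ('a \<Rightarrow> complex) set"
  where "chars G = {\<xi>. (\<forall>x. x \<notin> carrier G \<longrightarrow> \<xi> x = 0) \<and> \<xi> \<one>\<^bsub>G\<^esub> = 1 \<and>
    (\<forall>x\<in>carrier G. \<forall>y\<in>carrier G. \<xi> (x \<otimes>\<^bsub>G\<^esub> y) = \<xi> x * \<xi> y)}"

definition triv_char :: "('a, 'm) monoid_scheme \<Rightarrow> 'a \<Rightarrow> complex"
  where "triv_char G = (\<lambda>x. if x \<in> carrier G then 1 else 0)"

lemma char_outside: "\<xi> \<in> chars G \<Longrightarrow> x \<notin> carrier G \<Longrightarrow> \<xi> x = 0"
  and char_one: "\<xi> \<in> chars G \<Longrightarrow> \<xi> \<one>\<^bsub>G\<^esub> = 1"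
  and char_mult: "\<xi> \<in> chars G \<Longrightarrow> x \<in> carrier G \<Longrightarrow> y \<in> carrier G \<Longrightarrow> \<xi> (x \<otimes>\<^bsub>G\<^esub> y) = \<xi> x * \<xi> y"
  by (auto simp: chars_def)

lemma char_eqI:
  assumes "\<xi> \<in> chars G" "\<psi> \<in> chars G" "\<And>x. x \<in> carrier G \<Longrightarrow> \<xi> x = \<psi> x"
  shows "\<xi> = \<psi>"
proof
  fix x show "\<xi> x = \<psi> x"
    using assms(3)[of x] char_outside[OF assms(1), of x] char_outside[OF assms(2), of x]
    by (cases "x \<in> carrier G") auto
qed

lemma chars_times: "\<xi> \<in> chars G \<Longrightarrow> \<psi> \<in> chars G \<Longrightarrow> (\<lambda>x. \<xi> x * \<psi> x) \<in> chars G"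
  by (auto simp: chars_def)

lemma chars_cnj: "\<xi> \<in> chars G \<Longrightarrow> (\<lambda>x. cnj (\<xi> x)) \<in> chars G"
  by (auto simp: chars_def)

context finite_comm_group
begin

lemma triv_char_in: "triv_char G \<in> chars G"
  by (auto simp: chars_def triv_char_def)

lemma char_pow: "\<xi> \<in> chars G \<Longrightarrow> x \<in> carrier G \<Longrightarrow> \<xi> (x [^] (n::nat)) = \<xi> x ^ n"
  by (induction n) (auto simp: char_one char_mult)

lemma char_root_of_unity: "\<xi> \<in> chars G \<Longrightarrow> x \<in> carrier G \<Longrightarrow> \<xi> x ^ order G = 1"
  using char_pow[of \<xi> x "order G"] pow_order_eq_1[of x] char_one[of \<xi> G] by simp

lemma order_pos: "order G > 0"
  using finite_carrier order_gt_0_iff_finite by blast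

lemma char_norm:
  assumes "\<xi> \<in> chars G" "x \<in> carrier G"
  shows "norm (\<xi> x) = 1"
proof -
  have "norm (\<xi> x) ^ order G = 1"
    using char_root_of_unity[OF assms] by (metis norm_one norm_power)
  then show ?thesis
    using power_eq_iff_eq_base[of "order G" "norm (\<xi> x)" 1] order_pos by simp
qed

lemma char_norm_le: "\<xi> \<in> chars G \<Longrightarrow> norm (\<xi> x) \<le> 1"
  using char_norm[of \<xi> x] char_outside[of \<xi> G x] by (cases "x \<in> carrier G") auto

lemma char_cnj_self: "\<xi> \<in> chars G \<Longrightarrow> x \<in> carrier G \<Longrightarrow> \<xi> x * cnj (\<xi> x) = 1"
  using char_norm[of \<xi> x] by (simp add: complex_norm_square flip: complex_norm_square)

lemma char_inv:
  assumes "\<xi> \<in> chars G" "x \<in> carrier G"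
  shows "\<xi> (inv x) = cnj (\<xi> x)"
proof -
  have "\<xi> x * \<xi> (inv x) = 1"
    using assms by (metis char_mult char_one inv_closed r_inv)
  moreover have "\<xi> x * cnj (\<xi> x) = 1" by (rule char_cnj_self[OF assms])
  moreover have "\<xi> x \<noteq> 0" using char_norm[OF assms] by auto
  ultimately show ?thesis by (metis mult_left_cancel)
qed

lemma char_finprod:
  assumes "\<xi> \<in> chars G" "f \<in> A \<rightarrow> carrier G"
  shows "\<xi> (finprod G f A) = (\<Prod>a\<in>A. \<xi> (f a))"
  using assms(2)
proof (induction A rule: infinite_finite_induct)
  case (insert a A)
  then show ?case using assms(1) by (simp add: char_mult Pi_def)
qed (simp_all add: char_one[OF assms(1)])

lemma finite_chars: "finite (chars G)"
proof (rule finite_subset)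
  show "chars G \<subseteq> {\<xi>. \<forall>x. (x \<in> carrier G \<longrightarrow> \<xi> x \<in> {z. z ^ order G = 1}) \<and> (x \<notin> carrier G \<longrightarrow> \<xi> x = 0)}"
    using char_root_of_unity char_outside by auto
  show "finite {\<xi>. \<forall>x. (x \<in> carrier G \<longrightarrow> \<xi> x \<in> {z::complex. z ^ order G = 1}) \<and> (x \<notin> carrier G \<longrightarrow> \<xi> x = 0)}"
    by (rule finite_set_of_finite_funs) (use finite_carrier order_pos finite_roots_unity[of "order G"] in auto)
qed

text \<open>
  Every element of the subgroup generated by \<open>K\<close> and \<open>x\<close> is \<open>k
  \<otimes> x [^] j\<close>, and the extension has to send it to \<open>\<phi> k * z ^ j\<close>.
  Two such representations differ by a power of \<open>x\<close> in \<open>K\<close>, whose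
  exponent is a multiple of \<open>t\<close> by minimality, so that \<open>z ^ t = \<phi> (x [^]
  t)\<close> is exactly what makes this well defined.
\<close>

lemma char_extend_step:
  assumes K: "subgroup K G" and \<phi>: "\<phi> \<in> chars (G\<lparr>carrier := K\<rparr>)" and x: "x \<in> carrier G"
    and t: "t > 0" "x [^] t \<in> K" "\<And>s. 0 < s \<Longrightarrow> s < t \<Longrightarrow> x [^] s \<notin> K" and z: "z ^ t = \<phi> (x [^] (t::nat))"
  shows "\<exists>K' \<phi>'. subgroup K' G \<and> K \<subseteq> K' \<and> x \<in> K' \<and> \<phi>' \<in> chars (G\<lparr>carrier := K'\<rparr>) \<and>
    (\<forall>y\<in>K. \<phi>' y = \<phi> y) \<and> \<phi>' x = z"
proof -
  have Kc: "K \<subseteq> carrier G" using K by (rule subgroup.subset)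
  have \<phi>1: "\<phi> \<one> = 1" and \<phi>m: "\<And>a b. a \<in> K \<Longrightarrow> b \<in> K \<Longrightarrow> \<phi> (a \<otimes> b) = \<phi> a * \<phi> b"
    using char_one[OF \<phi>] char_mult[OF \<phi>] by auto
  have Kpow: "a [^] (q::nat) \<in> K \<and> \<phi> (a [^] q) = \<phi> a ^ q" if "a \<in> K" for a q
    using that by (induction q) (auto simp: \<phi>1 \<phi>m subgroup.one_closed[OF K] subgroup.m_closed[OF K])
  have ex: "x [^] e \<in> K \<Longrightarrow> \<phi> (x [^] e) = z ^ e" for e :: nat
  proof -
    assume e: "x [^] e \<in> K"
    let ?q = "e div t" and ?s = "e mod t"
    have split: "x [^] e = (x [^] t) [^] ?q \<otimes> x [^] ?s"
      using x by (simp add: nat_pow_pow nat_pow_mult)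
    have "x [^] ?s = inv ((x [^] t) [^] ?q) \<otimes> x [^] e"
      using split x by (metis inv_solve_left nat_pow_closed)
    then have "x [^] ?s \<in> K"
      using Kpow[OF t(2)] e K by (metis subgroup.m_closed subgroup.m_inv_closed)
    then have s0: "?s = 0" using t by (metis bot_nat_0.not_eq_extremum mod_less_divisor)
    then have "\<phi> (x [^] e) = \<phi> (x [^] t) ^ ?q"
      using split Kpow[OF t(2)] x by simp
    also have "\<dots> = z ^ (t * ?q)" using z by (simp add: power_mult)
    also have "t * ?q = e" using s0 by auto
    finally show "\<phi> (x [^] e) = z ^ e" .
  qed
  have z0: "z \<noteq> 0"
  proof
    assume "z = 0"
    then have "\<phi> (x [^] t) = 0" using z[symmetric] t(1) by (simp only: zero_power)
    moreover have "\<phi> (x [^] t) * \<phi> (inv (x [^] t)) = 1"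
      using \<phi>m[OF t(2) subgroup.m_inv_closed[OF K t(2)]] \<phi>1 Kc t(2) by (metis r_inv subsetD)
    ultimately show False by simp
  qed
  have wd1: "\<phi> k * z ^ j = \<phi> k' * z ^ j'"
    if h: "k \<in> K" "k' \<in> K" "k \<otimes> x [^] j = k' \<otimes> x [^] j'" "j \<le> j'" for k k' and j j' :: nat
  proof -
    have kc: "k \<in> carrier G" "k' \<in> carrier G" using h Kc by auto
    have "k \<otimes> x [^] j = (k' \<otimes> x [^] (j' - j)) \<otimes> x [^] j"
      using h x kc by (simp add: m_assoc nat_pow_mult)
    then have e: "k = k' \<otimes> x [^] (j' - j)" using kc x by (metis m_closed nat_pow_closed right_cancel)
    then have "x [^] (j' - j) = inv k' \<otimes> k" using kc x by (metis inv_solve_left nat_pow_closed)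
    then have xe: "x [^] (j' - j) \<in> K" using h K by (metis subgroup.m_closed subgroup.m_inv_closed)
    have "\<phi> k = \<phi> k' * z ^ (j' - j)"
      using e \<phi>m[OF h(2) xe] ex[OF xe] by simp
    then show ?thesis using h(4) by (simp add: power_add[symmetric])
  qed
  have wd: "\<phi> k * z ^ j = \<phi> k' * z ^ j'"
    if "k \<in> K" "k' \<in> K" "k \<otimes> x [^] j = k' \<otimes> x [^] j'" for k k' and j j' :: nat
    using wd1[of k k' j j'] wd1[of k' k j' j] that by (metis nat_le_linear)
  define K' where "K' = {k \<otimes> x [^] j | k (j::nat). k \<in> K}"
  define \<phi>' where "\<phi>' y = (if y \<in> K' then SOME c. \<exists>k\<in>K. \<exists>j::nat. y = k \<otimes> x [^] j \<and> c = \<phi> k * z ^ j else 0)" for y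
  have \<phi>': "\<phi>' (k \<otimes> x [^] j) = \<phi> k * z ^ j" if "k \<in> K" for k and j :: nat
  proof -
    have "\<exists>c. \<exists>k'\<in>K. \<exists>j'::nat. k \<otimes> x [^] j = k' \<otimes> x [^] j' \<and> c = \<phi> k' * z ^ j'" using that by blast
    moreover have "k \<otimes> x [^] j \<in> K'" using that unfolding K'_def by blast
    ultimately have "\<exists>k'\<in>K. \<exists>j'::nat. k \<otimes> x [^] j = k' \<otimes> x [^] j' \<and> \<phi>' (k \<otimes> x [^] j) = \<phi> k' * z ^ j'"
      unfolding \<phi>'_def by (simp only: if_True) (rule someI_ex)
    then obtain k' and j' :: nat where
      "k' \<in> K" "k \<otimes> x [^] j = k' \<otimes> x [^] j'" "\<phi>' (k \<otimes> x [^] j) = \<phi> k' * z ^ j'"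
      by blast
    then show ?thesis using wd[OF that] by simp
  qed
  have K'I: "k \<otimes> x [^] j \<in> K'" if "k \<in> K" for k and j :: nat using that K'_def by blast
  have mm: "(k \<otimes> x [^] j) \<otimes> (k' \<otimes> x [^] j') = (k \<otimes> k') \<otimes> x [^] (j + j')"
    if "k \<in> K" "k' \<in> K" for k k' and j j' :: nat
  proof -
    have "k \<in> carrier G" "k' \<in> carrier G" using that Kc by auto
    then show ?thesis using x by (simp add: m_ac nat_pow_mult[symmetric])
  qed
  have "subgroup K' G"
  proof (rule subgroupI)
    show "K' \<subseteq> carrier G" using Kc x by (auto simp: K'_def)
    show "K' \<noteq> {}" using K'I[OF subgroup.one_closed[OF K]] by blast
    show "inv a \<in> K'" if a: "a \<in> K'" for a
    proof -
      obtain k and j :: nat where kj: "k \<in> K" "a = k \<otimes> x [^] j" using a K'_def by blast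
      have kc: "k \<in> carrier G" using kj Kc by auto
      let ?b = "inv k \<otimes> x [^] (j * (order G - 1))"
      have "a \<otimes> ?b = (k \<otimes> inv k) \<otimes> x [^] (j + j * (order G - 1))"
        using kj mm[OF kj(1) subgroup.m_inv_closed[OF K kj(1)]] by simp
      also have "j + j * (order G - 1) = order G * j" using order_pos by (cases "order G") auto
      also have "x [^] (order G * j) = \<one>" using x pow_order_eq_1 by (simp flip: nat_pow_pow)
      finally have "a \<otimes> ?b = \<one>" using kc by simp
      then have "inv a = ?b" using kj kc x by (metis comm_inv_char inv_closed m_closed nat_pow_closed)
      then show ?thesis using K'I[OF subgroup.m_inv_closed[OF K kj(1)]] by simp
    qed
    show "a \<otimes> b \<in> K'" if "a \<in> K'" "b \<in> K'" for a b
      using that mm K'I subgroup.m_closed[OF K] unfolding K'_def by (smt (verit) mem_Collect_eq)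
  qed
  moreover have KK': "K \<subseteq> K'"
  proof
    fix k assume "k \<in> K" then show "k \<in> K'" using K'I[of k 0] Kc by auto
  qed
  moreover have "x \<in> K'" using K'I[OF subgroup.one_closed[OF K], of 1] x by simp
  moreover have ag: "\<forall>y\<in>K. \<phi>' y = \<phi> y" using \<phi>'[of _ 0] Kc by (auto simp: subset_iff)
  moreover have "\<phi>' x = z" using \<phi>'[OF subgroup.one_closed[OF K], of 1] x \<phi>1 by simp
  moreover have "\<phi>' \<in> chars (G\<lparr>carrier := K'\<rparr>)"
  proof -
    have "\<phi>' (a \<otimes> b) = \<phi>' a * \<phi>' b" if ab: "a \<in> K'" "b \<in> K'" for a b
    proof -
      obtain k k' and j j' :: nat where kj: "k \<in> K" "a = k \<otimes> x [^] j" "k' \<in> K" "b = k' \<otimes> x [^] j'"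
        using ab unfolding K'_def by blast
      then show ?thesis
        using mm[OF kj(1,3), of j j'] \<phi>'[OF subgroup.m_closed[OF K kj(1,3)], of "j + j'"] \<phi>' \<phi>m
        by (simp add: power_add)
    qed
    moreover have "\<phi>' \<one> = 1" using ag \<phi>1 subgroup.one_closed[OF K] by metis
    ultimately show ?thesis by (auto simp: chars_def \<phi>'_def)
  qed
  ultimately show ?thesis by blast
qed

lemma least_power_in_subgroup:
  assumes "subgroup K G" "x \<in> carrier G"
  obtains t :: nat where "t > 0" "x [^] t \<in> K" "\<And>s. 0 < s \<Longrightarrow> s < t \<Longrightarrow> x [^] s \<notin> K"
proof -
  let ?P = "\<lambda>s::nat. 0 < s \<and> x [^] s \<in> K"
  have "?P (order G)"
    using assms order_pos pow_order_eq_1 subgroup.one_closed by metis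
  then have "?P (LEAST s. ?P s)" by (rule LeastI)
  moreover have "\<And>s. 0 < s \<Longrightarrow> s < (LEAST s. ?P s) \<Longrightarrow> x [^] s \<notin> K"
    using not_less_Least by blast
  ultimately show ?thesis using that by blast
qed

text \<open>
  A proper subgroup can always be enlarged by one element, since complex numbers have roots of
  every order.
\<close>

lemma char_extend:
  assumes "subgroup K G" "\<phi> \<in> chars (G\<lparr>carrier := K\<rparr>)"
  shows "\<exists>\<xi>\<in>chars G. \<forall>x\<in>K. \<xi> x = \<phi> x"
  using assms
proof (induction "card (carrier G) - card K" arbitrary: K \<phi> rule: less_induct)
  case less
  have Kc: "K \<subseteq> carrier G" using less.prems by (simp add: subgroup.subset)
  show ?case
  proof (cases "K = carrier G")
    case True
    then show ?thesis using less.prems by (auto simp: chars_def)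
  next
    case False
    then obtain x where x: "x \<in> carrier G" "x \<notin> K" using Kc by blast
    obtain t :: nat where t: "t > 0" "x [^] t \<in> K" "\<And>s. 0 < s \<Longrightarrow> s < t \<Longrightarrow> x [^] s \<notin> K"
      using least_power_in_subgroup[OF less.prems(1) x(1)] by blast
    obtain z where z: "z ^ t = \<phi> (x [^] t)"
      using exists_complex_root t(1) by (metis bot_nat_0.not_eq_extremum)
    obtain K' \<phi>' where K': "subgroup K' G" "K \<subseteq> K'" "x \<in> K'" "\<phi>' \<in> chars (G\<lparr>carrier := K'\<rparr>)" "\<forall>y\<in>K. \<phi>' y = \<phi> y"
      using char_extend_step[OF less.prems x(1) t z] by blast
    have K'c: "K' \<subseteq> carrier G" using K' by (simp add: subgroup.subset)
    have "card K < card K'" using K' x K'c finite_carrier by (metis finite_subset psubsetI psubset_card_mono)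
    moreover have "card K' \<le> card (carrier G)" using K'c finite_carrier card_mono by blast
    ultimately have "card (carrier G) - card K' < card (carrier G) - card K" by simp
    from less.hyps[OF this K'(1,4)] show ?thesis using K'(2,5) by (metis subsetD)
  qed
qed

text \<open>
  Extend the trivial group by \<open>x\<close> and send \<open>x\<close> to a primitive root of
  unity of its order.
\<close>

lemma char_separates:
  assumes "x \<in> carrier G" "x \<noteq> \<one>"
  shows "\<exists>\<xi>\<in>chars G. \<xi> x \<noteq> 1"
proof -
  have sg: "subgroup {\<one>} G" by (rule triv_subgroup)
  obtain t :: nat where t: "t > 0" "x [^] t \<in> {\<one>}" "\<And>s. 0 < s \<Longrightarrow> s < t \<Longrightarrow> x [^] s \<notin> {\<one>}"
    using least_power_in_subgroup[OF sg assms(1)] by blast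
  have "t \<noteq> 1" using t(2) assms by auto
  then have "t > 1" using t(1) by simp
  let ?z = "cis (2 * pi / t)"
  have z1: "?z \<noteq> 1"
  proof
    assume "?z = 1"
    then have "cos (2 * pi / t) = 1" by (simp add: complex_eq_iff)
    then obtain k :: int where k: "2 * pi / t = real_of_int k * 2 * pi" using cos_one_2pi_int by auto
    then have "2 * pi = (real_of_int k * real t) * (2 * pi)"
      using t(1) by (simp add: nonzero_divide_eq_eq)
    then have "real_of_int k * real t = 1"
      using pi_gt_zero by (metis mult_cancel_right1 mult_eq_0_iff pi_neq_zero zero_neq_numeral)
    then have "real_of_int (k * int t) = 1" by simp
    then have "k * int t = 1" by linarith
    then show False using \<open>t > 1\<close> by (simp add: zmult_eq_1_iff)
  qed
  have "?z ^ t = cis (real t * (2 * pi / real t))" by (rule Complex.DeMoivre)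
  also have "real t * (2 * pi / real t) = 2 * pi" using t(1) by simp
  finally have zt: "?z ^ t = 1" by simp
  have "triv_char (G\<lparr>carrier := {\<one>}\<rparr>) \<in> chars (G\<lparr>carrier := {\<one>}\<rparr>)"
    by (auto simp: chars_def triv_char_def)
  from char_extend_step[OF sg this assms(1) t, of ?z] obtain K' \<phi>' where
    K': "subgroup K' G" "x \<in> K'" "\<phi>' \<in> chars (G\<lparr>carrier := K'\<rparr>)" "\<phi>' x = ?z"
    using zt t(2) by (auto simp: triv_char_def)
  from char_extend[OF K'(1,3)] show ?thesis using K'(2,4) z1 by metis
qed

text \<open>
  Translation by an element on which the character is not 1 multiplies the sum by that value.
\<close>

lemma sum_char:
  assumes "\<xi> \<in> chars G" "\<xi> \<noteq> triv_char G"
  shows "(\<Sum>x\<in>carrier G. \<xi> x) = 0"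
proof -
  obtain y where y: "y \<in> carrier G" "\<xi> y \<noteq> 1"
    using char_eqI[OF assms(1) triv_char_in] assms(2) by (auto simp: triv_char_def)
  have "bij_betw (\<lambda>x. y \<otimes> x) (carrier G) (carrier G)"
    by (rule bij_betwI[where g = "\<lambda>x. inv y \<otimes> x"]) (use y in \<open>auto simp: m_assoc[symmetric]\<close>)
  then have "(\<Sum>x\<in>carrier G. \<xi> x) = (\<Sum>x\<in>carrier G. \<xi> (y \<otimes> x))"
    by (rule sum.reindex_bij_betw[symmetric])
  also have "\<dots> = \<xi> y * (\<Sum>x\<in>carrier G. \<xi> x)"
    using y assms by (simp add: char_mult sum_distrib_left)
  finally show ?thesis using y by simp
qed

lemma sum_over_chars_nontriv:
  assumes "x \<in> carrier G" "x \<noteq> \<one>"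
  shows "(\<Sum>\<xi>\<in>chars G. \<xi> x) = 0"
proof -
  obtain \<psi> where y: "\<psi> \<in> chars G" "\<psi> x \<noteq> 1" using char_separates[OF assms] by blast
  have i: "\<psi> y * (cnj (\<psi> y) * \<xi> y) = \<xi> y" "cnj (\<psi> y) * (\<psi> y * \<xi> y) = \<xi> y" if "\<xi> \<in> chars G" for \<xi> y
    using char_cnj_self[OF y(1), of y] char_outside[OF that, of y]
    by (cases "y \<in> carrier G"; simp add: mult.assoc[symmetric] mult.commute)+
  have "bij_betw (\<lambda>\<xi> x. \<psi> x * \<xi> x) (chars G) (chars G)"
    by (rule bij_betwI[where g = "\<lambda>\<xi> x. cnj (\<psi> x) * \<xi> x"])
      (use chars_times[OF y(1)] chars_times[OF chars_cnj[OF y(1)]] i in auto)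
  then have "(\<Sum>\<xi>\<in>chars G. \<xi> x) = (\<Sum>\<xi>\<in>chars G. \<psi> x * \<xi> x)"
    by (rule sum.reindex_bij_betw[symmetric, where g = "\<lambda>\<xi>. \<xi> x"])
  also have "\<dots> = \<psi> x * (\<Sum>\<xi>\<in>chars G. \<xi> x)" by (simp add: sum_distrib_left)
  finally show ?thesis using y by simp
qed

text \<open>
  Both numbers are the sum of all values of all characters, added up in the two possible orders.
\<close>

lemma card_chars: "card (chars G) = card (carrier G)"
proof -
  have "(\<Sum>\<xi>\<in>chars G. \<Sum>x\<in>carrier G. \<xi> x) = (\<Sum>\<xi>\<in>chars G. if \<xi> = triv_char G then of_nat (card (carrier G)) else 0)"
    by (intro sum.cong refl) (auto simp: sum_char triv_char_def)
  also have "\<dots> = of_nat (card (carrier G))" using finite_chars triv_char_in by simp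
  finally have 1: "(\<Sum>\<xi>\<in>chars G. \<Sum>x\<in>carrier G. \<xi> x) = of_nat (card (carrier G))" .
  have "(\<Sum>x\<in>carrier G. \<Sum>\<xi>\<in>chars G. \<xi> x) = (\<Sum>x\<in>carrier G. if x = \<one> then of_nat (card (chars G)) else 0)"
    by (intro sum.cong refl) (auto simp: sum_over_chars_nontriv char_one)
  also have "\<dots> = of_nat (card (chars G))" using finite_carrier by simp
  finally have "(of_nat (card (chars G)) :: complex) = of_nat (card (carrier G))"
    using 1 sum.swap[of "\<lambda>\<xi> x. \<xi> x" "carrier G" "chars G"] by simp
  then show ?thesis by (metis of_nat_eq_iff)
qed

lemma sum_over_chars:
  assumes "x \<in> carrier G"
  shows "(\<Sum>\<xi>\<in>chars G. \<xi> x) = (if x = \<one> then of_nat (card (carrier G)) else 0)"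
  using assms by (auto simp: sum_over_chars_nontriv char_one card_chars)

lemma sub_finite_comm_group:
  assumes "subgroup H G"
  shows "finite_comm_group (G\<lparr>carrier := H\<rparr>)"
proof -
  interpret H: group "G\<lparr>carrier := H\<rparr>" by (rule subgroup_imp_group[OF assms])
  have "H \<subseteq> carrier G" by (rule subgroup.subset[OF assms])
  then show ?thesis
    using finite_carrier by unfold_locales (auto intro: m_comm finite_subset)
qed

end

section \<open>Fourier coefficients of a uniform word\<close>

text \<open>
  The Fourier coefficient at \<open>\<psi>\<close> of the uniform distribution on the words of
  type \<open>M\<close>, where a character of the group of all words is a family
  \<open>\<psi>\<close> of characters, one for each position.
\<close>

definition ft :: "'i set \<Rightarrow> 'a multiset \<Rightarrow> ('i \<Rightarrow> 'a \<Rightarrow> complex) \<Rightarrow> complex"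
  where "ft I M \<psi> = (\<Sum>w\<in>words I M. \<Prod>i\<in>I. \<psi> i (w i)) / of_nat (card (words I M))"

text \<open>
  The exchangeability of the positions of a uniform word.
\<close>

lemma words_swap_sum:
  fixes h :: "('i \<Rightarrow> 'a) \<Rightarrow> 'b :: comm_monoid_add"
  assumes "finite I" "p permutes I"
  shows "(\<Sum>w\<in>words I M. h w) = (\<Sum>w\<in>words I M. h (restrict (w \<circ> p) I))"
  by (rule sum.reindex_bij_betw[OF words_permute[OF assms], symmetric])

context finite_comm_group
begin

lemma words_carrier:
  assumes "finite I" "set_mset M \<subseteq> carrier G" "w \<in> words I M" "i \<in> I"
  shows "w i \<in> carrier G"
  using words_eval[OF assms(1,3,4)] assms(2) by auto

text \<open>
  If the letters were independent, the expectation of the product would be the product of the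
  \<open>card S\<close> small means, each at most \<open>b / card I\<close>. For sampling without
  replacement, move one factor \<open>\<psi> i\<close> to any of the positions not used by the
  others, which does not change the expectation, and average. Summing over all positions instead
  gives the total of \<open>\<psi> i\<close> over the letters, which is at most \<open>b\<close>;
  the correction consists of the positions that are already in use, where \<open>\<psi> i\<close>
  merges with another character. Merging loses one factor, or two if the product is trivial, but
  there are fewer than \<open>c\<close> such positions among \<open>card I\<close>. This is why
  \<open>Y\<close> has to be of the order of \<open>b / card I + sqrt (c / card I)\<close>.
\<close>

lemma sparse_char_sum_bound:
  fixes I :: "'i set" and M :: "'a multiset" and b Y :: real and c :: nat
  assumes I: "finite I" and M: "size M = card I" "set_mset M \<subseteq> carrier G"
    and b: "\<And>\<xi>. \<xi> \<in> chars G \<Longrightarrow> \<xi> \<noteq> triv_char G \<Longrightarrow> norm (\<Sum>v\<in>#M. \<xi> v) \<le> b"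
    and Y: "0 < Y" "Y \<le> 1" "6 * b \<le> Y * card I" and c: "2 * c \<le> card I" "12 * c \<le> Y ^ 2 * card I"
    and S: "S \<subseteq> I" "card S \<le> c" and \<psi>: "\<And>i. i \<in> S \<Longrightarrow> \<psi> i \<in> chars G \<and> \<psi> i \<noteq> triv_char G"
  shows "norm (\<Sum>w\<in>words I M. \<Prod>i\<in>S. \<psi> i (w i)) \<le> Y ^ card S * card (words I M)"
  using S \<psi>
proof (induction "card S" arbitrary: S \<psi> rule: less_induct)
  case less
  let ?W = "words I M" and ?n = "real (card I)"
  have finS: "finite S" using less.prems(1) I finite_subset by blast
  show ?case
  proof (cases "S = {}")
    case False
    then obtain i where i: "i \<in> S" by blast
    define S' where "S' = S - {i}"
    define m where "m = card S"
    have finS': "finite S'" "S' \<subseteq> I" "i \<notin> S'" using finS less.prems(1) by (auto simp: S'_def)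
    have cS': "card S' = m - 1" "m \<ge> 1" using i finS by (auto simp: S'_def m_def Suc_le_eq card_gt_0_iff)
    have mc: "m \<le> c" using less.prems m_def by simp
    \<comment> \<open>The value of the sum after the factor at i has been moved to the position i'.\<close>
    define F where "F i' = (\<Sum>w\<in>?W. (\<Prod>j\<in>S'. \<psi> j (w j)) * \<psi> i (w i'))" for i'
    have n0: "?n > 0" using i less.prems(1) I by (auto simp: card_gt_0_iff)
    have F1: "F i' = F i" if i': "i' \<in> I - S'" for i'
    proof -
      let ?p = "Transposition.transpose i i'"
      have p: "?p permutes I" using i' i less.prems(1) by (intro permutes_swap_id) auto
      have "F i' = (\<Sum>w\<in>?W. (\<Prod>j\<in>S'. \<psi> j (restrict (w \<circ> ?p) I j)) * \<psi> i (restrict (w \<circ> ?p) I i'))"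
        unfolding F_def by (rule words_swap_sum[OF I p])
      also have "\<dots> = F i"
        unfolding F_def
      proof (intro sum.cong refl arg_cong2[where f = "(*)"] prod.cong)
        fix w j assume "j \<in> S'"
        then have "j \<noteq> i" "j \<noteq> i'" "j \<in> I" using i' finS' by auto
        then have "?p j = j" "j \<in> I" by (simp_all add: transpose_apply_other)
        then show "\<psi> j (restrict (w \<circ> ?p) I j) = \<psi> j (w j)" by simp
      next
        fix w show "\<psi> i (restrict (w \<circ> ?p) I i') = \<psi> i (w i)" using i' by simp
      qed
      finally show ?thesis .
    qed
    have F2: "(\<Sum>i'\<in>I - S'. F i') = of_nat (card (I - S')) * F i"
      using F1 by simp
    have F3: "(\<Sum>i'\<in>I - S'. F i') = (\<Sum>i'\<in>I. F i') - (\<Sum>i'\<in>S'. F i')"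
      using sum.subset_diff[OF finS'(2) I, of F] by simp
    have F4: "(\<Sum>i'\<in>I. F i') = (\<Sum>v\<in>#M. \<psi> i v) * (\<Sum>w\<in>?W. \<Prod>j\<in>S'. \<psi> j (w j))"
    proof -
      have "(\<Sum>i'\<in>I. F i') = (\<Sum>w\<in>?W. (\<Prod>j\<in>S'. \<psi> j (w j)) * (\<Sum>i'\<in>I. \<psi> i (w i')))"
        unfolding F_def by (subst sum.swap) (simp add: sum_distrib_left)
      also have "\<dots> = (\<Sum>w\<in>?W. (\<Prod>j\<in>S'. \<psi> j (w j)) * (\<Sum>v\<in>#M. \<psi> i v))"
        by (intro sum.cong refl) (simp add: words_sum_mset[of _ _ _ "\<psi> i"])
      finally show ?thesis by (simp add: sum_distrib_left sum_distrib_right mult.commute)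
    qed
    have IH1: "norm (\<Sum>w\<in>?W. \<Prod>j\<in>S'. \<psi> j (w j)) \<le> Y ^ (m - 1) * card ?W"
      using less.hyps[of S' \<psi>] less.prems cS' finS' mc m_def S'_def by auto
    have F5: "norm (F j) \<le> Y ^ (m - 2) * card ?W" if j: "j \<in> S'" for j
    proof -
      define \<psi>' where "\<psi>' = \<psi>(j := (\<lambda>x. \<psi> j x * \<psi> i x))"
      have jS: "j \<in> S" "j \<in> I" "j \<noteq> i" using j finS' S'_def by auto
      have \<psi>'c: "\<psi>' l \<in> chars G" if "l \<in> S'" for l
        using that less.prems(3) jS i unfolding \<psi>'_def S'_def by (auto intro: chars_times)
      have sp: "(\<Prod>l\<in>S'. \<psi>' l (w l)) = \<psi>' j (w j) * (\<Prod>l\<in>S' - {j}. \<psi> l (w l))" for w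
        by (subst prod.remove[OF finS'(1) j]) (auto simp: \<psi>'_def intro!: prod.cong arg_cong2[where f = "(*)"])
      have sp2: "(\<Prod>l\<in>S'. \<psi> l (w l)) = \<psi> j (w j) * (\<Prod>l\<in>S' - {j}. \<psi> l (w l))" for w
        by (subst prod.remove[OF finS'(1) j]) simp
      have Fj: "F j = (\<Sum>w\<in>?W. \<Prod>l\<in>S'. \<psi>' l (w l))"
        unfolding F_def sp sp2 by (intro sum.cong refl) (simp add: \<psi>'_def)
      have "card S' > 0" using j finS' by (auto simp: card_gt_0_iff)
      then have m2: "m \<ge> 2" "card (S' - {j}) = m - 2" using j cS' by (simp_all add: card_Diff_singleton)
      show ?thesis
      proof (cases "\<psi>' j = triv_char G")
        case False
        have "norm (F j) \<le> Y ^ (m - 1) * card ?W"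
          unfolding Fj
        proof -
          have "\<psi>' l \<in> chars G \<and> \<psi>' l \<noteq> triv_char G" if "l \<in> S'" for l
            using \<psi>'c[OF that] False less.prems(3)[of l] that by (cases "l = j") (auto simp: \<psi>'_def S'_def)
          then show "norm (\<Sum>w\<in>?W. \<Prod>l\<in>S'. \<psi>' l (w l)) \<le> Y ^ (m - 1) * card ?W"
            using less.hyps[of S' \<psi>'] cS' finS'(2) mc m_def by simp
        qed
        also have "\<dots> \<le> Y ^ (m - 2) * card ?W"
          using Y m2 by (intro mult_right_mono power_decreasing) auto
        finally show ?thesis .
      next
        case True
        have "F j = (\<Sum>w\<in>?W. \<Prod>l\<in>S' - {j}. \<psi> l (w l))"
          unfolding Fj sp True
          by (intro sum.cong refl) (use words_carrier[OF I M(2)] jS in \<open>auto simp: triv_char_def\<close>)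
        then show ?thesis
          using less.hyps[of "S' - {j}" \<psi>] less.prems m2 finS' mc m_def by (auto simp: S'_def)
      qed
    qed
    have b0: "norm (\<Sum>v\<in>#M. \<psi> i v) \<le> b" using b less.prems(3) i by blast
    have "real (card (I - S')) * norm (F i) = norm (\<Sum>i'\<in>I - S'. F i')" unfolding F2 by (simp add: norm_mult)
    also have "\<dots> \<le> norm (\<Sum>v\<in>#M. \<psi> i v) * norm (\<Sum>w\<in>?W. \<Prod>j\<in>S'. \<psi> j (w j)) + norm (\<Sum>i'\<in>S'. F i')"
      unfolding F3 F4 norm_mult[symmetric] by (rule norm_triangle_ineq4)
    also have "\<dots> \<le> b * (Y ^ (m - 1) * card ?W) + (\<Sum>i'\<in>S'. Y ^ (m - 2) * card ?W)"
    proof (rule add_mono)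
      show "norm (\<Sum>i'\<in>S'. F i') \<le> (\<Sum>i'\<in>S'. Y ^ (m - 2) * card ?W)"
        by (rule order_trans[OF norm_sum sum_mono[OF F5]])
    qed (rule mult_mono[OF b0 IH1 order_trans[OF norm_ge_zero b0] norm_ge_zero])
    also have "\<dots> = (b * Y ^ (m - 1) + real (m - 1) * Y ^ (m - 2)) * card ?W"
      using cS' by (simp add: algebra_simps)
    also have "\<dots> \<le> (?n / 2 * Y ^ m) * card ?W"
    proof (rule mult_right_mono)
      have "b * Y ^ (m - 1) \<le> (Y * ?n / 6) * Y ^ (m - 1)" using Y by (intro mult_right_mono) auto
      also have "\<dots> = ?n / 6 * Y ^ m" using cS' by (cases m) auto
      finally have 1: "b * Y ^ (m - 1) \<le> ?n / 6 * Y ^ m" .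
      have 2: "real (m - 1) * Y ^ (m - 2) \<le> ?n / 6 * Y ^ m"
      proof (cases "m = 1")
        case True then show ?thesis using Y by simp
      next
        case False
        then have l: "m = (m - 2) + 2" using cS'(2) by simp
        have "real (m - 1) * Y ^ (m - 2) \<le> (Y ^ 2 * ?n / 6) * Y ^ (m - 2)"
          using Y c mc by (intro mult_right_mono) auto
        also have "\<dots> = ?n / 6 * Y ^ m" by (subst (2) l) (simp add: power_add power2_eq_square algebra_simps)
        finally show ?thesis .
      qed
      have "0 \<le> ?n * Y ^ m" using Y by simp
      then show "b * Y ^ (m - 1) + real (m - 1) * Y ^ (m - 2) \<le> ?n / 2 * Y ^ m" using 1 2 by simp
    qed simp
    finally have up: "real (card (I - S')) * norm (F i) \<le> ?n / 2 * Y ^ m * card ?W" .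
    have "card (I - S') = card I - (m - 1)" using finS' cS' by (simp add: card_Diff_subset)
    then have "?n / 2 \<le> real (card (I - S'))" using mc c(1) cS'(2) by linarith
    then have "?n / 2 * norm (F i) \<le> real (card (I - S')) * norm (F i)" by (intro mult_right_mono) auto
    with up have "?n / 2 * norm (F i) \<le> ?n / 2 * (Y ^ m * card ?W)" by (simp add: algebra_simps)
    then have "norm (F i) \<le> Y ^ m * card ?W" using n0 by (simp only: mult_le_cancel_left)
    moreover have "F i = (\<Sum>w\<in>?W. \<Prod>j\<in>S. \<psi> j (w j))"
      unfolding F_def S'_def prod.remove[OF finS i] by (simp only: mult.commute)
    ultimately show ?thesis by (simp add: m_def)
  qed simp
qed

lemma prod_mset_char_norm:
  assumes "set_mset M \<subseteq> carrier G" "\<xi> \<in> chars G"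
  shows "norm (\<Prod>v\<in>#M. \<xi> v) = 1"
  using assms(1) by (induction M) (auto simp: norm_mult char_norm[OF assms(2)])

text \<open>
  A factor that is common to all positions contributes \<open>\<xi>\<close> of the product of all
  letters, a constant of modulus one, so a nearly constant family behaves like one with few
  nontrivial characters.
\<close>

lemma ft_near_const:
  fixes I :: "'i set" and M :: "'a multiset" and b Y :: real and c :: nat
  assumes I: "finite I" and M: "size M = card I" "set_mset M \<subseteq> carrier G"
    and b: "\<And>\<xi>. \<xi> \<in> chars G \<Longrightarrow> \<xi> \<noteq> triv_char G \<Longrightarrow> norm (\<Sum>v\<in>#M. \<xi> v) \<le> b"
    and Y: "0 < Y" "Y \<le> 1" "6 * b \<le> Y * card I" and c: "2 * c \<le> card I" "12 * c \<le> Y ^ 2 * card I"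
    and \<psi>: "\<And>i. i \<in> I \<Longrightarrow> \<psi> i \<in> chars G" and \<xi>: "\<xi> \<in> chars G"
    and S: "card {i \<in> I. \<psi> i \<noteq> \<xi>} \<le> c"
  shows "norm (ft I M \<psi>) \<le> Y ^ card {i \<in> I. \<psi> i \<noteq> \<xi>}"
proof -
  let ?S = "{i \<in> I. \<psi> i \<noteq> \<xi>}"
  define \<psi>' where "\<psi>' i = (\<lambda>x. \<psi> i x * cnj (\<xi> x))" for i
  have nt: "\<psi>' i \<in> chars G \<and> \<psi>' i \<noteq> triv_char G" if "i \<in> ?S" for i
  proof
    show "\<psi>' i \<in> chars G" unfolding \<psi>'_def using that \<psi> \<xi> by (intro chars_times chars_cnj) auto
    show "\<psi>' i \<noteq> triv_char G"
    proof
      assume e: "\<psi>' i = triv_char G"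
      have "\<psi> i = \<xi>"
      proof (rule char_eqI[OF \<psi> \<xi>])
        show "i \<in> I" using that by simp
        fix x assume x: "x \<in> carrier G"
        have "\<psi> i x = \<psi> i x * (\<xi> x * cnj (\<xi> x))" using char_cnj_self[OF \<xi> x] by simp
        also have "\<dots> = \<psi>' i x * \<xi> x" by (simp add: \<psi>'_def)
        also have "\<dots> = \<xi> x" using e x by (simp add: triv_char_def)
        finally show "\<psi> i x = \<xi> x" .
      qed
      then show False using that by simp
    qed
  qed
  have main: "norm (\<Sum>w\<in>words I M. \<Prod>i\<in>?S. \<psi>' i (w i)) \<le> Y ^ card ?S * card (words I M)"
    by (rule sparse_char_sum_bound[OF I M b Y c _ S nt]) auto
  have "(\<Sum>w\<in>words I M. \<Prod>i\<in>I. \<psi> i (w i)) = (\<Sum>w\<in>words I M. (\<Prod>v\<in>#M. \<xi> v) * (\<Prod>i\<in>?S. \<psi>' i (w i)))"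
  proof (intro sum.cong refl)
    fix w assume w: "w \<in> words I M"
    have wc: "w i \<in> carrier G" if "i \<in> I" for i using words_carrier[OF I M(2) w that] .
    have "(\<Prod>i\<in>I. \<psi> i (w i)) = (\<Prod>i\<in>I. \<xi> (w i) * \<psi>' i (w i))"
      using char_cnj_self[OF \<xi> wc] by (intro prod.cong refl) (simp add: \<psi>'_def mult_ac)
    also have "\<dots> = (\<Prod>v\<in>#M. \<xi> v) * (\<Prod>i\<in>I. \<psi>' i (w i))"
      using words_prod_mset[OF w, of \<xi>] by (simp add: prod.distrib)
    also have "(\<Prod>i\<in>I. \<psi>' i (w i)) = (\<Prod>i\<in>?S. \<psi>' i (w i))"
      by (rule prod.mono_neutral_right) (use I char_cnj_self[OF \<xi> wc] in \<open>auto simp: \<psi>'_def\<close>)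
    finally show "(\<Prod>i\<in>I. \<psi> i (w i)) = (\<Prod>v\<in>#M. \<xi> v) * (\<Prod>i\<in>?S. \<psi>' i (w i))" .
  qed
  also have "\<dots> = (\<Prod>v\<in>#M. \<xi> v) * (\<Sum>w\<in>words I M. \<Prod>i\<in>?S. \<psi>' i (w i))"
    by (simp add: sum_distrib_left)
  finally have "norm (\<Sum>w\<in>words I M. \<Prod>i\<in>I. \<psi> i (w i)) = norm (\<Sum>w\<in>words I M. \<Prod>i\<in>?S. \<psi>' i (w i))"
    using prod_mset_char_norm[OF M(2) \<xi>] by (simp add: norm_mult)
  moreover have "real (card (words I M)) > 0" using card_words_pos[OF I M(1)] by simp
  ultimately show ?thesis using main unfolding ft_def by (simp add: norm_divide divide_le_eq)
qed

text \<open>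
  Parseval: the squares add up to \<open>card (carrier G) ^ card I\<close> times the collision
  probability of two uniform words.
\<close>

lemma ft_L2:
  assumes I: "finite I" and M: "size M = card I" "set_mset M \<subseteq> carrier G"
  shows "(\<Sum>\<psi>\<in>PiE I (\<lambda>_. chars G). norm (ft I M \<psi>) ^ 2) = real (order G) ^ card I / card (words I M)"
proof -
  let ?W = "words I M" and ?P = "PiE I (\<lambda>_. chars G)"
  have fW: "finite ?W" by (rule finite_words[OF I])
  have orth: "(\<Sum>\<psi>\<in>?P. (\<Prod>i\<in>I. \<psi> i (w i)) * cnj (\<Prod>i\<in>I. \<psi> i (w' i))) = (if w = w' then of_nat (order G) ^ card I else 0)"
    if w: "w \<in> ?W" "w' \<in> ?W" for w w'
  proof -
    have c: "w i \<in> carrier G" "w' i \<in> carrier G" if "i \<in> I" for i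
      using words_carrier[OF I M(2)] w that by auto
    have "(\<Sum>\<psi>\<in>?P. (\<Prod>i\<in>I. \<psi> i (w i)) * cnj (\<Prod>i\<in>I. \<psi> i (w' i))) = (\<Sum>\<psi>\<in>?P. \<Prod>i\<in>I. \<psi> i (w i) * cnj (\<psi> i (w' i)))"
      by (simp add: prod.distrib)
    also have "\<dots> = (\<Prod>i\<in>I. \<Sum>\<xi>\<in>chars G. \<xi> (w i) * cnj (\<xi> (w' i)))"
      by (rule prod_sum_PiE[symmetric]) (use I finite_chars in auto)
    also have "\<dots> = (\<Prod>i\<in>I. \<Sum>\<xi>\<in>chars G. \<xi> (w i \<otimes> inv (w' i)))"
      by (intro prod.cong sum.cong refl) (simp add: c char_mult char_inv)
    also have "\<dots> = (\<Prod>i\<in>I. if w i = w' i then of_nat (order G) else 0)"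
    proof (intro prod.cong refl)
      fix i assume "i \<in> I"
      then have "(w i \<otimes> inv (w' i) = \<one>) = (w i = w' i)"
        using c by (metis inv_equality inv_inv inv_closed r_inv)
      then show "(\<Sum>\<xi>\<in>chars G. \<xi> (w i \<otimes> inv (w' i))) = (if w i = w' i then of_nat (order G) else 0)"
        using c[OF \<open>i \<in> I\<close>] by (simp add: sum_over_chars order_def)
    qed
    also have "\<dots> = (if w = w' then of_nat (order G) ^ card I else 0)"
    proof (cases "w = w'")
      case False
      then obtain i where "i \<in> I" "w i \<noteq> w' i" using w by (auto simp: words_def intro: extensionalityI)
      then show ?thesis using False I by (auto intro!: prod_zero)
    qed simp
    finally show ?thesis .
  qed
  have "complex_of_real (\<Sum>\<psi>\<in>?P. norm (\<Sum>w\<in>?W. \<Prod>i\<in>I. \<psi> i (w i)) ^ 2)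
    = (\<Sum>\<psi>\<in>?P. (\<Sum>w\<in>?W. \<Prod>i\<in>I. \<psi> i (w i)) * cnj (\<Sum>w\<in>?W. \<Prod>i\<in>I. \<psi> i (w i)))"
    by (simp only: of_real_sum complex_norm_square)
  also have "\<dots> = (\<Sum>\<psi>\<in>?P. \<Sum>w\<in>?W. \<Sum>w'\<in>?W. (\<Prod>i\<in>I. \<psi> i (w i)) * cnj (\<Prod>i\<in>I. \<psi> i (w' i)))"
    by (simp only: sum_product cnj_sum)
  also have "\<dots> = (\<Sum>w\<in>?W. \<Sum>w'\<in>?W. \<Sum>\<psi>\<in>?P. (\<Prod>i\<in>I. \<psi> i (w i)) * cnj (\<Prod>i\<in>I. \<psi> i (w' i)))"
    by (subst sum.swap) (intro sum.cong refl sum.swap)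
  also have "\<dots> = (\<Sum>w\<in>?W. \<Sum>w'\<in>?W. if w = w' then of_nat (order G) ^ card I else 0)"
    by (intro sum.cong refl orth)
  also have "\<dots> = complex_of_real (card ?W * real (order G) ^ card I)"
    using fW by simp
  finally have "(\<Sum>\<psi>\<in>?P. norm (\<Sum>w\<in>?W. \<Prod>i\<in>I. \<psi> i (w i)) ^ 2) = card ?W * real (order G) ^ card I"
    by (simp only: of_real_eq_iff)
  then show ?thesis
    unfolding ft_def using card_words_pos[OF I M(1)]
    by (simp add: norm_divide power_divide sum_divide_distrib[symmetric]) (simp add: power2_eq_square)
qed

lemma ft_type_invariant:
  assumes I: "finite I" and "\<psi> \<in> words I Q" "\<psi>' \<in> words I Q"
  shows "ft I M \<psi> = ft I M \<psi>'"
proof -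
  obtain p where p: "p permutes I" "\<And>i. i \<in> I \<Longrightarrow> \<psi> i = \<psi>' (p i)"
    using words_transitive[OF assms] by blast
  have "(\<Sum>w\<in>words I M. \<Prod>i\<in>I. \<psi>' i (w i)) = (\<Sum>w\<in>words I M. \<Prod>i\<in>I. \<psi>' (p i) (w (p i)))"
    by (intro sum.cong refl prod.reindex_bij_betw[symmetric] permutes_imp_bij p)
  also have "\<dots> = (\<Sum>w\<in>words I M. \<Prod>i\<in>I. \<psi> i (restrict (w \<circ> p) I i))"
    by (intro sum.cong prod.cong refl) (simp add: p)
  also have "\<dots> = (\<Sum>w\<in>words I M. \<Prod>i\<in>I. \<psi> i (w i))"
    by (rule words_swap_sum[OF I p(1), symmetric])
  finally show ?thesis by (simp add: ft_def)
qed

text \<open>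
  All rearrangements of \<open>\<psi>\<close> have the same coefficient, so it cannot be large if
  there are many of them.
\<close>

lemma ft_bound_by_type_size:
  assumes I: "finite I" and M: "size M = card I" "set_mset M \<subseteq> carrier G"
    and \<psi>: "\<psi> \<in> PiE I (\<lambda>_. chars G)"
  shows "card (words I (image_mset \<psi> (mset_set I))) * norm (ft I M \<psi>) ^ 2 \<le> real (order G) ^ card I / card (words I M)"
proof -
  let ?T = "words I (image_mset \<psi> (mset_set I))"
  have T: "?T \<subseteq> PiE I (\<lambda>_. chars G)" by (rule words_PiE[OF I]) (use \<psi> I in auto)
  have "\<psi> \<in> ?T" by (rule self_in_words) (use \<psi> in \<open>simp add: PiE_iff\<close>)
  then have inv: "ft I M \<psi>' = ft I M \<psi>" if "\<psi>' \<in> ?T" for \<psi>'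
    by (rule ft_type_invariant[OF I that])
  have "card ?T * norm (ft I M \<psi>) ^ 2 = (\<Sum>\<psi>'\<in>?T. norm (ft I M \<psi>) ^ 2)" by simp
  also have "\<dots> = (\<Sum>\<psi>'\<in>?T. norm (ft I M \<psi>') ^ 2)"
    by (intro sum.cong refl) (simp only: inv)
  also have "\<dots> \<le> (\<Sum>\<psi>\<in>PiE I (\<lambda>_. chars G). norm (ft I M \<psi>) ^ 2)"
    by (rule sum_mono2) (use T I finite_chars in \<open>auto intro!: finite_PiE\<close>)
  finally show ?thesis using ft_L2[OF I M] by simp
qed

end

section \<open>Flat types have small Fourier coefficients\<close>

lemma sum_mset_count:
  fixes f :: "'a \<Rightarrow> 'b :: comm_semiring_1"
  assumes "finite A" "set_mset M \<subseteq> A"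
  shows "(\<Sum>v\<in>#M. f v) = (\<Sum>v\<in>A. of_nat (count M v) * f v)"
  using assms(2)
proof (induction M)
  case (add x M)
  have "(\<Sum>v\<in>A. of_nat (count (add_mset x M) v) * f v) = (\<Sum>v\<in>A. of_nat (count M v) * f v + (if v = x then f v else 0))"
    by (intro sum.cong refl) (auto simp: algebra_simps)
  then show ?case using add assms(1) by (simp add: sum.distrib add.commute)
qed simp

lemma sum_count:
  assumes "finite A" "set_mset M \<subseteq> A"
  shows "(\<Sum>v\<in>A. count M v) = size M"
  using sum_mset_count[OF assms, of "\<lambda>_. 1 :: nat"] by simp

lemma sum_UN_le:
  fixes f :: "'a \<Rightarrow> real"
  assumes "finite J" "\<And>j. j \<in> J \<Longrightarrow> finite (A j)" "\<And>x. 0 \<le> f x"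
  shows "sum f (\<Union>j\<in>J. A j) \<le> (\<Sum>j\<in>J. sum f (A j))"
  using assms(1,2)
proof (induction J)
  case (insert j J)
  have fin: "finite (A j)" "finite (\<Union>j\<in>J. A j)" using insert by auto
  have "sum f (A j \<union> (\<Union>j\<in>J. A j)) \<le> sum f (A j) + sum f (\<Union>j\<in>J. A j)"
    using sum.union_inter[OF fin, of f] sum_nonneg[of "A j \<inter> (\<Union>j\<in>J. A j)" f] assms(3) by simp
  then show ?case using insert by simp
qed simp

lemma count_image_mset_set:
  assumes "finite I"
  shows "count (image_mset f (mset_set I)) x = card {i \<in> I. f i = x}"
proof -
  have "count (image_mset f (mset_set I)) x = (\<Sum>i\<in>f -` {x} \<inter> I. count (mset_set I) i)"
    using assms by (simp add: count_image_mset)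
  also have "\<dots> = (\<Sum>i\<in>f -` {x} \<inter> I. 1)"
    by (rule sum.cong) (use assms in auto)
  also have "f -` {x} \<inter> I = {i \<in> I. f i = x}" by auto
  finally show ?thesis by simp
qed

lemma card_off_set:
  assumes "finite I" "finite C" "B \<subseteq> C" "m \<le> card I"
  shows "card {\<psi> \<in> PiE I (\<lambda>_. C). card {i \<in> I. \<psi> i \<notin> B} = m}
    \<le> (card I choose m) * (card C ^ m * card B ^ (card I - m))"
proof -
  let ?S = "{S. S \<subseteq> I \<and> card S = m}"
  let ?F = "\<lambda>S. PiE I (\<lambda>i. if i \<in> S then C else B)"
  have fin: "finite ?S" "finite B" using assms finite_subset by auto
  have "{\<psi> \<in> PiE I (\<lambda>_. C). card {i \<in> I. \<psi> i \<notin> B} = m} \<subseteq> (\<Union>S\<in>?S. ?F S)"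
  proof
    fix \<psi> assume \<psi>: "\<psi> \<in> {\<psi> \<in> PiE I (\<lambda>_. C). card {i \<in> I. \<psi> i \<notin> B} = m}"
    then have "\<psi> \<in> ?F {i \<in> I. \<psi> i \<notin> B}" by (auto simp: PiE_iff)
    moreover have "{i \<in> I. \<psi> i \<notin> B} \<in> ?S" using \<psi> by simp
    ultimately show "\<psi> \<in> (\<Union>S\<in>?S. ?F S)" by (rule UN_I[rotated])
  qed
  then have "card {\<psi> \<in> PiE I (\<lambda>_. C). card {i \<in> I. \<psi> i \<notin> B} = m} \<le> card (\<Union>S\<in>?S. ?F S)"
    by (rule card_mono[rotated]) (use fin assms in \<open>auto intro!: finite_PiE\<close>)
  also have "\<dots> \<le> (\<Sum>S\<in>?S. card (?F S))" by (rule card_UN_le[OF fin(1)])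
  also have "\<dots> = (\<Sum>S\<in>?S. card C ^ m * card B ^ (card I - m))"
  proof (intro sum.cong refl)
    fix S assume S: "S \<in> ?S"
    have "card (?F S) = (\<Prod>i\<in>I. if i \<in> S then card C else card B)"
      by (subst card_PiE[OF assms(1)]) (intro prod.cong refl, auto)
    also have "\<dots> = card C ^ card S * card B ^ card (I - S)"
      using S assms(1) by (simp add: prod.If_cases Int_absorb1 Diff_eq[symmetric] Collect_mem_eq)
    finally show "card (?F S) = card C ^ m * card B ^ (card I - m)"
      using S assms(1) finite_subset[of S I] by (simp add: card_Diff_subset)
  qed
  finally show ?thesis using n_subsets[OF assms(1), of m] by simp
qed

lemma card_off_const:
  assumes "finite I" "finite C" "\<xi> \<in> C"
  shows "card {\<psi> \<in> PiE I (\<lambda>_. C). card {i \<in> I. \<psi> i \<noteq> \<xi>} = m} \<le> (card I * card C) ^ m"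
proof (cases "m \<le> card I")
  case True
  have "card {\<psi> \<in> PiE I (\<lambda>_. C). card {i \<in> I. \<psi> i \<noteq> \<xi>} = m} \<le> (card I choose m) * card C ^ m"
    using card_off_set[OF assms(1,2), of "{\<xi>}" m] True assms(3) by simp
  also have "\<dots> \<le> card I ^ m * card C ^ m"
    by (intro mult_right_mono binomial_le_pow True) simp
  finally show ?thesis by (simp add: power_mult_distrib)
next
  case False
  have "card {i \<in> I. \<psi> i \<noteq> \<xi>} \<le> card I" for \<psi>
    by (rule card_mono[OF assms(1)]) auto
  then have "card {i \<in> I. \<psi> i \<noteq> \<xi>} \<noteq> m" for \<psi>
    using False by metis
  then show ?thesis by simp
qed

context finite_comm_group
begin

text \<open>
  Parseval for the letter counts.
\<close>

lemma char_sum_count: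
  assumes "set_mset M \<subseteq> carrier G"
  shows "(\<Sum>\<xi>\<in>chars G. norm (\<Sum>v\<in>#M. \<xi> v) ^ 2) = real (order G) * (\<Sum>v\<in>carrier G. real (count M v) ^ 2)"
proof -
  let ?c = "\<lambda>v. of_nat (count M v) :: complex"
  have "complex_of_real (\<Sum>\<xi>\<in>chars G. norm (\<Sum>v\<in>#M. \<xi> v) ^ 2)
    = (\<Sum>\<xi>\<in>chars G. (\<Sum>v\<in>carrier G. ?c v * \<xi> v) * cnj (\<Sum>v\<in>carrier G. ?c v * \<xi> v))"
    by (simp only: of_real_sum complex_norm_square sum_mset_count[OF finite_carrier assms])
  also have "\<dots> = (\<Sum>\<xi>\<in>chars G. \<Sum>v\<in>carrier G. \<Sum>v'\<in>carrier G. ?c v * ?c v' * \<xi> (v \<otimes> inv v'))"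
    by (simp add: sum_product cnj_sum char_mult char_inv mult_ac cong: sum.cong)
  also have "\<dots> = (\<Sum>v\<in>carrier G. \<Sum>v'\<in>carrier G. ?c v * ?c v' * (\<Sum>\<xi>\<in>chars G. \<xi> (v \<otimes> inv v')))"
    unfolding sum_distrib_left by (subst sum.swap) (intro sum.cong refl sum.swap)
  also have "\<dots> = (\<Sum>v\<in>carrier G. \<Sum>v'\<in>carrier G. if v = v' then of_nat (order G) * ?c v ^ 2 else 0)"
  proof (intro sum.cong refl)
    fix v v' assume v: "v \<in> carrier G" "v' \<in> carrier G"
    then have "(v \<otimes> inv v' = \<one>) = (v = v')" by (metis inv_equality inv_inv inv_closed r_inv)
    then show "?c v * ?c v' * (\<Sum>\<xi>\<in>chars G. \<xi> (v \<otimes> inv v')) = (if v = v' then of_nat (order G) * ?c v ^ 2 else 0)"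
      using v by (simp add: sum_over_chars order_def power2_eq_square)
  qed
  also have "\<dots> = complex_of_real (real (order G) * (\<Sum>v\<in>carrier G. real (count M v) ^ 2))"
    using finite_carrier by (simp add: sum_distrib_left)
  finally show ?thesis by (simp only: of_real_eq_iff)
qed

text \<open>
  If all nontrivial character sums are at most \<open>b\<close>, then the letter frequencies are
  uniform up to \<open>b / card I\<close> in quadratic mean, by Parseval, and the relative entropy
  \<open>\<Sum> c log (k c / n)\<close> is at most \<open>k b^2 / n\<close>. The method of types
  turns this into a bound for the number of words.
\<close>

lemma card_words_near_uniform:
  assumes I: "finite I" "I \<noteq> {}" and M: "size M = card I" "set_mset M \<subseteq> carrier G"
    and b: "\<And>\<xi>. \<xi> \<in> chars G \<Longrightarrow> \<xi> \<noteq> triv_char G \<Longrightarrow> norm (\<Sum>v\<in>#M. \<xi> v) \<le> b"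
  shows "real (order G) ^ card I / card (words I M)
    \<le> (real (card I) + 1) ^ order G * exp (real (order G) * b ^ 2 / card I)"
proof -
  let ?n = "real (card I)" and ?k = "real (order G)" and ?c = "\<lambda>v. real (count M v)" and ?N = "real (card (words I M))"
  have n: "?n > 0" using I by (simp add: card_gt_0_iff)
  have k: "?k > 0" using order_pos by simp
  have N: "?N > 0" using card_words_pos[OF I(1) M(1)] by simp
  have sc: "(\<Sum>v\<in>carrier G. ?c v) = ?n"
    using sum_count[OF finite_carrier M(2)] M(1) by (metis of_nat_sum)
  have "?k * (\<Sum>v\<in>carrier G. ?c v ^ 2) = (\<Sum>\<xi>\<in>chars G. norm (\<Sum>v\<in>#M. \<xi> v) ^ 2)"
    using char_sum_count[OF M(2)] by simp
  also have "\<dots> = norm (\<Sum>v\<in>#M. triv_char G v) ^ 2 + (\<Sum>\<xi>\<in>chars G - {triv_char G}. norm (\<Sum>v\<in>#M. \<xi> v) ^ 2)"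
    by (rule sum.remove[OF finite_chars triv_char_in])
  also have "(\<Sum>v\<in>#M. triv_char G v) = of_nat (card I)"
  proof -
    have "(\<Sum>v\<in>#M. triv_char G v) = (\<Sum>v\<in>#M. 1)"
      by (rule arg_cong[where f = sum_mset], rule image_mset_cong) (use M in \<open>auto simp: triv_char_def\<close>)
    then show ?thesis using M by simp
  qed
  also have "(\<Sum>\<xi>\<in>chars G - {triv_char G}. norm (\<Sum>v\<in>#M. \<xi> v) ^ 2) \<le> (\<Sum>\<xi>\<in>chars G - {triv_char G}. b ^ 2)"
    by (intro sum_mono power_mono b) auto
  also have "(\<Sum>\<xi>\<in>chars G - {triv_char G}. b ^ 2) \<le> ?k * b ^ 2"
    using finite_chars triv_char_in by (simp add: card_chars order_def card_Diff_singleton mult_right_mono)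
  finally have sq: "?k * (\<Sum>v\<in>carrier G. ?c v ^ 2) \<le> ?n ^ 2 + ?k * b ^ 2" by simp
  have "?k ^ card I * (\<Prod>v\<in>carrier G. (?c v / ?n) ^ count M v) = (\<Prod>v\<in>carrier G. (?k * ?c v / ?n) ^ count M v)"
  proof -
    have "?k ^ card I = (\<Prod>v\<in>carrier G. ?k ^ count M v)"
      using sum_count[OF finite_carrier M(2)] M(1) by (simp add: power_sum[symmetric])
    then show ?thesis by (simp add: prod.distrib[symmetric] power_mult_distrib[symmetric])
  qed
  also have "\<dots> \<le> (\<Prod>v\<in>carrier G. exp (?c v * (?k * ?c v / ?n - 1)))"
  proof (intro prod_mono conjI)
    fix v
    have "?k * ?c v / ?n \<le> exp (?k * ?c v / ?n - 1)" using exp_ge_add_one_self[of "?k * ?c v / ?n - 1"] by simp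
    then have "(?k * ?c v / ?n) ^ count M v \<le> exp (?k * ?c v / ?n - 1) ^ count M v"
      using k n by (intro power_mono) auto
    then show "(?k * ?c v / ?n) ^ count M v \<le> exp (?c v * (?k * ?c v / ?n - 1))"
      by (simp add: exp_of_nat_mult)
  qed (use k n in auto)
  also have "\<dots> = exp (\<Sum>v\<in>carrier G. ?c v * (?k * ?c v / ?n - 1))"
    by (rule exp_sum[OF finite_carrier, symmetric])
  also have "(\<Sum>v\<in>carrier G. ?c v * (?k * ?c v / ?n - 1)) = (?k * (\<Sum>v\<in>carrier G. ?c v ^ 2)) / ?n - ?n"
  proof -
    have "(\<Sum>v\<in>carrier G. ?c v * (?k * ?c v / ?n - 1)) = (\<Sum>v\<in>carrier G. ?k / ?n * ?c v ^ 2 - ?c v)"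
      by (intro sum.cong refl) (simp add: algebra_simps power2_eq_square)
    also have "\<dots> = ?k / ?n * (\<Sum>v\<in>carrier G. ?c v ^ 2) - ?n"
      by (simp add: sum_subtractf sum_distrib_left sc)
    finally show ?thesis by simp
  qed
  also have "exp \<dots> \<le> exp (?k * b ^ 2 / ?n)"
    using divide_right_mono[OF sq, of ?n] n by (simp add: add_divide_distrib power2_eq_square)
  finally have up: "?k ^ card I * (\<Prod>v\<in>carrier G. (?c v / ?n) ^ count M v) \<le> exp (?k * b ^ 2 / ?n)" .
  have "?k ^ card I \<le> ?k ^ card I * ((?n + 1) ^ order G * (?N * (\<Prod>v\<in>carrier G. (?c v / ?n) ^ count M v)))"
    using mult_left_mono[OF method_of_types[OF I(1) finite_carrier M(2,1) I(2)], of "?k ^ card I"] by (simp add: order_def)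
  also have "\<dots> = (?n + 1) ^ order G * ?N * (?k ^ card I * (\<Prod>v\<in>carrier G. (?c v / ?n) ^ count M v))"
    by (simp add: algebra_simps)
  also have "\<dots> \<le> (?n + 1) ^ order G * ?N * exp (?k * b ^ 2 / ?n)"
    using up by (intro mult_left_mono) auto
  finally show ?thesis using N by (simp add: divide_le_eq mult_ac)
qed

text \<open>
  All letters but the most frequent one have frequency at most one half, and at least
  \<open>c\<close> positions carry such a letter. So the probability in the method of types is at
  most \<open>2 ^ - c\<close>.
\<close>

lemma card_words_far_from_const:
  assumes I: "finite I" "I \<noteq> {}" and A: "finite A" "A \<noteq> {}" "set_mset Q \<subseteq> A" and sz: "size Q = card I"
    and far: "\<And>x. x \<in> A \<Longrightarrow> count Q x + c \<le> card I"
  shows "2 ^ c \<le> (real (card I) + 1) ^ card A * card (words I Q)"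
proof -
  let ?n = "card I"
  obtain x0 where x0: "x0 \<in> A" "\<And>x. x \<in> A \<Longrightarrow> count Q x \<le> count Q x0"
  proof -
    have "Max (count Q ` A) \<in> count Q ` A" using A by (intro Max_in) auto
    then obtain x0 where "x0 \<in> A" "count Q x0 = Max (count Q ` A)" by auto
    then show ?thesis using that Max_ge[of "count Q ` A"] A(1) by simp
  qed
  have half: "2 * count Q x \<le> ?n" if "x \<in> A" "x \<noteq> x0" for x
  proof -
    have "count Q x + count Q x0 = (\<Sum>y\<in>{x, x0}. count Q y)" using that by simp
    also have "\<dots> \<le> (\<Sum>y\<in>A. count Q y)" using that x0 A(1) by (intro sum_mono2) auto
    also have "\<dots> = ?n" using sum_count[OF A(1,3)] sz by simp
    finally show ?thesis using x0(2)[OF that(1)] by simp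
  qed
  have n: "?n > 0" using I by (simp add: card_gt_0_iff)
  let ?q = "\<lambda>x. (real (count Q x) / ?n) ^ count Q x"
  have "(\<Prod>x\<in>A. ?q x) = ?q x0 * (\<Prod>x\<in>A - {x0}. ?q x)" by (rule prod.remove[OF A(1) x0(1)])
  also have "\<dots> \<le> 1 * (\<Prod>x\<in>A - {x0}. (1 / 2) ^ count Q x)"
  proof (intro mult_mono prod_mono conjI)
    show "?q x0 \<le> 1" using count_le_size[of Q x0] sz n by (intro power_le_one) auto
    show "?q x \<le> (1 / 2) ^ count Q x" if "x \<in> A - {x0}" for x
    proof (rule power_mono)
      have "2 * real (count Q x) \<le> real ?n" using half[of x] that by simp
      then show "real (count Q x) / ?n \<le> 1 / 2" using n by (simp add: divide_le_eq)
    qed simp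
  qed (auto intro!: prod_nonneg)
  also have "\<dots> = (1 / 2) ^ (\<Sum>x\<in>A - {x0}. count Q x)" by (simp add: power_sum)
  also have "(\<Sum>x\<in>A - {x0}. count Q x) = ?n - count Q x0"
    using sum.remove[OF A(1) x0(1), of "count Q"] sum_count[OF A(1,3)] sz by simp
  also have "(1 / 2 :: real) ^ (?n - count Q x0) \<le> (1 / 2) ^ c"
    using far[OF x0(1)] by (intro power_decreasing) auto
  finally have le: "(\<Prod>x\<in>A. ?q x) \<le> (1 / 2) ^ c" .
  have "1 \<le> (real ?n + 1) ^ card A * (real (card (words I Q)) * (\<Prod>x\<in>A. ?q x))"
    by (rule method_of_types[OF I(1) A(1,3) sz I(2)])
  also have "\<dots> \<le> (real ?n + 1) ^ card A * (real (card (words I Q)) * (1 / 2) ^ c)"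
    using le by (intro mult_left_mono) auto
  finally show ?thesis by (simp add: power_divide field_simps)
qed

text \<open>
  Families that differ from a constant at \<open>1 \<le> m \<le> c\<close> positions number at
  most a multiple of \<open>(card I * order G) ^ m\<close> and have coefficients at most \<open>Y
  ^ m\<close>; their cubes form a geometric series. All other families have exponentially many
  rearrangements, hence an exponentially small coefficient, and Parseval takes care of the
  remaining square. With squares in place of cubes, the ratio of the series would not be small;
  the cubes become available through \<open>d \<ge> 3\<close>.
\<close>

lemma ft_cube_sum_bound:
  fixes I :: "'i set" and M :: "'a multiset" and b Y :: real and c :: nat
  assumes I: "finite I" "I \<noteq> {}" and M: "size M = card I" "set_mset M \<subseteq> carrier G"
    and b: "\<And>\<xi>. \<xi> \<in> chars G \<Longrightarrow> \<xi> \<noteq> triv_char G \<Longrightarrow> norm (\<Sum>v\<in>#M. \<xi> v) \<le> b"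
    and Y: "0 < Y" "Y \<le> 1" "6 * b \<le> Y * card I" and c: "2 * c \<le> card I" "12 * c \<le> Y ^ 2 * card I"
    and nY: "card I * order G * Y ^ 3 \<le> 1 / 2"
  shows "(\<Sum>\<psi>\<in>{\<psi> \<in> PiE I (\<lambda>_. chars G). \<forall>\<xi>\<in>chars G. \<exists>i\<in>I. \<psi> i \<noteq> \<xi>}. norm (ft I M \<psi>) ^ 3)
    \<le> 2 * real (order G) ^ 2 * card I * Y ^ 3 +
      sqrt ((real (card I) + 1) ^ (2 * order G) * exp (real (order G) * b ^ 2 / card I) / 2 ^ c)
       * ((real (card I) + 1) ^ order G * exp (real (order G) * b ^ 2 / card I))"
proof -
  let ?P = "PiE I (\<lambda>_. chars G)" and ?n = "real (card I)" and ?k = "real (order G)"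
  let ?off = "\<lambda>\<psi> \<xi>. card {i \<in> I. \<psi> i \<noteq> \<xi>}"
  define R where "R = (?n + 1) ^ order G * exp (?k * b ^ 2 / ?n)"
  define near where "near = (\<Union>\<xi>\<in>chars G. \<Union>m\<in>{1..c}. {\<psi> \<in> ?P. ?off \<psi> \<xi> = m})"
  define far where "far = {\<psi> \<in> ?P. \<forall>\<xi>\<in>chars G. c < ?off \<psi> \<xi>}"
  have fP: "finite ?P" using I finite_chars by (auto intro!: finite_PiE)
  have fin: "finite near" "finite far" using fP by (auto simp: near_def far_def finite_chars)
  have cover: "{\<psi> \<in> ?P. \<forall>\<xi>\<in>chars G. \<exists>i\<in>I. \<psi> i \<noteq> \<xi>} \<subseteq> near \<union> far"
  proof
    fix \<psi> assume \<psi>: "\<psi> \<in> {\<psi> \<in> ?P. \<forall>\<xi>\<in>chars G. \<exists>i\<in>I. \<psi> i \<noteq> \<xi>}"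
    have "?off \<psi> \<xi> \<ge> 1" if "\<xi> \<in> chars G" for \<xi>
      using \<psi> that I by (auto simp: Suc_le_eq card_gt_0_iff)
    then show "\<psi> \<in> near \<union> far"
      using \<psi> unfolding near_def far_def by (auto simp: not_less)
  qed
  have near_term: "(\<Sum>\<psi>\<in>{\<psi> \<in> ?P. ?off \<psi> \<xi> = m}. norm (ft I M \<psi>) ^ 3) \<le> (?n * ?k * Y ^ 3) ^ m"
    if "\<xi> \<in> chars G" "m \<le> c" for \<xi> m
  proof -
    have "(\<Sum>\<psi>\<in>{\<psi> \<in> ?P. ?off \<psi> \<xi> = m}. norm (ft I M \<psi>) ^ 3) \<le> (\<Sum>\<psi>\<in>{\<psi> \<in> ?P. ?off \<psi> \<xi> = m}. (Y ^ m) ^ 3)"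
    proof (intro sum_mono power_mono)
      fix \<psi> assume \<psi>: "\<psi> \<in> {\<psi> \<in> ?P. ?off \<psi> \<xi> = m}"
      then have off: "?off \<psi> \<xi> = m" by simp
      have "norm (ft I M \<psi>) \<le> Y ^ ?off \<psi> \<xi>"
        by (rule ft_near_const[OF I(1) M b Y c _ that(1)]) (use \<psi> that off in auto)
      then show "norm (ft I M \<psi>) \<le> Y ^ m" unfolding off .
    qed simp
    also have "\<dots> = real (card {\<psi> \<in> ?P. ?off \<psi> \<xi> = m}) * (Y ^ m) ^ 3" by simp
    also have "\<dots> \<le> real ((card I * card (chars G)) ^ m) * (Y ^ m) ^ 3"
      using Y by (intro mult_right_mono of_nat_mono card_off_const I finite_chars that) auto
    also have "\<dots> = (?n * ?k * Y ^ 3) ^ m"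
      by (simp add: card_chars order_def power_mult_distrib power_mult[symmetric] mult.commute)
    finally show ?thesis .
  qed
  have "(\<Sum>\<psi>\<in>near. norm (ft I M \<psi>) ^ 3) \<le> (\<Sum>\<xi>\<in>chars G. \<Sum>m=1..c. \<Sum>\<psi>\<in>{\<psi> \<in> ?P. ?off \<psi> \<xi> = m}. norm (ft I M \<psi>) ^ 3)"
  proof -
    have "(\<Sum>\<psi>\<in>near. norm (ft I M \<psi>) ^ 3) \<le> (\<Sum>\<xi>\<in>chars G. \<Sum>\<psi>\<in>(\<Union>m\<in>{1..c}. {\<psi> \<in> ?P. ?off \<psi> \<xi> = m}). norm (ft I M \<psi>) ^ 3)"
      unfolding near_def by (rule sum_UN_le[OF finite_chars]) (use fP in auto)
    also have "\<dots> \<le> (\<Sum>\<xi>\<in>chars G. \<Sum>m=1..c. \<Sum>\<psi>\<in>{\<psi> \<in> ?P. ?off \<psi> \<xi> = m}. norm (ft I M \<psi>) ^ 3)"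
      by (rule sum_mono, rule sum_UN_le) (use fP in auto)
    finally show ?thesis .
  qed
  also have "\<dots> \<le> (\<Sum>\<xi>\<in>chars G. \<Sum>m=1..c. (?n * ?k * Y ^ 3) ^ m)"
    by (intro sum_mono near_term) auto
  also have "\<dots> \<le> (\<Sum>\<xi>\<in>chars G. 2 * (?n * ?k * Y ^ 3))"
  proof (rule sum_mono)
    let ?x = "?n * ?k * Y ^ 3"
    have x: "0 \<le> ?x" "?x \<le> 1 / 2" using Y nY by auto
    have "(\<Sum>m=1..c. ?x ^ m) \<le> 2 * ?x * (1 - ?x ^ c)"
    proof (induction c)
      case (Suc c)
      have "?x * ?x ^ c * ?x \<le> ?x * ?x ^ c * (1 / 2)" using x by (intro mult_left_mono) auto
      then show ?case using Suc by (simp add: algebra_simps)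
    qed simp
    also have "\<dots> \<le> 2 * ?x" using x by (simp add: mult_le_cancel_left1 mult_left_le)
    finally show "(\<Sum>m=1..c. ?x ^ m) \<le> 2 * ?x" .
  qed
  also have "\<dots> = 2 * ?k ^ 2 * ?n * Y ^ 3" by (simp add: card_chars order_def power2_eq_square)
  finally have near_le: "(\<Sum>\<psi>\<in>near. norm (ft I M \<psi>) ^ 3) \<le> 2 * ?k ^ 2 * ?n * Y ^ 3" .
  have RM: "?k ^ card I / card (words I M) \<le> R" unfolding R_def by (rule card_words_near_uniform[OF I M b])
  have far_le: "norm (ft I M \<psi>) \<le> sqrt ((?n + 1) ^ order G * R / 2 ^ c)" if \<psi>: "\<psi> \<in> far" for \<psi>
  proof -
    let ?Q = "image_mset \<psi> (mset_set I)"
    have cnt: "count ?Q \<xi> + ?off \<psi> \<xi> = card I" for \<xi>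
    proof -
      have "card I = card ({i \<in> I. \<psi> i = \<xi>} \<union> {i \<in> I. \<psi> i \<noteq> \<xi>})"
        by (rule arg_cong[where f = card]) auto
      also have "\<dots> = card {i \<in> I. \<psi> i = \<xi>} + ?off \<psi> \<xi>"
        by (rule card_Un_disjoint) (use I(1) in auto)
      finally show ?thesis using count_image_mset_set[OF I(1), of \<psi> \<xi>] by simp
    qed
    have "2 ^ c \<le> (?n + 1) ^ card (chars G) * card (words I ?Q)"
    proof (rule card_words_far_from_const[OF I finite_chars])
      show "chars G \<noteq> {}" using triv_char_in by blast
      show "set_mset ?Q \<subseteq> chars G" using \<psi> I by (auto simp: far_def)
      fix \<xi> assume "\<xi> \<in> chars G"
      then have "c < ?off \<psi> \<xi>" using \<psi> by (simp add: far_def)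
      then show "count ?Q \<xi> + c \<le> card I" using cnt[of \<xi>] by linarith
    qed simp
    from mult_right_mono[OF this, of "norm (ft I M \<psi>) ^ 2"]
    have "2 ^ c * norm (ft I M \<psi>) ^ 2 \<le> (?n + 1) ^ order G * (card (words I ?Q) * norm (ft I M \<psi>) ^ 2)"
      by (simp add: card_chars order_def mult.assoc)
    also have "\<dots> \<le> (?n + 1) ^ order G * R"
    proof (intro mult_left_mono order_trans[OF ft_bound_by_type_size[OF I(1) M] RM])
      show "\<psi> \<in> ?P" using \<psi> by (simp add: far_def)
    qed simp
    finally have "norm (ft I M \<psi>) ^ 2 \<le> (?n + 1) ^ order G * R / 2 ^ c" by (simp add: field_simps)
    then show ?thesis by (rule real_le_rsqrt)
  qed
  have "(\<Sum>\<psi>\<in>far. norm (ft I M \<psi>) ^ 3) \<le> (\<Sum>\<psi>\<in>far. sqrt ((?n + 1) ^ order G * R / 2 ^ c) * norm (ft I M \<psi>) ^ 2)"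
    by (intro sum_mono) (simp add: power3_eq_cube power2_eq_square mult_right_mono far_le flip: mult.assoc)
  also have "\<dots> = sqrt ((?n + 1) ^ order G * R / 2 ^ c) * (\<Sum>\<psi>\<in>far. norm (ft I M \<psi>) ^ 2)"
    by (simp add: sum_distrib_left)
  also have "\<dots> \<le> sqrt ((?n + 1) ^ order G * R / 2 ^ c) * R"
  proof (rule mult_left_mono)
    have "(\<Sum>\<psi>\<in>far. norm (ft I M \<psi>) ^ 2) \<le> (\<Sum>\<psi>\<in>?P. norm (ft I M \<psi>) ^ 2)"
      by (rule sum_mono2[OF fP]) (auto simp: far_def)
    then show "(\<Sum>\<psi>\<in>far. norm (ft I M \<psi>) ^ 2) \<le> R" using ft_L2[OF I(1) M] RM by simp
    show "0 \<le> sqrt ((?n + 1) ^ order G * R / 2 ^ c)" by (simp add: R_def)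
  qed
  finally have far_sum: "(\<Sum>\<psi>\<in>far. norm (ft I M \<psi>) ^ 3) \<le> sqrt ((?n + 1) ^ order G * R / 2 ^ c) * R" .
  have "(\<Sum>\<psi>\<in>{\<psi> \<in> ?P. \<forall>\<xi>\<in>chars G. \<exists>i\<in>I. \<psi> i \<noteq> \<xi>}. norm (ft I M \<psi>) ^ 3) \<le> (\<Sum>\<psi>\<in>near \<union> far. norm (ft I M \<psi>) ^ 3)"
    by (rule sum_mono2) (use fin cover in auto)
  also have "\<dots> \<le> (\<Sum>\<psi>\<in>near. norm (ft I M \<psi>) ^ 3) + (\<Sum>\<psi>\<in>far. norm (ft I M \<psi>) ^ 3)"
    using sum.union_inter[OF fin, of "\<lambda>\<psi>. norm (ft I M \<psi>) ^ 3"] sum_nonneg[of "near \<inter> far" "\<lambda>\<psi>. norm (ft I M \<psi>) ^ 3"] by simp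
  also have "\<dots> \<le> 2 * ?k ^ 2 * ?n * Y ^ 3 + sqrt ((?n + 1) ^ order G * R / 2 ^ c) * R"
    using near_le far_sum by simp
  also have "(?n + 1) ^ order G * R = (?n + 1) ^ (2 * order G) * exp (?k * b ^ 2 / ?n)"
    by (simp add: R_def power_add[symmetric] mult_2 flip: mult.assoc)
  finally show ?thesis by (simp add: R_def)
qed

text \<open>
  With \<open>c = n ^ (1/4)\<close> and \<open>Y\<close> of the order \<open>n ^ (-3/8)\<close> we
  have \<open>n Y ^ 3 = O(n ^ (-1/8))\<close>, while the factor \<open>exp (k b ^ 2 / n) = exp
  (O(n ^ (1/5)))\<close> is beaten by \<open>2 ^ - c\<close>.
\<close>

lemma ft_cube_sum_eventually_small:
  fixes C e :: real
  assumes C: "C > 0" and e: "e > 0"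
  shows "\<forall>\<^sub>F n in sequentially. \<forall>I M. finite (I :: nat set) \<longrightarrow> card I = n \<longrightarrow> size M = n \<longrightarrow> set_mset M \<subseteq> carrier G \<longrightarrow>
    (\<forall>\<xi>\<in>chars G. \<xi> \<noteq> triv_char G \<longrightarrow> norm (\<Sum>v\<in>#M. \<xi> v) \<le> C * real n powr (3/5)) \<longrightarrow>
    (\<Sum>\<psi>\<in>{\<psi> \<in> PiE I (\<lambda>_. chars G). \<forall>\<xi>\<in>chars G. \<exists>i\<in>I. \<psi> i \<noteq> \<xi>}. norm (ft I M \<psi>) ^ 3) \<le> e"
proof -
  define k where "k = real (order G)"
  define K where "K = 6 * C + 4"
  have k: "k > 0" using order_pos by (simp add: k_def)
  have K: "K \<ge> 6 * C" "K \<ge> 4" "K > 0" using C by (auto simp: K_def)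
  define b where "b n = C * real n powr (3/5)" for n
  define Y where "Y n = K * real n powr (-3/8)" for n
  define c where "c n = nat \<lfloor>real n powr (1/4)\<rfloor>" for n
  define B where "B n = 2 * k ^ 2 * real n * Y n ^ 3 + sqrt ((real n + 1) powr (2 * k) * exp (k * C ^ 2 * real n powr (1/5)) / 2 powr (real n powr (1/4) - 1))
    * ((real n + 1) powr k * exp (k * C ^ 2 * real n powr (1/5)))" for n
  have Bl: "B \<longlonglongrightarrow> 0"
  proof -
    have "(\<lambda>n. 2 * k ^ 2 * real n * Y n ^ 3) \<longlonglongrightarrow> 0" unfolding Y_def using k K by real_asymp
    moreover have "(\<lambda>n. sqrt ((real n + 1) powr (2 * k) * exp (k * C ^ 2 * real n powr (1/5)) / 2 powr (real n powr (1/4) - 1))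
      * ((real n + 1) powr k * exp (k * C ^ 2 * real n powr (1/5)))) \<longlonglongrightarrow> 0" using k C by real_asymp
    ultimately show ?thesis unfolding B_def by (rule tendsto_add_zero)
  qed
  have ev: "\<forall>\<^sub>F n in sequentially. 0 < n \<and> Y n \<le> 1 \<and> 2 * real n powr (1/4) \<le> real n \<and> real n * k * Y n ^ 3 \<le> 1 / 2 \<and> B n < e
      \<and> 6 * b n \<le> Y n * n"
  proof (intro eventually_conj)
    show "\<forall>\<^sub>F n in sequentially. Y n \<le> 1" unfolding Y_def using K by real_asymp
    show "\<forall>\<^sub>F n in sequentially. 2 * real n powr (1/4) \<le> real n" by real_asymp
    show "\<forall>\<^sub>F n in sequentially. real n * k * Y n ^ 3 \<le> 1 / 2" unfolding Y_def using k K by real_asymp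
    show "\<forall>\<^sub>F n in sequentially. B n < e" using order_tendstoD(2)[OF Bl e] .
    show "\<forall>\<^sub>F n in sequentially. 6 * b n \<le> Y n * n" unfolding Y_def b_def using C K by real_asymp
  qed (rule eventually_gt_at_top)
  then show ?thesis
  proof (rule eventually_mono, intro allI impI)
    fix n and I :: "nat set" and M
    assume n: "0 < n \<and> Y n \<le> 1 \<and> 2 * real n powr (1/4) \<le> real n \<and> real n * k * Y n ^ 3 \<le> 1 / 2 \<and> B n < e \<and> 6 * b n \<le> Y n * n"
    assume I: "finite I" "card I = n" and M: "size M = n" "set_mset M \<subseteq> carrier G"
      and bd: "\<forall>\<xi>\<in>chars G. \<xi> \<noteq> triv_char G \<longrightarrow> norm (\<Sum>v\<in>#M. \<xi> v) \<le> C * real n powr (3/5)"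
    have cle: "real (c n) \<le> real n powr (1/4)" "real n powr (1/4) - 1 \<le> real (c n)"
      unfolding c_def by (auto simp: of_nat_nat)
    have Y2: "Y n ^ 2 * n = K ^ 2 * real n powr (1/4)"
    proof -
      have "Y n ^ 2 * n = K ^ 2 * (real n powr (-3/8) * real n powr (-3/8) * real n powr 1)"
        using n by (simp add: Y_def power2_eq_square)
      also have "real n powr (-3/8) * real n powr (-3/8) * real n powr 1 = real n powr (1/4)"
        unfolding powr_add[symmetric] by simp
      finally show ?thesis .
    qed
    have b2: "b n ^ 2 / n = C ^ 2 * real n powr (1/5)"
    proof -
      have "b n ^ 2 = C ^ 2 * (real n powr (3/5) * real n powr (3/5))"
        by (simp add: b_def power2_eq_square)
      also have "real n powr (3/5) * real n powr (3/5) = real n powr (1/5) * real n powr 1"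
        unfolding powr_add[symmetric] by simp
      finally show ?thesis using n by simp
    qed
    have "(\<Sum>\<psi>\<in>{\<psi> \<in> PiE I (\<lambda>_. chars G). \<forall>\<xi>\<in>chars G. \<exists>i\<in>I. \<psi> i \<noteq> \<xi>}. norm (ft I M \<psi>) ^ 3)
      \<le> 2 * real (order G) ^ 2 * card I * Y n ^ 3 +
      sqrt ((real (card I) + 1) ^ (2 * order G) * exp (real (order G) * b n ^ 2 / card I) / 2 ^ c n)
       * ((real (card I) + 1) ^ order G * exp (real (order G) * b n ^ 2 / card I))"
    proof (rule ft_cube_sum_bound)
      show "I \<noteq> {}" using I n by auto
      show "norm (\<Sum>v\<in>#M. \<xi> v) \<le> b n" if "\<xi> \<in> chars G" "\<xi> \<noteq> triv_char G" for \<xi>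
        using bd that by (simp add: b_def)
      show "0 < Y n" using n K by (simp add: Y_def)
      have "2 * real (c n) \<le> real n" using cle n by linarith
      then show "2 * c n \<le> card I" using I by linarith
      have "12 * real (c n) \<le> 16 * real n powr (1/4)" using cle by linarith
      also have "\<dots> \<le> K ^ 2 * real n powr (1/4)"
        using power_mono[OF K(2), of 2] by (intro mult_right_mono) auto
      finally show "real (12 * c n) \<le> (Y n)\<^sup>2 * real (card I)" using I Y2 by simp
    qed (use I M n in \<open>auto simp: k_def\<close>)
    also have "\<dots> \<le> B n"
    proof -
      have q: "(real n + 1) ^ order G = (real n + 1) powr k" "(real n + 1) ^ (2 * order G) = (real n + 1) powr (2 * k)"
        by (simp_all add: powr_realpow[symmetric] k_def)
      have "2 powr (real n powr (1/4) - 1) \<le> (2::real) ^ c n"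
        using cle by (simp add: powr_realpow[symmetric])
      then have "(real n + 1) powr (2 * k) * exp (k * C ^ 2 * real n powr (1/5)) / 2 ^ c n
        \<le> (real n + 1) powr (2 * k) * exp (k * C ^ 2 * real n powr (1/5)) / 2 powr (real n powr (1/4) - 1)"
        by (intro divide_left_mono) auto
      then have sq: "sqrt ((real n + 1) powr (2 * k) * exp (k * C ^ 2 * real n powr (1/5)) / 2 ^ c n)
        \<le> sqrt ((real n + 1) powr (2 * k) * exp (k * C ^ 2 * real n powr (1/5)) / 2 powr (real n powr (1/4) - 1))"
        by (rule real_sqrt_le_mono)
      have E: "k * b n ^ 2 / n = k * C ^ 2 * real n powr (1/5)"
        by (simp only: times_divide_eq_right[symmetric] b2 mult.assoc)
      show ?thesis
        unfolding B_def I(2) q k_def[symmetric] E by (intro add_left_mono mult_right_mono sq) auto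
    qed
    finally show "(\<Sum>\<psi>\<in>{\<psi> \<in> PiE I (\<lambda>_. chars G). \<forall>\<xi>\<in>chars G. \<exists>i\<in>I. \<psi> i \<noteq> \<xi>}. norm (ft I M \<psi>) ^ 3) \<le> e"
      using n by linarith
  qed
qed

end

section \<open>Counting solutions by Fourier inversion\<close>

lemma sum_PiE_prod:
  fixes f :: "'k \<Rightarrow> 'b \<Rightarrow> 'c :: comm_semiring_1"
  assumes "finite K" "\<And>k. k \<in> K \<Longrightarrow> finite (F k)"
  shows "(\<Sum>ws\<in>PiE K F. \<Prod>k\<in>K. f k (ws k)) = (\<Prod>k\<in>K. \<Sum>w\<in>F k. f k w)"
  by (rule prod_sum_PiE[symmetric]) (use assms in auto)

text \<open>
  A comparison of sums needs to be checked only on those fibres of a map where the smaller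
  function does not vanish.
\<close>

lemma sum_by_fibers_le:
  fixes h \<phi> :: "'x \<Rightarrow> real"
  assumes "finite X" "\<And>x. 0 \<le> \<phi> x"
    and "\<And>x0. x0 \<in> X \<Longrightarrow> h x0 \<noteq> 0 \<Longrightarrow> (\<Sum>x\<in>{x \<in> X. f x = f x0}. h x) \<le> (\<Sum>x\<in>{x \<in> X. f x = f x0}. \<phi> x)"
  shows "(\<Sum>x\<in>X. h x) \<le> (\<Sum>x\<in>X. \<phi> x)"
proof -
  have "(\<Sum>x\<in>X. h x) = (\<Sum>y\<in>f ` X. \<Sum>x\<in>{x \<in> X. f x = y}. h x)" by (rule sum.image_gen[OF assms(1)])
  also have "\<dots> \<le> (\<Sum>y\<in>f ` X. \<Sum>x\<in>{x \<in> X. f x = y}. \<phi> x)"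
  proof (rule sum_mono)
    fix y assume "y \<in> f ` X"
    show "(\<Sum>x\<in>{x \<in> X. f x = y}. h x) \<le> (\<Sum>x\<in>{x \<in> X. f x = y}. \<phi> x)"
    proof (cases "\<exists>x0\<in>X. f x0 = y \<and> h x0 \<noteq> 0")
      case True then show ?thesis using assms(3) by blast
    next
      case False
      then have "(\<Sum>x\<in>{x \<in> X. f x = y}. h x) = 0" by (intro sum.neutral) auto
      then show ?thesis using assms(2) by (simp add: sum_nonneg)
    qed
  qed
  also have "\<dots> = (\<Sum>x\<in>X. \<phi> x)" by (rule sum.image_gen[OF assms(1), symmetric])
  finally show ?thesis .
qed

lemma prod_le_sum_cubes:
  fixes x :: "nat \<Rightarrow> real"
  assumes "d \<ge> 3" "\<And>k. k < d \<Longrightarrow> 0 \<le> x k \<and> x k \<le> 1"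
  shows "(\<Prod>k<d. x k) \<le> (\<Sum>k<d. x k ^ 3)"
proof -
  have "0 \<in> {..<d}" using assms(1) by simp
  then have ne: "x ` {..<d} \<noteq> {}" by blast
  have "Max (x ` {..<d}) \<in> x ` {..<d}" by (rule Max_in) (use ne in auto)
  then obtain k0 where k0: "k0 < d" "x k0 = Max (x ` {..<d})" by auto
  have "(\<Prod>k<d. x k) \<le> (\<Prod>k<d. x k0)"
  proof (rule prod_mono)
    fix k assume "k \<in> {..<d}"
    then show "0 \<le> x k \<and> x k \<le> x k0" using assms(2)[of k] Max_ge[of "x ` {..<d}" "x k"] k0(2) by simp
  qed
  also have "\<dots> = x k0 ^ d" by simp
  also have "\<dots> \<le> x k0 ^ 3" using assms(1) assms(2)[OF k0(1)] by (intro power_decreasing) simp_all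
  also have "\<dots> \<le> (\<Sum>k<d. x k ^ 3)"
    by (rule member_le_sum) (use assms(2) k0 in auto)
  finally show ?thesis .
qed

text \<open>
  Among the words that agree with \<open>b\<close> wherever \<open>b\<close> is outside of
  \<open>W\<close>, the remaining letters form an arbitrary word, on the remaining positions, over
  the letters in \<open>W\<close>.
\<close>

lemma words_split:
  fixes I :: "'i set" and W :: "'a set"
  assumes I: "finite I" and b: "b \<in> words I M"
  shows "bij_betw (\<lambda>w. restrict w {i \<in> I. b i \<in> W})
    {w \<in> words I M. \<forall>i\<in>I. (w i \<in> W) = (b i \<in> W) \<and> (b i \<notin> W \<longrightarrow> w i = b i)}
    (words {i \<in> I. b i \<in> W} (filter_mset (\<lambda>v. v \<in> W) M))"
proof -
  let ?J = "{i \<in> I. b i \<in> W}" and ?S = "{i \<in> I. b i \<notin> W}" and ?MW = "filter_mset (\<lambda>v. v \<in> W) M"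
  let ?F = "{w \<in> words I M. \<forall>i\<in>I. (w i \<in> W) = (b i \<in> W) \<and> (b i \<notin> W \<longrightarrow> w i = b i)}"
  let ?glue = "\<lambda>u. (\<lambda>i. if i \<in> ?S then b i else u i)"
  have filt: "image_mset w (mset_set {i \<in> I. w i \<in> W}) = ?MW" if "w \<in> words I M" for w
  proof -
    have M: "M = image_mset w (mset_set I)" using that by (simp only: words_def mem_Collect_eq)
    show ?thesis unfolding M filter_mset_image_mset filter_mset_mset_set[OF I] ..
  qed
  have un: "mset_set I = mset_set ?S + mset_set ?J"
  proof -
    have "I = ?S \<union> ?J" by auto
    then have "mset_set I = mset_set (?S \<union> ?J)" by (rule arg_cong)
    also have "\<dots> = mset_set ?S + mset_set ?J" by (rule mset_set_Union) (use I in auto)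
    finally show ?thesis .
  qed
  show ?thesis
  proof (rule bij_betwI[where g = ?glue])
    show "(\<lambda>w. restrict w ?J) \<in> ?F \<rightarrow> words ?J ?MW"
    proof
      fix w assume w: "w \<in> ?F"
      have e: "{i \<in> I. w i \<in> W} = ?J" using w by auto
      have "image_mset (restrict w ?J) (mset_set ?J) = image_mset w (mset_set ?J)"
        by (rule image_mset_cong) (use I in auto)
      also have "\<dots> = ?MW" using filt[of w] w unfolding e by simp
      finally show "restrict w ?J \<in> words ?J ?MW" by (simp only: words_def mem_Collect_eq restrict_extensional)
    qed
    show "?glue \<in> words ?J ?MW \<rightarrow> ?F"
    proof
      fix u assume u: "u \<in> words ?J ?MW"
      have uJ: "u i \<in> W" if "i \<in> ?J" for i
        using words_eval[OF _ u that] I by auto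
      have uo: "u i = undefined" if "i \<notin> I" for i using u that by (auto simp: words_def extensional_def)
      have "image_mset (?glue u) (mset_set I) = image_mset (?glue u) (mset_set ?S) + image_mset (?glue u) (mset_set ?J)"
        by (subst un) simp
      also have "image_mset (?glue u) (mset_set ?S) = image_mset b (mset_set ?S)"
        by (rule image_mset_cong) (use I in auto)
      also have "image_mset (?glue u) (mset_set ?J) = image_mset u (mset_set ?J)"
        by (rule image_mset_cong) (use I in auto)
      also have "image_mset u (mset_set ?J) = image_mset b (mset_set ?J)"
        using u filt[OF b] by (simp only: words_def mem_Collect_eq)
      also have "image_mset b (mset_set ?S) + image_mset b (mset_set ?J) = M"
        using b by (simp only: words_def mem_Collect_eq un image_mset_union)
      finally have "?glue u \<in> words I M"
        using uo by (simp only: words_def mem_Collect_eq) (auto simp: extensional_def)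
      then show "?glue u \<in> ?F" using uJ by simp
    qed
    show "?glue (restrict w ?J) = w" if "w \<in> ?F" for w
      using that by (auto simp: fun_eq_iff words_def extensional_def)
    show "restrict (?glue u) ?J = u" if "u \<in> words ?J ?MW" for u
      using that by (auto simp: fun_eq_iff words_def extensional_def)
  qed
qed

context finite_comm_group
begin

text \<open>
  Characters of a subgroup turn products taken in the large group into products of complex
  numbers.
\<close>

lemma char_sub_finprod:
  assumes W: "subgroup W G" and \<xi>: "\<xi> \<in> chars (G\<lparr>carrier := W\<rparr>)" and K: "finite K" "\<And>k. k \<in> K \<Longrightarrow> f k \<in> W"
  shows "finprod G f K \<in> W" "\<xi> (finprod G f K) = (\<Prod>k\<in>K. \<xi> (f k))"
proof -
  have "finprod G f K \<in> W \<and> \<xi> (finprod G f K) = (\<Prod>k\<in>K. \<xi> (f k))"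
    using K
  proof (induction K)
    case empty
    then show ?case using char_one[OF \<xi>] subgroup.one_closed[OF W] by simp
  next
    case (insert k K)
    have "f \<in> K \<rightarrow> carrier G" "f k \<in> carrier G" using insert.prems subgroup.subset[OF W] by auto
    then show ?case
      using insert char_mult[OF \<xi>, of "f k" "finprod G f K"] subgroup.m_closed[OF W] by simp
  qed
  then show "finprod G f K \<in> W" "\<xi> (finprod G f K) = (\<Prod>k\<in>K. \<xi> (f k))" by auto
qed

text \<open>
  Detect \<open>y = \<one>\<close> for \<open>y \<in> W\<close> by the average of \<open>\<xi>
  y\<close> over the characters \<open>\<xi>\<close> of \<open>W\<close>, at each position
  separately, and interchange the sums. The base point \<open>b\<close>, which solves the
  equation, serves to bring the factors into \<open>W\<close>.
\<close>

lemma fiber_fourier: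
  assumes W: "subgroup W G" and I: "finite I" and K: "finite K" "\<And>k. k \<in> K \<Longrightarrow> finite (F k)"
    and F: "\<And>k w i. k \<in> K \<Longrightarrow> w \<in> F k \<Longrightarrow> i \<in> I \<Longrightarrow> w i \<in> carrier G \<and> w i \<otimes> inv (b k i) \<in> W"
    and b: "\<And>k i. k \<in> K \<Longrightarrow> i \<in> I \<Longrightarrow> b k i \<in> carrier G"
    and r: "\<And>i. i \<in> I \<Longrightarrow> finprod G (\<lambda>k. b k i) K = r i"
  shows "of_nat (card {ws \<in> PiE K F. \<forall>i\<in>I. finprod G (\<lambda>k. ws k i) K = r i}) * of_nat (card W) ^ card I
    = (\<Sum>\<psi>\<in>PiE I (\<lambda>_. chars (G\<lparr>carrier := W\<rparr>)). \<Prod>k\<in>K. \<Sum>w\<in>F k. \<Prod>i\<in>I. \<psi> i (w i \<otimes> inv (b k i)))"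
proof -
  interpret Ws: finite_comm_group "G\<lparr>carrier := W\<rparr>" by (rule sub_finite_comm_group[OF W])
  let ?C = "chars (G\<lparr>carrier := W\<rparr>)"
  have fC: "finite ?C" by (rule Ws.finite_chars)
  define y where "y ws i = finprod G (\<lambda>k. ws k i \<otimes> inv (b k i)) K" for ws i
  have ind: "(\<Sum>\<xi>\<in>?C. \<Prod>k\<in>K. \<xi> (ws k i \<otimes> inv (b k i))) = (if finprod G (\<lambda>k. ws k i) K = r i then of_nat (card W) else 0)"
    if ws: "ws \<in> PiE K F" and i: "i \<in> I" for ws i
  proof -
    have wc: "ws k \<in> F k" if "k \<in> K" for k using ws that by auto
    have yW: "y ws i \<in> W" "(\<Prod>k\<in>K. \<xi> (ws k i \<otimes> inv (b k i))) = \<xi> (y ws i)" if "\<xi> \<in> ?C" for \<xi>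
      using char_sub_finprod[OF W that K(1), of "\<lambda>k. ws k i \<otimes> inv (b k i)"] F[OF _ wc i] by (auto simp: y_def)
    have yc: "y ws i \<in> W" using yW(1) Ws.triv_char_in by blast
    have ycar: "y ws i \<in> carrier G" using yc subgroup.subset[OF W] by auto
    have "finprod G (\<lambda>k. ws k i) K = finprod G (\<lambda>k. (ws k i \<otimes> inv (b k i)) \<otimes> b k i) K"
      by (rule finprod_cong') (use F[OF _ wc i] b[OF _ i] in \<open>auto simp: m_assoc\<close>)
    also have "\<dots> = y ws i \<otimes> r i"
      unfolding y_def r[OF i, symmetric] by (rule finprod_multf) (use F[OF _ wc i] b[OF _ i] in auto)
    finally have eq: "finprod G (\<lambda>k. ws k i) K = y ws i \<otimes> r i" .
    have rc: "r i \<in> carrier G" unfolding r[OF i, symmetric] by (rule finprod_closed) (use b i in auto)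
    have iff: "finprod G (\<lambda>k. ws k i) K = r i \<longleftrightarrow> y ws i = \<one>"
      using eq ycar rc by (metis l_one right_cancel one_closed)
    have "(\<Sum>\<xi>\<in>?C. \<Prod>k\<in>K. \<xi> (ws k i \<otimes> inv (b k i))) = (\<Sum>\<xi>\<in>?C. \<xi> (y ws i))"
      by (rule sum.cong) (use yW in auto)
    also have "\<dots> = (if finprod G (\<lambda>k. ws k i) K = r i then of_nat (card W) else 0)"
      using Ws.sum_over_chars[of "y ws i"] yc iff by simp
    finally show ?thesis .
  qed
  have fKF: "finite (PiE K F)" using K by (auto intro!: finite_PiE)
  have "(\<Sum>\<psi>\<in>PiE I (\<lambda>_. ?C). \<Prod>k\<in>K. \<Sum>w\<in>F k. \<Prod>i\<in>I. \<psi> i (w i \<otimes> inv (b k i)))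
    = (\<Sum>\<psi>\<in>PiE I (\<lambda>_. ?C). \<Sum>ws\<in>PiE K F. \<Prod>k\<in>K. \<Prod>i\<in>I. \<psi> i (ws k i \<otimes> inv (b k i)))"
    by (intro sum.cong refl sum_PiE_prod[symmetric] K)
  also have "\<dots> = (\<Sum>ws\<in>PiE K F. \<Sum>\<psi>\<in>PiE I (\<lambda>_. ?C). \<Prod>i\<in>I. \<Prod>k\<in>K. \<psi> i (ws k i \<otimes> inv (b k i)))"
    by (subst sum.swap) (intro sum.cong refl prod.swap)
  also have "\<dots> = (\<Sum>ws\<in>PiE K F. \<Prod>i\<in>I. \<Sum>\<xi>\<in>?C. \<Prod>k\<in>K. \<xi> (ws k i \<otimes> inv (b k i)))"
    by (intro sum.cong refl sum_PiE_prod I fC)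
  also have "\<dots> = (\<Sum>ws\<in>PiE K F. \<Prod>i\<in>I. if finprod G (\<lambda>k. ws k i) K = r i then of_nat (card W) else 0)"
    by (intro sum.cong prod.cong refl ind)
  also have "\<dots> = (\<Sum>ws\<in>PiE K F. if \<forall>i\<in>I. finprod G (\<lambda>k. ws k i) K = r i then of_nat (card W) ^ card I else 0)"
    by (intro sum.cong refl) (use I in \<open>auto intro!: prod_zero\<close>)
  also have "\<dots> = of_nat (card {ws \<in> PiE K F. \<forall>i\<in>I. finprod G (\<lambda>k. ws k i) K = r i}) * of_nat (card W) ^ card I"
    using fKF by (simp add: sum.If_cases Int_def conj_commute)
  finally show ?thesis by simp
qed

lemma ft_norm_le_1:
  assumes I: "finite I" and M: "size M = card I" "set_mset M \<subseteq> carrier G" and \<psi>: "\<And>i. i \<in> I \<Longrightarrow> \<psi> i \<in> chars G"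
  shows "norm (ft I M \<psi>) \<le> 1"
proof -
  have "norm (\<Sum>w\<in>words I M. \<Prod>i\<in>I. \<psi> i (w i)) \<le> (\<Sum>w\<in>words I M. 1)"
    by (rule sum_norm_le) (auto simp: prod_norm[symmetric] intro!: prod_le_1 char_norm_le \<psi>)
  then show ?thesis using card_words_pos[OF I M(1)] by (simp add: ft_def norm_divide divide_le_eq)
qed

text \<open>
  The constant families, one for each character, contribute at most one each.
\<close>

lemma ft_cube_sum_total:
  fixes e :: real
  assumes I: "finite I" "I \<noteq> {}" and M: "size M = card I" "set_mset M \<subseteq> carrier G"
    and small: "(\<Sum>\<psi>\<in>{\<psi> \<in> PiE I (\<lambda>_. chars G). \<forall>\<xi>\<in>chars G. \<exists>i\<in>I. \<psi> i \<noteq> \<xi>}. norm (ft I M \<psi>) ^ 3) \<le> e"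
  shows "(\<Sum>\<psi>\<in>PiE I (\<lambda>_. chars G). norm (ft I M \<psi>) ^ 3) \<le> order G + e"
proof -
  let ?P = "PiE I (\<lambda>_. chars G)"
  let ?N = "{\<psi> \<in> ?P. \<forall>\<xi>\<in>chars G. \<exists>i\<in>I. \<psi> i \<noteq> \<xi>}"
  let ?c = "\<lambda>\<xi>. restrict (\<lambda>_. \<xi>) I"
  have fP: "finite ?P" using I finite_chars by (auto intro!: finite_PiE)
  have sub: "?P - ?N \<subseteq> ?c ` chars G"
  proof
    fix \<psi> assume \<psi>: "\<psi> \<in> ?P - ?N"
    then obtain \<xi> where "\<xi> \<in> chars G" "\<forall>i\<in>I. \<psi> i = \<xi>" by auto
    then have "\<psi> = ?c \<xi>" using \<psi> by (auto simp: fun_eq_iff PiE_def extensional_def)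
    then show "\<psi> \<in> ?c ` chars G" using \<open>\<xi> \<in> chars G\<close> by blast
  qed
  have "(\<Sum>\<psi>\<in>?P - ?N. norm (ft I M \<psi>) ^ 3) \<le> (\<Sum>\<psi>\<in>?P - ?N. 1)"
    by (intro sum_mono power_le_one ft_norm_le_1 I M) auto
  also have "\<dots> \<le> order G"
    using card_mono[OF finite_imageI[OF finite_chars] sub] card_image_le[OF finite_chars, of ?c]
    by (simp add: card_chars order_def)
  finally have 1: "(\<Sum>\<psi>\<in>?P - ?N. norm (ft I M \<psi>) ^ 3) \<le> order G" .
  have "(\<Sum>\<psi>\<in>?P. norm (ft I M \<psi>) ^ 3) = (\<Sum>\<psi>\<in>?P - ?N. norm (ft I M \<psi>) ^ 3) + (\<Sum>\<psi>\<in>?N. norm (ft I M \<psi>) ^ 3)"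
    by (rule sum.subset_diff) (use fP in auto)
  then show ?thesis using 1 small by linarith
qed

end

section \<open>Random sets that cover no point exactly once\<close>

text \<open>
  The positions of the letters outside of \<open>W\<close> form a uniform set of size
  \<open>m\<close>, and \<open>R\<close> contains it with probability at most \<open>(card R /
  card I) ^ m\<close>. The induction removes points from \<open>R\<close> one at a time: by
  symmetry it does not matter which point is removed, and the average over all of them is
  explicit.
\<close>

lemma card_support_subset:
  fixes I :: "'i set" and M :: "'a multiset"
  assumes I: "finite I" and sz: "\<And>w. w \<in> words I M \<Longrightarrow> card {i \<in> I. w i \<notin> W} = m" and R: "R \<subseteq> I"
  shows "real (card {w \<in> words I M. {i \<in> I. w i \<notin> W} \<subseteq> R}) \<le> card (words I M) * (card R / card I) ^ m"
  using R
proof (induction "card I - card R" arbitrary: R)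
  case 0
  then have RI: "R = I" using I by (metis card_subset_eq card_mono diff_is_0_eq le_antisym)
  have e: "{w \<in> words I M. {i \<in> I. w i \<notin> W} \<subseteq> I} = words I M" by auto
  show ?case
  proof (cases "I = {}")
    case True
    then show ?thesis unfolding RI e
      by (cases "words I M = {}") (use sz in auto)
  next
    case False
    then show ?thesis unfolding RI e using I by simp
  qed
next
  case (Suc l)
  let ?n = "card I" and ?N = "card (words I M)"
  define f where "f R = card {w \<in> words I M. {i \<in> I. w i \<notin> W} \<subseteq> R}" for R
  have fW: "finite (words I M)" by (rule finite_words[OF I])
  have "card R < ?n" using Suc(2) by simp
  then obtain x where x: "x \<in> I" "x \<notin> R" using Suc.prems by (metis card_mono I finite_subset leD subsetI)
  define R' where "R' = insert x R"
  have finR: "finite R" using Suc.prems I finite_subset by blast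
  have R': "R' \<subseteq> I" "card R' = Suc (card R)" "finite R'" using x Suc.prems finR by (auto simp: R'_def)
  have sym: "f (R' - {y}) = f R" if y: "y \<in> R'" for y
  proof -
    let ?p = "Transposition.transpose x y"
    have p: "?p permutes I" using x y R' by (intro permutes_swap_id) auto
    have pR: "?p ` R = R' - {y}"
    proof -
      have "?p ` R' = R'"
        by (rule permutes_image, rule permutes_swap_id) (use y in \<open>auto simp: R'_def\<close>)
      moreover have "?p ` (R' - {x}) = ?p ` R' - ?p ` {x}" by (rule image_set_diff[OF permutes_inj[OF p]])
      moreover have "R' - {x} = R" using x by (auto simp: R'_def)
      ultimately show ?thesis by simp
    qed
    have inv: "(?p i \<in> R) = (i \<in> R' - {y})" for i
      unfolding pR[symmetric] by (metis imageE image_eqI transpose_involutory)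
    have "bij_betw (\<lambda>w. restrict (w \<circ> ?p) I) {w \<in> words I M. {i \<in> I. w i \<notin> W} \<subseteq> R} {w \<in> words I M. {i \<in> I. w i \<notin> W} \<subseteq> R' - {y}}"
    proof (rule bij_betw_Collect[OF words_permute[OF I p]])
      fix w assume "w \<in> words I M"
      have pI: "(?p i \<in> I) = (i \<in> I)" for i by (rule permutes_in_image[OF p])
      show "({i \<in> I. restrict (w \<circ> ?p) I i \<notin> W} \<subseteq> R' - {y}) = ({i \<in> I. w i \<notin> W} \<subseteq> R)"
      proof
        assume h: "{i \<in> I. restrict (w \<circ> ?p) I i \<notin> W} \<subseteq> R' - {y}"
        show "{i \<in> I. w i \<notin> W} \<subseteq> R"
        proof
          fix i assume "i \<in> {i \<in> I. w i \<notin> W}"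
          then have "?p i \<in> {i \<in> I. restrict (w \<circ> ?p) I i \<notin> W}" using pI by simp
          then show "i \<in> R" using h inv[of "?p i"] by auto
        qed
      next
        assume h: "{i \<in> I. w i \<notin> W} \<subseteq> R"
        show "{i \<in> I. restrict (w \<circ> ?p) I i \<notin> W} \<subseteq> R' - {y}"
        proof
          fix i assume "i \<in> {i \<in> I. restrict (w \<circ> ?p) I i \<notin> W}"
          then have "i \<in> I \<and> w (?p i) \<notin> W" by (auto split: if_splits)
          then have "?p i \<in> {i \<in> I. w i \<notin> W}" using pI[of i] by blast
          then show "i \<in> R' - {y}" using h inv[of i] by auto
        qed
      qed
    qed
    then show ?thesis unfolding f_def by (rule bij_betw_same_card[symmetric])
  qed
  let ?A = "{w \<in> words I M. {i \<in> I. w i \<notin> W} \<subseteq> R'}"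
  have "real (card R') * real (f R) = (\<Sum>y\<in>R'. real (f (R' - {y})))" using sym by simp
  also have "\<dots> = (\<Sum>y\<in>R'. \<Sum>w\<in>?A. if w y \<in> W then 1 else 0)"
  proof (intro sum.cong refl)
    fix y assume y: "y \<in> R'"
    have "{w \<in> words I M. {i \<in> I. w i \<notin> W} \<subseteq> R' - {y}} = {w \<in> ?A. w y \<in> W}" using y R' by auto
    then show "real (f (R' - {y})) = (\<Sum>w\<in>?A. if w y \<in> W then 1 else 0)"
      unfolding f_def using fW by (simp add: sum.If_cases Int_def)
  qed
  also have "\<dots> = (\<Sum>w\<in>?A. \<Sum>y\<in>R'. if w y \<in> W then 1 else 0)" by (rule sum.swap)
  also have "\<dots> = (\<Sum>w\<in>?A. real (card R') - real m)"
  proof (intro sum.cong refl)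
    fix w assume w: "w \<in> ?A"
    have "(\<Sum>y\<in>R'. if w y \<in> W then 1 else 0 :: real) = real (card (R' - {i \<in> I. w i \<notin> W}))"
      using R' by (simp add: sum.If_cases) (rule arg_cong[where f = card], auto)
    also have "card (R' - {i \<in> I. w i \<notin> W}) = card R' - m"
      using w sz[of w] I by (simp add: card_Diff_subset)
    also have "real (card R' - m) = real (card R') - real m"
      using w sz[of w] card_mono[OF R'(3), of "{i \<in> I. w i \<notin> W}"] by auto
    finally show "(\<Sum>y\<in>R'. if w y \<in> W then 1 else 0) = real (card R') - real m" .
  qed
  also have "\<dots> = (real (card R') - real m) * f R'" by (simp add: f_def)
  finally have rec: "real (card R') * real (f R) = (real (card R') - real m) * f R'" .
  have IH: "real (f R') \<le> ?N * (card R' / ?n) ^ m"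
    unfolding f_def using Suc R' by (intro Suc.hyps) auto
  have r: "real (card R') > 0" using R' by simp
  have "real (f R) = (1 + real m * (- 1 / card R')) * f R'" using rec r by (simp add: field_simps)
  also have "\<dots> \<le> (1 + (- 1 / card R')) ^ m * f R'"
    by (intro mult_right_mono Bernoulli_inequality) (use R' in auto)
  also have "1 + (- 1 / card R') = card R / card R'" using R' by (simp add: field_simps)
  also have "(card R / card R') ^ m * real (f R') \<le> (card R / card R') ^ m * (?N * (card R' / ?n) ^ m)"
    using IH by (intro mult_left_mono) auto
  also have "\<dots> = ?N * ((card R / card R') * (card R' / ?n)) ^ m" unfolding power_mult_distrib by simp
  also have "(card R / card R') * (card R' / ?n) = real (card R) / ?n" using r by simp
  finally show ?case by (simp add: f_def)
qed

text \<open>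
  A position outside of \<open>S0\<close> that is covered at all by the \<open>d\<close> sets of
  size \<open>m\<close> is covered twice, so there are at most \<open>d * m div 2\<close> such
  positions. All \<open>d\<close> sets then lie in the union of \<open>S0\<close> with a set of
  this size.
\<close>

lemma covering_count:
  fixes I :: "'i set" and M :: "'a multiset"
  assumes I: "finite I" and sz: "\<And>w. w \<in> words I M \<Longrightarrow> card {i \<in> I. w i \<notin> W} = m"
    and S0: "S0 \<subseteq> I" "card S0 = m" and u: "u = d * m div 2" "m + u \<le> card I"
  shows "real (card {ws \<in> PiE {..<d} (\<lambda>_. words I M). \<forall>i\<in>I - S0. card {k \<in> {..<d}. ws k i \<notin> W} \<noteq> 1})
    \<le> (card I choose u) * (card (words I M) * ((m + u) / card I) ^ m) ^ d"
proof -
  let ?T = "words I M"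
  let ?F = "\<lambda>U. {w \<in> ?T. {i \<in> I. w i \<notin> W} \<subseteq> S0 \<union> U}"
  let ?U = "{U. U \<subseteq> I - S0 \<and> card U = u}"
  have fT: "finite ?T" by (rule finite_words[OF I])
  have finU: "finite ?U" using I by simp
  have finS: "finite S0" using S0 I finite_subset by blast
  have "{ws \<in> PiE {..<d} (\<lambda>_. ?T). \<forall>i\<in>I - S0. card {k \<in> {..<d}. ws k i \<notin> W} \<noteq> 1} \<subseteq> (\<Union>U\<in>?U. PiE {..<d} (\<lambda>_. ?F U))"
  proof
    fix ws assume ws: "ws \<in> {ws \<in> PiE {..<d} (\<lambda>_. ?T). \<forall>i\<in>I - S0. card {k \<in> {..<d}. ws k i \<notin> W} \<noteq> 1}"
    then have wT: "ws k \<in> ?T" if "k < d" for k using that by auto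
    define U1 where "U1 = {i \<in> I - S0. \<exists>k<d. ws k i \<notin> W}"
    have fU1: "finite U1" using I by (simp add: U1_def)
    \<comment> \<open>Each point of U1 is counted at least twice in the total size of the d supports.\<close>
    have "2 * card U1 = (\<Sum>i\<in>U1. 2)" by simp
    also have "\<dots> \<le> (\<Sum>i\<in>U1. card {k \<in> {..<d}. ws k i \<notin> W})"
    proof (rule sum_mono)
      fix i assume i: "i \<in> U1"
      then obtain k where "k < d" "ws k i \<notin> W" by (auto simp: U1_def)
      then have "{k \<in> {..<d}. ws k i \<notin> W} \<noteq> {}" by auto
      then have "card {k \<in> {..<d}. ws k i \<notin> W} \<noteq> 0" by (subst card_0_eq) auto
      moreover have "card {k \<in> {..<d}. ws k i \<notin> W} \<noteq> 1" using ws i unfolding U1_def by blast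
      ultimately show "2 \<le> card {k \<in> {..<d}. ws k i \<notin> W}" by linarith
    qed
    also have "\<dots> \<le> (\<Sum>i\<in>I. card {k \<in> {..<d}. ws k i \<notin> W})"
      by (rule sum_mono2) (use I in \<open>auto simp: U1_def\<close>)
    also have "\<dots> = (\<Sum>i\<in>I. \<Sum>k<d. if ws k i \<notin> W then 1 else 0)"
      by (intro sum.cong refl) (simp add: sum.If_cases Int_def)
    also have "\<dots> = (\<Sum>k<d. \<Sum>i\<in>I. if ws k i \<notin> W then 1 else 0)" by (rule sum.swap)
    also have "\<dots> = (\<Sum>k<d. m)"
    proof (intro sum.cong refl)
      fix k assume "k \<in> {..<d}"
      then show "(\<Sum>i\<in>I. if ws k i \<notin> W then 1 else 0) = m"
        using sz[OF wT[of k]] I by (simp add: sum.If_cases Int_def)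
    qed
    finally have c1: "card U1 \<le> u" using u by simp
    have "u \<le> card (I - S0)" using u S0 finS by (simp add: card_Diff_subset)
    then obtain U where U: "U1 \<subseteq> U" "U \<subseteq> I - S0" "card U = u"
      using exists_subset_between[of U1 u "I - S0"] c1 I by (auto simp: U1_def)
    have "ws \<in> PiE {..<d} (\<lambda>_. ?F U)"
    proof (rule PiE_I)
      fix k assume k: "k \<in> {..<d}"
      have "{i \<in> I. ws k i \<notin> W} \<subseteq> S0 \<union> U1" using k by (auto simp: U1_def)
      then show "ws k \<in> ?F U" using wT[of k] k U(1) by auto
    qed (use ws in \<open>auto simp: PiE_def extensional_def\<close>)
    then show "ws \<in> (\<Union>U\<in>?U. PiE {..<d} (\<lambda>_. ?F U))" by (rule UN_I[rotated]) (use U in simp)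
  qed
  then have "card {ws \<in> PiE {..<d} (\<lambda>_. ?T). \<forall>i\<in>I - S0. card {k \<in> {..<d}. ws k i \<notin> W} \<noteq> 1}
      \<le> card (\<Union>U\<in>?U. PiE {..<d} (\<lambda>_. ?F U))"
    by (rule card_mono[rotated]) (intro finite_UN_I finU finite_PiE, simp_all add: fT)
  also have "\<dots> \<le> (\<Sum>U\<in>?U. card (PiE {..<d} (\<lambda>_. ?F U)))" by (rule card_UN_le[OF finU])
  finally have "real (card {ws \<in> PiE {..<d} (\<lambda>_. ?T). \<forall>i\<in>I - S0. card {k \<in> {..<d}. ws k i \<notin> W} \<noteq> 1})
      \<le> (\<Sum>U\<in>?U. real (card (?F U)) ^ d)"
    by (simp add: card_PiE flip: of_nat_sum of_nat_power)
  also have "\<dots> \<le> (\<Sum>U\<in>?U. (card ?T * ((m + u) / card I) ^ m) ^ d)"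
  proof (intro sum_mono power_mono)
    fix U assume U: "U \<in> ?U"
    then have fU: "finite U" using I finite_subset by blast
    have "card (S0 \<union> U) = card S0 + card U" by (rule card_Un_disjoint) (use U finS fU in auto)
    then have c: "card (S0 \<union> U) = m + u" using U S0 by simp
    have "real (card (?F U)) \<le> card ?T * (card (S0 \<union> U) / card I) ^ m"
      by (rule card_support_subset[OF I sz]) (use S0 U in auto)
    then show "real (card (?F U)) \<le> card ?T * ((m + u) / card I) ^ m" unfolding c by simp
  qed simp
  also have "\<dots> = real (card (I - S0) choose u) * (card ?T * ((m + u) / card I) ^ m) ^ d"
    using n_subsets[of "I - S0" u] I by simp
  also have "\<dots> \<le> real (card I choose u) * (card ?T * ((m + u) / card I) ^ m) ^ d"
    by (intro mult_right_mono of_nat_mono binomial_right_mono card_mono I) auto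
  finally show ?thesis by (simp only: of_nat_add)
qed

text \<open>
  One term of the exponential series gives \<open>m ^ m / fact m \<le> exp m\<close>.
\<close>

lemma binomial_le_exp:
  assumes "m \<ge> 1"
  shows "real (n choose m) \<le> (exp 1 * n / m) ^ m"
proof -
  have "(\<Sum>j\<in>{m}. real m ^ j / fact j) \<le> (\<Sum>j. real m ^ j / fact j)"
    using summable_exp_generic[of "real m"] by (intro sum_le_suminf) (auto simp: divide_inverse mult.commute)
  then have "real m ^ m / fact m \<le> exp (real m)" by (simp add: exp_def divide_inverse mult.commute)
  then have f: "real m ^ m \<le> exp 1 ^ m * fact m" by (simp add: divide_le_eq exp_of_nat_mult[of m 1, simplified, symmetric] flip: exp_of_nat_mult)
  have "real (n choose m) * fact m \<le> real n ^ m"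
    using binomial_fact_pow[of n m] by (metis of_nat_le_iff of_nat_mult of_nat_power of_nat_fact)
  then have "real (n choose m) * (fact m * real m ^ m) \<le> real n ^ m * real m ^ m"
    by (simp add: mult.assoc[symmetric] mult_right_mono)
  also have "\<dots> \<le> real n ^ m * (exp 1 ^ m * fact m)" using f by (intro mult_left_mono) auto
  finally have "(real (n choose m) * real m ^ m) * fact m \<le> (real n ^ m * exp 1 ^ m) * fact m" by (simp add: mult_ac)
  then have "real (n choose m) * real m ^ m \<le> real n ^ m * exp 1 ^ m" by (rule mult_right_le_imp_le) simp
  then show ?thesis using assms by (simp add: power_divide power_mult_distrib field_simps)
qed

text \<open>
  The powers of \<open>n\<close> on the left are \<open>m\<close> and at most \<open>d m /
  2\<close> for the two choices, against \<open>d m\<close> for the containment probability, and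
  \<open>d m - d m / 2 - m \<ge> m / 2\<close> as \<open>d \<ge> 3\<close>. What remains is
  \<open>(m / n) ^ (m / 2)\<close> up to a factor exponential in \<open>m\<close>.
\<close>

lemma covering_estimate:
  fixes d m n u :: nat
  assumes d: "d \<ge> 3" and m: "m \<ge> 1" "m \<le> n" and u: "u = d * m div 2"
  shows "real (n choose m) * real (n choose u) * (((m + u) / n) ^ m) ^ d \<le> ((exp 1 * d) ^ d * sqrt (m / n)) ^ m"
proof -
  have n: "real n > 0" using m by simp
  have "3 * m \<le> d * m" using d by simp
  then have um: "u \<ge> m" "2 * u \<le> d * m" "m + u \<le> d * m" using u m by linarith+
  define x where "x = real m / n"
  have x: "0 < x" "x \<le> 1" using m n by (auto simp: x_def)
  have ex: "exp 1 * real n / m = exp 1 / x" using m by (simp add: x_def)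
  have c1: "real (n choose m) \<le> (exp 1 / x) ^ m" using binomial_le_exp[OF m(1), of n] unfolding ex .
  have "real (n choose u) \<le> (exp 1 * n / u) ^ u" using binomial_le_exp[of u n] um m by simp
  also have "\<dots> \<le> (exp 1 * n / m) ^ u" using um m by (intro power_mono divide_left_mono) auto
  finally have c2: "real (n choose u) \<le> (exp 1 / x) ^ u" unfolding ex .
  have c3: "(((m + u) / n) ^ m) ^ d \<le> ((d * x) ^ m) ^ d"
  proof (intro power_mono)
    have "real (m + u) \<le> real d * real m" using um(3) by (metis of_nat_le_iff of_nat_mult)
    then show "real (m + u) / n \<le> d * x" using n by (simp add: x_def divide_right_mono)
  qed auto
  have "real (n choose m) * real (n choose u) * (((m + u) / n) ^ m) ^ d \<le> (exp 1 / x) ^ m * (exp 1 / x) ^ u * ((d * x) ^ m) ^ d"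
    using x by (intro mult_mono c1 c2 c3) auto
  also have "\<dots> = exp 1 ^ (m + u) * real d ^ (m * d) * (x ^ (m * d) / x ^ (m + u))"
    by (simp add: power_add power_divide power_mult_distrib power_mult[symmetric])
  also have "x ^ (m * d) / x ^ (m + u) = x ^ (m * d - (m + u))"
    using um x by (simp add: power_diff mult.commute)
  also have "\<dots> = sqrt x ^ (2 * (m * d - (m + u)))" using x by (simp add: power_mult)
  also have "\<dots> \<le> sqrt x ^ m"
  proof (rule power_decreasing)
    have "m * d = d * m" by simp
    then show "m \<le> 2 * (m * d - (m + u))" using um \<open>3 * m \<le> d * m\<close> by linarith
  qed (use x in auto)
  also have "exp 1 ^ (m + u) \<le> (exp 1 :: real) ^ (m * d)"
    using um by (intro power_increasing) (auto simp: mult.commute)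
  finally have "real (n choose m) * real (n choose u) * (((m + u) / n) ^ m) ^ d \<le> exp 1 ^ (m * d) * real d ^ (m * d) * sqrt x ^ m"
    using x by (simp add: mult_left_mono mult_right_mono)
  also have "\<dots> = ((exp 1 * d) ^ d * sqrt x) ^ m"
    by (simp add: power_mult_distrib power_mult[symmetric] mult.commute)
  finally show ?thesis by (simp add: x_def)
qed

lemma sum_restrict_PiE:
  fixes f :: "('i \<Rightarrow> 'c) \<Rightarrow> real"
  assumes I: "finite I" "J \<subseteq> I" and C: "finite C"
  shows "(\<Sum>\<psi>\<in>PiE I (\<lambda>_. C). f (restrict \<psi> J)) = card C ^ card (I - J) * (\<Sum>\<psi>\<in>PiE J (\<lambda>_. C). f \<psi>)"
proof -
  have fin: "finite (PiE I (\<lambda>_. C))" "finite (PiE J (\<lambda>_. C))"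
    using I C finite_subset by (auto intro!: finite_PiE)
  have "(\<Sum>\<psi>\<in>PiE I (\<lambda>_. C). f (restrict \<psi> J))
    = (\<Sum>\<psi>'\<in>PiE J (\<lambda>_. C). \<Sum>\<psi>\<in>{\<psi> \<in> PiE I (\<lambda>_. C). restrict \<psi> J = \<psi>'}. f (restrict \<psi> J))"
    by (rule sum.group[symmetric]) (use fin I in auto)
  also have "\<dots> = (\<Sum>\<psi>'\<in>PiE J (\<lambda>_. C). card C ^ card (I - J) * f \<psi>')"
  proof (intro sum.cong refl)
    fix \<psi>' assume \<psi>': "\<psi>' \<in> PiE J (\<lambda>_. C)"
    have "{\<psi> \<in> PiE I (\<lambda>_. C). restrict \<psi> J = \<psi>'} = PiE I (\<lambda>i. if i \<in> J then {\<psi>' i} else C)"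
    proof (intro equalityI subsetI)
      fix \<psi> assume "\<psi> \<in> {\<psi> \<in> PiE I (\<lambda>_. C). restrict \<psi> J = \<psi>'}"
      then show "\<psi> \<in> PiE I (\<lambda>i. if i \<in> J then {\<psi>' i} else C)" by auto
    next
      fix \<psi> assume h: "\<psi> \<in> PiE I (\<lambda>i. if i \<in> J then {\<psi>' i} else C)"
      have e: "\<psi> i = \<psi>' i" if "i \<in> J" for i using PiE_mem[OF h, of i] that I by auto
      have "\<psi> \<in> PiE I (\<lambda>_. C)"
      proof (rule PiE_I)
        fix i assume "i \<in> I"
        then show "\<psi> i \<in> C" using PiE_mem[OF h, of i] e[of i] PiE_mem[OF \<psi>', of i] by (cases "i \<in> J") auto
      qed (use h in \<open>auto simp: PiE_def extensional_def\<close>)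
      moreover have "restrict \<psi> J = \<psi>'"
        using e \<psi>' by (auto simp: fun_eq_iff PiE_def extensional_def)
      ultimately show "\<psi> \<in> {\<psi> \<in> PiE I (\<lambda>_. C). restrict \<psi> J = \<psi>'}" by simp
    qed
    moreover have "card (PiE I (\<lambda>i. if i \<in> J then {\<psi>' i} else C)) = card C ^ card (I - J)"
    proof -
      have "card (PiE I (\<lambda>i. if i \<in> J then {\<psi>' i} else C)) = (\<Prod>i\<in>I. if i \<in> J then 1 else card C)"
        by (subst card_PiE[OF I(1)]) (intro prod.cong refl, auto)
      also have "\<dots> = card C ^ card (I - J)"
        using I by (simp add: prod.If_cases Diff_eq[symmetric] Collect_mem_eq)
      finally show ?thesis .
    qed
    ultimately have "card {\<psi> \<in> PiE I (\<lambda>_. C). restrict \<psi> J = \<psi>'} = card C ^ card (I - J)" by simp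
    moreover have "(\<Sum>\<psi>\<in>{\<psi> \<in> PiE I (\<lambda>_. C). restrict \<psi> J = \<psi>'}. f (restrict \<psi> J)) = (\<Sum>\<psi>\<in>{\<psi> \<in> PiE I (\<lambda>_. C). restrict \<psi> J = \<psi>'}. f \<psi>')"
      by (intro sum.cong refl) auto
    ultimately show "(\<Sum>\<psi>\<in>{\<psi> \<in> PiE I (\<lambda>_. C). restrict \<psi> J = \<psi>'}. f (restrict \<psi> J)) = card C ^ card (I - J) * f \<psi>'"
      by simp
  qed
  finally show ?thesis by (simp add: sum_distrib_left)
qed

section \<open>Words that are concentrated on a subgroup\<close>

context finite_comm_group
begin

text \<open>
  The \<open>d\<close>-tuples of rearrangements of \<open>g\<close> whose product is
  \<open>g\<close> to the power \<open>d\<close> at every position. In additive notation, these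
  are the solutions of \<open>A g = d g\<close> for the adjacency matrix \<open>A\<close>.
\<close>

definition hits :: "nat \<Rightarrow> 'i set \<Rightarrow> ('i \<Rightarrow> 'a) \<Rightarrow> (nat \<Rightarrow> 'i \<Rightarrow> 'a) set"
  where "hits d I g = {ws \<in> PiE {..<d} (\<lambda>_. words I (image_mset g (mset_set I))).
    \<forall>i\<in>I. finprod G (\<lambda>k. ws k i) {..<d} = g i [^] d}"

definition hit_prob :: "nat \<Rightarrow> 'i set \<Rightarrow> ('i \<Rightarrow> 'a) \<Rightarrow> real"
  where "hit_prob d I g = card (hits d I g) / card (words I (image_mset g (mset_set I))) ^ d"

text \<open>
  On the fixed letters the characters see the identity, and on the others the base point
  contributes a factor of modulus one, so only the Fourier coefficient of the letters in
  \<open>W\<close> remains.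
\<close>

lemma fiber_char_sum:
  fixes I :: "'i set"
  assumes W: "subgroup W G" and I: "finite I" and M: "set_mset M \<subseteq> carrier G" and b: "b \<in> words I M"
    and \<psi>: "\<And>i. i \<in> I \<Longrightarrow> \<psi> i \<in> chars (G\<lparr>carrier := W\<rparr>)"
  shows "norm (\<Sum>w\<in>{w \<in> words I M. \<forall>i\<in>I. (w i \<in> W) = (b i \<in> W) \<and> (b i \<notin> W \<longrightarrow> w i = b i)}. \<Prod>i\<in>I. \<psi> i (w i \<otimes> inv (b i)))
    = card {w \<in> words I M. \<forall>i\<in>I. (w i \<in> W) = (b i \<in> W) \<and> (b i \<notin> W \<longrightarrow> w i = b i)}
      * norm (ft {i \<in> I. b i \<in> W} (filter_mset (\<lambda>v. v \<in> W) M) \<psi>)"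
proof -
  interpret Ws: finite_comm_group "G\<lparr>carrier := W\<rparr>" by (rule sub_finite_comm_group[OF W])
  let ?J = "{i \<in> I. b i \<in> W}" and ?MW = "filter_mset (\<lambda>v. v \<in> W) M"
  let ?F = "{w \<in> words I M. \<forall>i\<in>I. (w i \<in> W) = (b i \<in> W) \<and> (b i \<notin> W \<longrightarrow> w i = b i)}"
  have bij: "bij_betw (\<lambda>w. restrict w ?J) ?F (words ?J ?MW)" by (rule words_split[OF I b])
  define c where "c = (\<Prod>i\<in>?J. \<psi> i (inv (b i)))"
  have c: "norm c = 1"
    unfolding c_def prod_norm[symmetric]
    by (rule prod.neutral) (use Ws.char_norm[OF \<psi>] subgroup.m_inv_closed[OF W] in auto)
  have "(\<Sum>w\<in>?F. \<Prod>i\<in>I. \<psi> i (w i \<otimes> inv (b i))) = (\<Sum>w\<in>?F. c * (\<Prod>i\<in>?J. \<psi> i (restrict w ?J i)))"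
  proof (intro sum.cong refl)
    fix w assume w: "w \<in> ?F"
    have "(\<Prod>i\<in>I. \<psi> i (w i \<otimes> inv (b i))) = (\<Prod>i\<in>?J. \<psi> i (w i \<otimes> inv (b i)))"
    proof (rule prod.mono_neutral_right[OF I])
      show "\<forall>i\<in>I - ?J. \<psi> i (w i \<otimes> inv (b i)) = 1"
      proof
        fix i assume i: "i \<in> I - ?J"
        then have "w i = b i" "b i \<in> carrier G" using w words_carrier[OF I M b, of i] by auto
        then show "\<psi> i (w i \<otimes> inv (b i)) = 1" using char_one[OF \<psi>[of i]] i by simp
      qed
    qed auto
    also have "\<dots> = (\<Prod>i\<in>?J. \<psi> i (inv (b i)) * \<psi> i (restrict w ?J i))"
    proof (intro prod.cong refl)
      fix i assume i: "i \<in> ?J"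
      then have "w i \<in> W" "inv (b i) \<in> W" using w subgroup.m_inv_closed[OF W] by auto
      then show "\<psi> i (w i \<otimes> inv (b i)) = \<psi> i (inv (b i)) * \<psi> i (restrict w ?J i)"
        using i char_mult[OF \<psi>[of i], of "w i" "inv (b i)"] by (simp add: mult.commute)
    qed
    finally show "(\<Prod>i\<in>I. \<psi> i (w i \<otimes> inv (b i))) = c * (\<Prod>i\<in>?J. \<psi> i (restrict w ?J i))"
      by (simp only: c_def prod.distrib)
  qed
  also have "\<dots> = c * (\<Sum>w\<in>?F. \<Prod>i\<in>?J. \<psi> i (restrict w ?J i))" by (rule sum_distrib_left[symmetric])
  also have "(\<Sum>w\<in>?F. \<Prod>i\<in>?J. \<psi> i (restrict w ?J i)) = (\<Sum>u\<in>words ?J ?MW. \<Prod>i\<in>?J. \<psi> i (u i))"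
    by (rule sum.reindex_bij_betw[OF bij, of "\<lambda>u. \<Prod>i\<in>?J. \<psi> i (u i)"])
  finally have "norm (\<Sum>w\<in>?F. \<Prod>i\<in>I. \<psi> i (w i \<otimes> inv (b i))) = norm (\<Sum>u\<in>words ?J ?MW. \<Prod>i\<in>?J. \<psi> i (u i))"
    using c by (simp only: norm_mult)
  moreover have "card ?F = card (words ?J ?MW)" by (rule bij_betw_same_card[OF bij])
  moreover have "card (words ?J ?MW) > 0"
  proof -
    have "b \<in> ?F" using b by simp
    then have "card ?F > 0" using finite_words[OF I, of M] by (auto simp: card_gt_0_iff)
    then show ?thesis using calculation by simp
  qed
  ultimately show ?thesis by (simp add: ft_def norm_divide)
qed

text \<open>
  Group the tuples by the positions and values of their letters outside of \<open>W\<close>. If a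
  fibre contains a solution at all, then a position where \<open>g\<close> is in \<open>W\<close>
  cannot carry exactly one letter outside of \<open>W\<close>, as the product there is in
  \<open>W\<close>. Within such a fibre the letters in \<open>W\<close> are still free, and
  Fourier inversion over \<open>W\<close> shows that the solutions have the density of a uniform
  element of \<open>W ^ card I\<close>, up to a constant factor and a factor \<open>card W\<close>
  for each of the fixed positions.
\<close>

lemma near_coset_hits:
  fixes I :: "'i set"
  assumes W: "subgroup W G" and I: "finite I" and g: "g \<in> PiE I (\<lambda>_. carrier G)" and d: "d \<ge> 3"
    and lt: "card {i \<in> I. g i \<notin> W} < card I"
    and small: "\<And>J. J \<subseteq> I \<Longrightarrow> card J = card {i \<in> I. g i \<in> W} \<Longrightarrow>
      (\<Sum>\<psi>\<in>{\<psi> \<in> PiE J (\<lambda>_. chars (G\<lparr>carrier := W\<rparr>)). \<forall>\<xi>\<in>chars (G\<lparr>carrier := W\<rparr>). \<exists>i\<in>J. \<psi> i \<noteq> \<xi>}.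
        norm (ft J (filter_mset (\<lambda>v. v \<in> W) (image_mset g (mset_set I))) \<psi>) ^ 3) \<le> 1"
  shows "real (card (hits d I g)) * card W ^ card I
    \<le> card W ^ card {i \<in> I. g i \<notin> W} * (d * (card W + 1)) *
      card {ws \<in> PiE {..<d} (\<lambda>_. words I (image_mset g (mset_set I))).
        \<forall>i\<in>I - {i \<in> I. g i \<notin> W}. card {k \<in> {..<d}. ws k i \<notin> W} \<noteq> 1}"
proof -
  interpret Ws: finite_comm_group "G\<lparr>carrier := W\<rparr>" by (rule sub_finite_comm_group[OF W])
  let ?C = "chars (G\<lparr>carrier := W\<rparr>)"
  let ?M = "image_mset g (mset_set I)" and ?m = "card {i \<in> I. g i \<notin> W}"
  let ?MW = "filter_mset (\<lambda>v. v \<in> W) ?M"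
  let ?T = "words I ?M"
  let ?X = "PiE {..<d} (\<lambda>_. ?T)"
  let ?eq = "\<lambda>ws. \<forall>i\<in>I. finprod G (\<lambda>k. ws k i) {..<d} = g i [^] d"
  let ?cov = "\<lambda>ws. \<forall>i\<in>I - {i \<in> I. g i \<notin> W}. card {k \<in> {..<d}. ws k i \<notin> W} \<noteq> 1"
  have Wc: "W \<subseteq> carrier G" by (rule subgroup.subset[OF W])
  have M: "set_mset ?M \<subseteq> carrier G" "size ?M = card I" using g I by auto
  have fT: "finite ?T" by (rule finite_words[OF I])
  have fX: "finite ?X" using fT by (auto intro!: finite_PiE)
  have gc: "g i \<in> carrier G" if "i \<in> I" for i using g that by auto
  have mJ: "card I = ?m + card {i \<in> I. g i \<in> W}"
    using card_Un_disjoint[of "{i \<in> I. g i \<notin> W}" "{i \<in> I. g i \<in> W}"] I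
    by (simp add: Un_def disj_commute conj_disj_distribL[symmetric] Int_def cong: conj_cong)
  have sizeMW: "size ?MW = card {i \<in> I. g i \<in> W}"
    by (simp add: filter_mset_image_mset filter_mset_mset_set[OF I])
  have cJ: "card {i \<in> I. w i \<in> W} = card {i \<in> I. g i \<in> W}" if "w \<in> ?T" for w
  proof -
    have "?M = image_mset w (mset_set I)" using that by (simp only: words_def mem_Collect_eq)
    then have "size ?MW = size (filter_mset (\<lambda>v. v \<in> W) (image_mset w (mset_set I)))" by (simp only:)
    then show ?thesis using sizeMW by (simp add: filter_mset_image_mset filter_mset_mset_set[OF I])
  qed
  \<comment> \<open>This map records the letters outside of W with their positions; its fibres are the groups of tuples.\<close>
  define out where "out ws = (\<lambda>k\<in>{..<d}. \<lambda>i\<in>I. if ws k i \<in> W then None else Some (ws k i))" for ws :: "nat \<Rightarrow> 'i \<Rightarrow> 'a"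
  define h where "h ws = (if ?eq ws then real (card W) ^ card I else 0)" for ws
  define \<phi> where "\<phi> ws = (if ?cov ws then real (card W) ^ ?m * (d * (card W + 1)) else 0)" for ws
  have main: "(\<Sum>ws\<in>?X. h ws) \<le> (\<Sum>ws\<in>?X. \<phi> ws)"
  proof (rule sum_by_fibers_le[OF fX, where f = out])
    show "0 \<le> \<phi> ws" for ws by (simp add: \<phi>_def)
    fix b assume b: "b \<in> ?X" and "h b \<noteq> 0"
    then have beq: "?eq b" by (auto simp: h_def split: if_splits)
    have bT: "b k \<in> ?T" if "k \<in> {..<d}" for k using b that by auto
    have bc: "b k i \<in> carrier G" if "k \<in> {..<d}" "i \<in> I" for k i
      by (rule words_carrier[OF I M(1) bT]) (use that in auto)
    let ?F = "\<lambda>k. {w \<in> ?T. \<forall>i\<in>I. (w i \<in> W) = (b k i \<in> W) \<and> (b k i \<notin> W \<longrightarrow> w i = b k i)}"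
    let ?J = "\<lambda>k. {i \<in> I. b k i \<in> W}"
    have fib: "{ws \<in> ?X. out ws = out b} = PiE {..<d} ?F"
    proof (intro equalityI subsetI)
      fix ws assume ws: "ws \<in> {ws \<in> ?X. out ws = out b}"
      show "ws \<in> PiE {..<d} ?F"
      proof (rule PiE_I)
        fix k assume k: "k \<in> {..<d}"
        have "(if ws k i \<in> W then None else Some (ws k i)) = (if b k i \<in> W then None else Some (b k i))" if "i \<in> I" for i
        proof -
          have "out ws = out b" using ws by blast
          then have "out ws k i = out b k i" by (rule arg_cong)
          then show ?thesis unfolding out_def using k that by (simp only: restrict_apply if_True)
        qed
        then have "(ws k i \<in> W) = (b k i \<in> W) \<and> (b k i \<notin> W \<longrightarrow> ws k i = b k i)" if "i \<in> I" for i
          using that by (metis option.inject option.distinct(1))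
        then show "ws k \<in> ?F k" using ws k by auto
      qed (use ws in \<open>auto simp: PiE_def extensional_def\<close>)
    next
      fix ws assume ws: "ws \<in> PiE {..<d} ?F"
      then have wk: "ws k \<in> ?F k" if "k \<in> {..<d}" for k using that by auto
      have "ws \<in> ?X" using ws by (auto simp: PiE_def Pi_def)
      moreover have "out ws = out b"
        unfolding out_def by (intro restrict_ext) (use wk in auto)
      ultimately show "ws \<in> {ws \<in> ?X. out ws = out b}" by simp
    qed
    have bcov: "?cov b"
    proof (intro ballI notI)
      fix i assume i: "i \<in> I - {i \<in> I. g i \<notin> W}" and c1: "card {k \<in> {..<d}. b k i \<notin> W} = 1"
      then obtain k0 where k0: "{k \<in> {..<d}. b k i \<notin> W} = {k0}" by (auto simp: card_1_singleton_iff)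
      then have k0d: "k0 \<in> {..<d}" "b k0 i \<notin> W" by auto
      let ?R = "finprod G (\<lambda>k. b k i) ({..<d} - {k0})"
      have R: "?R \<in> W"
        by (rule char_sub_finprod(1)[OF W Ws.triv_char_in]) (use k0 in auto)
      have "finprod G (\<lambda>k. b k i) {..<d} = finprod G (\<lambda>k. b k i) (insert k0 ({..<d} - {k0}))"
        using k0d(1) by (simp add: insert_absorb)
      also have "\<dots> = b k0 i \<otimes> ?R"
        by (rule finprod_insert) (use bc i k0d(1) in auto)
      finally have "b k0 i \<otimes> ?R = g i [^] d" using beq i by auto
      then have "b k0 i = g i [^] d \<otimes> inv ?R" using bc[OF k0d(1)] i R Wc gc by (metis DiffD1 inv_solve_right' nat_pow_closed subsetD)
      moreover have "g i [^] d \<in> W"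
      proof -
        have gW: "g i \<in> W" using i by auto
        show ?thesis by (induction d) (use gW subgroup.m_closed[OF W] subgroup.one_closed[OF W] in auto)
      qed
      ultimately have "b k0 i \<in> W" using R subgroup.m_closed[OF W] subgroup.m_inv_closed[OF W] by metis
      then show False using k0d by simp
    qed
    have cov: "?cov ws" if ws: "ws \<in> PiE {..<d} ?F" for ws
    proof (intro ballI)
      fix i assume i: "i \<in> I - {i \<in> I. g i \<notin> W}"
      have "ws k i \<in> W \<longleftrightarrow> b k i \<in> W" if "k \<in> {..<d}" for k
        using PiE_mem[OF ws that] i by auto
      then have "{k \<in> {..<d}. ws k i \<notin> W} = {k \<in> {..<d}. b k i \<notin> W}" by auto
      then show "card {k \<in> {..<d}. ws k i \<notin> W} \<noteq> 1" using bcov i by metis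
    qed
    have fF: "finite (?F k)" for k using fT by simp
    have four: "of_nat (card {ws \<in> PiE {..<d} ?F. ?eq ws}) * of_nat (card W) ^ card I
      = (\<Sum>\<psi>\<in>PiE I (\<lambda>_. ?C). \<Prod>k<d. \<Sum>w\<in>?F k. \<Prod>i\<in>I. \<psi> i (w i \<otimes> inv (b k i)))"
    proof (rule fiber_fourier[OF W I])
      fix k w i assume h: "k \<in> {..<d}" "w \<in> ?F k" "i \<in> I"
      have wc: "w i \<in> carrier G" by (rule words_carrier[OF I M(1)]) (use h in auto)
      have "w i \<otimes> inv (b k i) \<in> W"
      proof (cases "b k i \<in> W")
        case True
        then have "w i \<in> W" using h by auto
        then show ?thesis using True subgroup.m_closed[OF W] subgroup.m_inv_closed[OF W] by blast
      next
        case False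
        then have "w i = b k i" using h by auto
        then show ?thesis using bc[OF h(1,3)] subgroup.one_closed[OF W] by simp
      qed
      then show "w i \<in> carrier G \<and> w i \<otimes> inv (b k i) \<in> W" using wc by simp
    qed (use fF bc beq in auto)
    let ?x = "\<lambda>k \<psi>. norm (ft (?J k) ?MW \<psi>)"
    have Jk: "?J k \<subseteq> I" "finite (?J k)" "size ?MW = card (?J k)" "?J k \<noteq> {}" "card (?J k) = card {i \<in> I. g i \<in> W}" if "k \<in> {..<d}" for k
    proof -
      show c: "card (?J k) = card {i \<in> I. g i \<in> W}" by (rule cJ[OF bT[OF that]])
      then show "size ?MW = card (?J k)" using sizeMW by simp
      have "card (?J k) > 0" using c lt mJ by linarith
      then show "?J k \<noteq> {}" by (metis card.empty less_irrefl)
    qed (use I in auto)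
    have MWc: "set_mset ?MW \<subseteq> carrier (G\<lparr>carrier := W\<rparr>)" by auto
    have x01: "?x k \<psi> \<le> 1" if "k \<in> {..<d}" "\<psi> \<in> PiE I (\<lambda>_. ?C)" for k \<psi>
      by (rule Ws.ft_norm_le_1[OF Jk(2,3)[OF that(1)] MWc]) (use that(2) in auto)
    have "real (card {ws \<in> PiE {..<d} ?F. ?eq ws}) * real (card W) ^ card I
      = norm (of_nat (card {ws \<in> PiE {..<d} ?F. ?eq ws}) * of_nat (card W) ^ card I :: complex)"
      by (simp add: norm_mult norm_power)
    also have "\<dots> \<le> (\<Sum>\<psi>\<in>PiE I (\<lambda>_. ?C). norm (\<Prod>k<d. \<Sum>w\<in>?F k. \<Prod>i\<in>I. \<psi> i (w i \<otimes> inv (b k i))))"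
      unfolding four by (rule norm_sum)
    also have "\<dots> = (\<Sum>\<psi>\<in>PiE I (\<lambda>_. ?C). \<Prod>k<d. real (card (?F k)) * ?x k \<psi>)"
      unfolding prod_norm[symmetric]
      by (intro sum.cong prod.cong refl fiber_char_sum[OF W I M(1) bT]) auto
    also have "\<dots> = real (card (PiE {..<d} ?F)) * (\<Sum>\<psi>\<in>PiE I (\<lambda>_. ?C). \<Prod>k<d. ?x k \<psi>)"
      by (simp add: card_PiE prod.distrib sum_distrib_left)
    also have "\<dots> \<le> real (card (PiE {..<d} ?F)) * (\<Sum>\<psi>\<in>PiE I (\<lambda>_. ?C). \<Sum>k<d. ?x k \<psi> ^ 3)"
      by (intro mult_left_mono sum_mono prod_le_sum_cubes d) (use x01 in auto)
    finally have bound1: "real (card {ws \<in> PiE {..<d} ?F. ?eq ws}) * real (card W) ^ card I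
      \<le> real (card (PiE {..<d} ?F)) * (\<Sum>\<psi>\<in>PiE I (\<lambda>_. ?C). \<Sum>k<d. ?x k \<psi> ^ 3)" .
    have "(\<Sum>\<psi>\<in>PiE I (\<lambda>_. ?C). \<Sum>k<d. ?x k \<psi> ^ 3) = (\<Sum>k<d. \<Sum>\<psi>\<in>PiE I (\<lambda>_. ?C). ?x k \<psi> ^ 3)"
      by (rule sum.swap)
    also have "\<dots> \<le> (\<Sum>k<d. real (card W) ^ ?m * (card W + 1))"
    proof (rule sum_mono)
      fix k assume k: "k \<in> {..<d}"
      have "(\<Sum>\<psi>\<in>PiE I (\<lambda>_. ?C). ?x k \<psi> ^ 3) = (\<Sum>\<psi>\<in>PiE I (\<lambda>_. ?C). ?x k (restrict \<psi> (?J k)) ^ 3)"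
        unfolding ft_def by (intro sum.cong prod.cong refl arg_cong[where f = "\<lambda>z. norm (z / _) ^ 3"]) auto
      also have "\<dots> = card ?C ^ card (I - ?J k) * (\<Sum>\<psi>\<in>PiE (?J k) (\<lambda>_. ?C). ?x k \<psi> ^ 3)"
        by (rule sum_restrict_PiE[OF I Jk(1)[OF k] Ws.finite_chars])
      also have "card ?C = card W" using Ws.card_chars by simp
      also have "card (I - ?J k) = ?m" using Jk[OF k] I mJ by (simp add: card_Diff_subset)
      also have "real (card W ^ ?m) * (\<Sum>\<psi>\<in>PiE (?J k) (\<lambda>_. ?C). ?x k \<psi> ^ 3) \<le> real (card W ^ ?m) * (real (order (G\<lparr>carrier := W\<rparr>)) + 1)"
        by (rule mult_left_mono[OF Ws.ft_cube_sum_total[OF Jk(2,4,3)[OF k] MWc small[OF Jk(1,5)[OF k]]]]) simp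
      finally show "(\<Sum>\<psi>\<in>PiE I (\<lambda>_. ?C). ?x k \<psi> ^ 3) \<le> real (card W) ^ ?m * (card W + 1)"
        by (simp add: order_def add.commute)
    qed
    also have "\<dots> = real (card W) ^ ?m * (d * (card W + 1))" by (simp add: algebra_simps)
    finally have bound2: "(\<Sum>\<psi>\<in>PiE I (\<lambda>_. ?C). \<Sum>k<d. ?x k \<psi> ^ 3) \<le> real (card W) ^ ?m * (d * (card W + 1))" .
    have bound: "real (card {ws \<in> PiE {..<d} ?F. ?eq ws}) * real (card W) ^ card I
      \<le> real (card (PiE {..<d} ?F)) * (real (card W) ^ ?m * (d * (card W + 1)))"
      by (rule order_trans[OF bound1 mult_left_mono[OF bound2]]) simp
    have fPF: "finite (PiE {..<d} ?F)" using fF by (auto intro!: finite_PiE)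
    have "(\<Sum>ws\<in>PiE {..<d} ?F. h ws) = real (card {ws \<in> PiE {..<d} ?F. ?eq ws}) * real (card W) ^ card I"
      unfolding h_def using fPF by (simp add: sum.If_cases Int_def)
    also note bound
    also have "real (card (PiE {..<d} ?F)) * (real (card W) ^ ?m * (d * (card W + 1))) = (\<Sum>ws\<in>PiE {..<d} ?F. real (card W) ^ ?m * (d * (card W + 1)))"
      by simp
    also have "\<dots> = (\<Sum>ws\<in>PiE {..<d} ?F. \<phi> ws)"
    proof (rule sum.cong[OF refl])
      fix ws assume "ws \<in> PiE {..<d} ?F"
      from cov[OF this] show "real (card W) ^ ?m * (d * (card W + 1)) = \<phi> ws"
        unfolding \<phi>_def by (rule if_P[symmetric])
    qed
    finally show "(\<Sum>ws\<in>{ws \<in> ?X. out ws = out b}. h ws) \<le> (\<Sum>ws\<in>{ws \<in> ?X. out ws = out b}. \<phi> ws)"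
      unfolding fib .
  qed
  have "(\<Sum>ws\<in>?X. h ws) = real (card (hits d I g)) * real (card W) ^ card I"
    unfolding h_def hits_def using fX by (simp add: sum.If_cases Int_def)
  moreover have "(\<Sum>ws\<in>?X. \<phi> ws) = real (card {ws \<in> ?X. ?cov ws}) * (real (card W) ^ ?m * (d * (card W + 1)))"
    unfolding \<phi>_def using fX by (simp add: sum.If_cases Int_def)
  ultimately show ?thesis using main by (simp add: mult_ac)
qed

end

section \<open>Bounds for the two kinds of exceptional words\<close>

text \<open>
  For negative arguments, compare with \<open>1 / (1 - x)\<close>.
\<close>

lemma exp_le_quadratic:
  fixes x :: real
  assumes "\<bar>x\<bar> \<le> 1"
  shows "exp x \<le> 1 + x + x ^ 2"
proof (cases "x \<ge> 0")
  case True
  then show ?thesis using exp_bound[of x] assms by simp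
next
  case False
  define y where "y = - x"
  have y: "0 < y" "y \<le> 1" using False assms by (auto simp: y_def)
  have "1 \<le> (1 - y + y ^ 2) * (1 + y)" using y by (simp add: algebra_simps power2_eq_square)
  also have "\<dots> \<le> (1 - y + y ^ 2) * exp y"
  proof (rule mult_left_mono[OF exp_ge_add_one_self_aux])
    have "0 \<le> y ^ 2" by simp
    then show "0 \<le> 1 - y + y ^ 2" using y by linarith
  qed (use y in auto)
  finally have "exp (- y) * 1 \<le> exp (- y) * ((1 - y + y ^ 2) * exp y)" by (intro mult_left_mono) auto
  also have "\<dots> = 1 - y + y ^ 2" by (simp add: exp_minus field_simps)
  finally show ?thesis by (simp add: y_def)
qed

context finite_comm_group
begin

text \<open>
  There are at most \<open>(n choose m) * order G ^ m * card W ^ (n - m)\<close> words of this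
  kind. The powers of \<open>card W\<close> cancel against the density in
  \<open>near_coset_hits\<close>, and the covering estimate remains.
\<close>

lemma near_coset_sum:
  fixes I :: "'i set"
  assumes W: "subgroup W G" and I: "finite I" "card I = n" and d: "d \<ge> 3"
    and m: "m \<ge> 1" "m + d * m div 2 \<le> n"
    and A: "A \<subseteq> {g \<in> PiE I (\<lambda>_. carrier G). card {i \<in> I. g i \<notin> W} = m}"
    and small: "\<And>g J. g \<in> A \<Longrightarrow> J \<subseteq> I \<Longrightarrow> card J = card {i \<in> I. g i \<in> W} \<Longrightarrow>
      (\<Sum>\<psi>\<in>{\<psi> \<in> PiE J (\<lambda>_. chars (G\<lparr>carrier := W\<rparr>)). \<forall>\<xi>\<in>chars (G\<lparr>carrier := W\<rparr>). \<exists>i\<in>J. \<psi> i \<noteq> \<xi>}.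
        norm (ft J (filter_mset (\<lambda>v. v \<in> W) (image_mset g (mset_set I))) \<psi>) ^ 3) \<le> 1"
  shows "(\<Sum>g\<in>A. hit_prob d I g) \<le> d * (card W + 1) * (order G * (exp 1 * d) ^ d * sqrt (m / n)) ^ m"
proof -
  let ?u = "d * m div 2"
  let ?w = "real (card W)" and ?D = "real (d * (card W + 1))"
  define E where "E = (((real m + real ?u) / n) ^ m) ^ d"
  define \<beta> where "\<beta> = ?w ^ m * ?D / ?w ^ n * (real (n choose ?u) * E)"
  have w: "?w > 0" using subgroup.finite_imp_card_positive[OF W finite_carrier] by simp
  have E0: "E \<ge> 0" by (simp add: E_def)
  have \<beta>0: "\<beta> \<ge> 0" using E0 by (simp add: \<beta>_def)
  have "3 * m \<le> d * m" using d by simp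
  then have "m \<le> ?u" using m by linarith
  then have mn: "m < n" using m by linarith
  have each: "hit_prob d I g \<le> \<beta>" if gA: "g \<in> A" for g
  proof -
    let ?M = "image_mset g (mset_set I)"
    let ?T = "words I ?M"
    have g: "g \<in> PiE I (\<lambda>_. carrier G)" "card {i \<in> I. g i \<notin> W} = m" using A gA by auto
    have sz: "card {i \<in> I. w i \<notin> W} = m" if "w \<in> ?T" for w
    proof -
      have "?M = image_mset w (mset_set I)" using that by (simp only: words_def mem_Collect_eq)
      then have "size (filter_mset (\<lambda>v. v \<notin> W) ?M) = size (filter_mset (\<lambda>v. v \<notin> W) (image_mset w (mset_set I)))" by (simp only:)
      then show ?thesis using g(2) by (simp add: filter_mset_image_mset filter_mset_mset_set[OF I(1)])
    qed
    have N: "real (card ?T) > 0" using card_words_pos[OF I(1), of ?M] by simp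
    let ?c = "card {ws \<in> PiE {..<d} (\<lambda>_. ?T). \<forall>i\<in>I - {i \<in> I. g i \<notin> W}. card {k \<in> {..<d}. ws k i \<notin> W} \<noteq> 1}"
    let ?cov = "real ?c"
    have "real (card (hits d I g)) * card W ^ card I
      \<le> card W ^ card {i \<in> I. g i \<notin> W} * (d * (card W + 1)) * ?c"
    proof (rule near_coset_hits[OF W I(1) g(1) d])
      show "card {i \<in> I. g i \<notin> W} < card I" using g(2) mn I(2) by simp
    qed (rule small[OF gA])
    then have "real (card (hits d I g)) * ?w ^ n \<le> ?w ^ m * ?D * ?cov"
      unfolding g(2) I(2) of_nat_mult of_nat_power .
    also have "\<dots> \<le> ?w ^ m * ?D * ((n choose ?u) * (card ?T * ((real m + real ?u) / n) ^ m) ^ d)"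
    proof (rule mult_left_mono)
      show "?cov \<le> (n choose ?u) * (card ?T * ((real m + real ?u) / n) ^ m) ^ d"
      proof -
        have "real ?c \<le> (card I choose ?u) * (card ?T * ((real m + real ?u) / card I) ^ m) ^ d"
        proof (rule covering_count[OF I(1)])
          show "card {i \<in> I. w i \<notin> W} = m" if "w \<in> ?T" for w by (rule sz[OF that])
        qed (use g(2) m I(2) in auto)
        then show ?thesis by (simp only: I(2))
      qed
    qed simp
    also have "\<dots> = ?w ^ m * ?D * ((n choose ?u) * E) * real (card ?T) ^ d"
      by (simp add: E_def power_mult_distrib)
    finally show ?thesis unfolding hit_prob_def \<beta>_def using w N by (simp add: divide_simps mult_ac)
  qed
  have finC: "finite {g \<in> PiE I (\<lambda>_. carrier G). card {i \<in> I. g i \<notin> W} = m}"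
    using I finite_carrier by (auto intro!: finite_PiE)
  have "(\<Sum>g\<in>A. hit_prob d I g) \<le> (\<Sum>g\<in>A. \<beta>)" by (rule sum_mono[OF each])
  also have "\<dots> \<le> real (card {g \<in> PiE I (\<lambda>_. carrier G). card {i \<in> I. g i \<notin> W} = m}) * \<beta>"
    using card_mono[OF finC A] \<beta>0 by (simp add: mult_right_mono)
  also have "\<dots> \<le> real ((n choose m) * (card (carrier G) ^ m * card W ^ (n - m))) * \<beta>"
    using card_off_set[OF I(1) finite_carrier subgroup.subset[OF W], of m] mn I(2) \<beta>0
    by (intro mult_right_mono of_nat_mono) auto
  also have "\<dots> = ?D * real (order G) ^ m * (real (n choose m) * real (n choose ?u) * E) * (?w ^ (n - m) * ?w ^ m / ?w ^ n)"
    by (simp add: \<beta>_def order_def)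
  also have "?w ^ (n - m) * ?w ^ m / ?w ^ n = 1"
    using mn w by (simp flip: power_add)
  also have "?D * real (order G) ^ m * (real (n choose m) * real (n choose ?u) * E) * 1
    \<le> ?D * real (order G) ^ m * ((exp 1 * d) ^ d * sqrt (m / n)) ^ m"
    using covering_estimate[OF d m(1) _ refl, of n] mn by (simp add: E_def mult_left_mono)
  also have "\<dots> = ?D * (order G * (exp 1 * d) ^ d * sqrt (m / n)) ^ m"
    by (simp add: power_mult_distrib)
  finally show ?thesis by simp
qed

text \<open>
  Let \<open>a\<close> be the modulus of the mean of \<open>\<xi>\<close> over the letters. If the
  combination of \<open>r\<close> with the two words has type \<open>M\<close>, then the sum of
  \<open>\<xi>\<close> over its letters has modulus \<open>n a\<close> and a phase that depends on
  \<open>M\<close> only. For independent letters, however, the expectation of that sum has modulus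
  at most \<open>n a ^ 2\<close>. The exponential moment bound in the direction of this phase
  gives \<open>exp (- n (a - a ^ 2) ^ 2 / 4)\<close>, and the method of types passes from
  independent letters to uniform words, once for each of the two words.
\<close>

lemma same_type_pair_bound:
  fixes I :: "'i set"
  assumes I: "finite I" "I \<noteq> {}" and M: "size M = card I" "set_mset M \<subseteq> carrier G" and \<xi>: "\<xi> \<in> chars G"
    and r: "\<And>i. i \<in> I \<Longrightarrow> r i \<in> carrier G"
    and a: "a = norm (\<Sum>v\<in>#M. \<xi> v) / card I"
  shows "real (card {(w1, w2) \<in> words I M \<times> words I M. (\<lambda>i\<in>I. r i \<otimes> inv (w1 i) \<otimes> inv (w2 i)) \<in> words I M})
    \<le> real (card (words I M)) ^ 2 * ((real (card I) + 1) ^ (2 * order G) * exp (- real (card I) * (a - a ^ 2) ^ 2 / 4))"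
proof -
  let ?n = "real (card I)" and ?T = "words I M" and ?V = "carrier G"
  define Z where "Z = (\<Sum>v\<in>#M. \<xi> v)"
  define p where "p v = real (count M v) / ?n" for v
  define P0 where "P0 = (\<Prod>v\<in>?V. p v ^ count M v)"
  \<comment> \<open>c rotates the common value Z of the character sum to the positive real axis.\<close>
  define c where "c = cnj (sgn Z)"
  \<comment> \<open>t minimises the exponent - t (a - a^2) + t^2 of the moment bound.\<close>
  define t where "t = (a - a ^ 2) / 2"
  define X where "X i v1 v2 = Re (c * \<xi> (r i) * cnj (\<xi> v1) * cnj (\<xi> v2))" for i v1 v2
  let ?Q = "{(w1, w2) \<in> ?T \<times> ?T. (\<lambda>i\<in>I. r i \<otimes> inv (w1 i) \<otimes> inv (w2 i)) \<in> ?T}"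
  have n: "?n > 0" using I by (simp add: card_gt_0_iff)
  have fT: "finite ?T" by (rule finite_words[OF I(1)])
  have Za: "norm Z = ?n * a" using n by (simp add: a Z_def)
  have "norm Z \<le> (\<Sum>v\<in>#M. 1)"
    unfolding Z_def using M(2) by (induction M) (auto intro!: order_trans[OF norm_triangle_ineq] add_mono simp: char_norm[OF \<xi>])
  then have "norm Z \<le> ?n" using M by simp
  then have a01: "0 \<le> a" "a \<le> 1" using n by (auto simp: a Z_def)
  then have "a ^ 2 \<le> a" by (simp add: power2_eq_square mult_left_le)
  moreover have "a - a ^ 2 \<le> 1" using a01 zero_le_power2[of a] by linarith
  ultimately have t: "0 \<le> t" "t \<le> 1" by (auto simp: t_def)
  have cn: "norm c \<le> 1" by (simp add: c_def norm_sgn)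
  have cZ: "c * Z = of_real (norm Z)"
    unfolding c_def sgn_eq
    by (cases "Z = 0") (simp_all add: mult.commute[of "cnj Z"] complex_norm_square[symmetric] power2_eq_square)
  have p0: "p v \<ge> 0" for v by (simp add: p_def)
  have psum: "(\<Sum>v\<in>?V. p v) = 1"
    using sum_count[OF finite_carrier M(2)] n M(1) by (simp add: p_def flip: sum_divide_distrib of_nat_sum)
  have pxi: "(\<Sum>v\<in>?V. p v * \<xi> v) = Z / ?n"
    unfolding Z_def p_def sum_mset_count[OF finite_carrier M(2)] by (simp add: sum_divide_distrib)
  have pw: "(\<Prod>i\<in>I. p (w i)) = P0" if w: "w \<in> ?T" for w
  proof -
    have "(\<Prod>i\<in>I. p (w i)) = (\<Prod>v\<in>#M. p v)" by (rule words_prod_mset[OF w])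
    also have "\<dots> = (\<Prod>v\<in>set_mset M. p v ^ count M v)" by (rule image_prod_mset_multiplicity)
    also have "\<dots> = P0" unfolding P0_def
      by (rule prod.mono_neutral_left) (use M finite_carrier in \<open>auto simp: not_in_iff\<close>)
    finally show ?thesis .
  qed
  have mt: "1 \<le> (?n + 1) ^ order G * (real (card ?T) * P0)"
    using method_of_types[OF I(1) finite_carrier M(2,1) I(2)] by (simp add: P0_def p_def order_def)
  have P00: "P0 > 0"
  proof -
    have "P0 \<ge> 0" unfolding P0_def by (intro prod_nonneg zero_le_power p0)
    moreover have "P0 \<noteq> 0" using mt by auto
    ultimately show ?thesis by simp
  qed
  have Xle: "\<bar>X i v1 v2\<bar> \<le> 1" for i v1 v2
  proof -
    have "\<bar>X i v1 v2\<bar> \<le> norm (c * \<xi> (r i) * cnj (\<xi> v1) * cnj (\<xi> v2))" unfolding X_def by (rule abs_Re_le_cmod)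
    also have "\<dots> \<le> 1" using cn char_norm_le[OF \<xi>] by (simp add: norm_mult mult_le_one)
    finally show ?thesis .
  qed
  have factor: "(\<Sum>v1\<in>?V. \<Sum>v2\<in>?V. p v1 * p v2 * exp (t * X i v1 v2)) \<le> exp (t * a ^ 2 + t ^ 2)" if i: "i \<in> I" for i
  proof -
    have "(\<Sum>v1\<in>?V. \<Sum>v2\<in>?V. p v1 * p v2 * exp (t * X i v1 v2)) \<le> (\<Sum>v1\<in>?V. \<Sum>v2\<in>?V. p v1 * p v2 * (1 + t * X i v1 v2 + t ^ 2))"
    proof (intro sum_mono mult_left_mono)
      fix v1 v2
      have tx: "\<bar>t * X i v1 v2\<bar> \<le> t" using mult_left_mono[OF Xle t(1), of i v1 v2] t by (simp add: abs_mult)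
      then have "exp (t * X i v1 v2) \<le> 1 + t * X i v1 v2 + (t * X i v1 v2) ^ 2"
        using t by (intro exp_le_quadratic) linarith
      also have "(t * X i v1 v2) ^ 2 \<le> t ^ 2" using tx t by (metis abs_ge_zero abs_of_nonneg power2_abs power_mono)
      finally show "exp (t * X i v1 v2) \<le> 1 + t * X i v1 v2 + t ^ 2" by simp
    qed (use p0 in simp)
    also have "\<dots> = (1 + t ^ 2) * (\<Sum>v1\<in>?V. \<Sum>v2\<in>?V. p v1 * p v2) + t * (\<Sum>v1\<in>?V. \<Sum>v2\<in>?V. p v1 * p v2 * X i v1 v2)"
      by (simp add: sum_distrib_left sum.distrib[symmetric] algebra_simps)
    also have "(\<Sum>v1\<in>?V. \<Sum>v2\<in>?V. p v1 * p v2) = 1"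
      using psum by (simp add: sum_product[symmetric])
    finally have up: "(\<Sum>v1\<in>?V. \<Sum>v2\<in>?V. p v1 * p v2 * exp (t * X i v1 v2))
      \<le> (1 + t ^ 2) * 1 + t * (\<Sum>v1\<in>?V. \<Sum>v2\<in>?V. p v1 * p v2 * X i v1 v2)" .
    have "(\<Sum>v1\<in>?V. \<Sum>v2\<in>?V. p v1 * p v2 * X i v1 v2) = Re (c * \<xi> (r i) * cnj ((\<Sum>v\<in>?V. p v * \<xi> v) * (\<Sum>v\<in>?V. p v * \<xi> v)))"
    proof -
      have "(\<Sum>v1\<in>?V. \<Sum>v2\<in>?V. p v1 * p v2 * X i v1 v2) = Re (\<Sum>v1\<in>?V. \<Sum>v2\<in>?V. of_real (p v1 * p v2) * (c * \<xi> (r i) * cnj (\<xi> v1) * cnj (\<xi> v2)))"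
      proof -
        have "Re (of_real s * z) = s * Re z" for s z by simp
        then show ?thesis unfolding X_def Re_sum by (simp only:)
      qed
      also have "(\<Sum>v1\<in>?V. \<Sum>v2\<in>?V. of_real (p v1 * p v2) * (c * \<xi> (r i) * cnj (\<xi> v1) * cnj (\<xi> v2)))
        = c * \<xi> (r i) * cnj ((\<Sum>v\<in>?V. p v * \<xi> v) * (\<Sum>v\<in>?V. p v * \<xi> v))"
      proof -
        have e: "cnj ((\<Sum>v\<in>?V. p v * \<xi> v) * (\<Sum>v\<in>?V. p v * \<xi> v)) = (\<Sum>v1\<in>?V. \<Sum>v2\<in>?V. cnj ((p v1 * \<xi> v1) * (p v2 * \<xi> v2)))"
          by (simp only: sum_product cnj_sum)
        show ?thesis unfolding e unfolding sum_distrib_left by (intro sum.cong refl) (simp add: mult_ac)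
      qed
      finally show ?thesis .
    qed
    also have "\<dots> \<le> norm (c * \<xi> (r i) * cnj ((\<Sum>v\<in>?V. p v * \<xi> v) * (\<Sum>v\<in>?V. p v * \<xi> v)))"
      by (rule complex_Re_le_cmod)
    also have "\<dots> = norm c * norm (\<xi> (r i)) * a ^ 2"
      unfolding pxi norm_mult complex_mod_cnj norm_divide using n by (simp add: Za power2_eq_square)
    also have "\<dots> \<le> 1 * 1 * a ^ 2"
      using cn char_norm_le[OF \<xi>, of "r i"] by (intro mult_right_mono mult_mono) auto
    finally have "t * (\<Sum>v1\<in>?V. \<Sum>v2\<in>?V. p v1 * p v2 * X i v1 v2) \<le> t * (1 * 1 * a ^ 2)"
      by (rule mult_left_mono[OF _ t(1)])
    then have "(\<Sum>v1\<in>?V. \<Sum>v2\<in>?V. p v1 * p v2 * exp (t * X i v1 v2)) \<le> 1 + (t * a ^ 2 + t ^ 2)"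
      using up by simp
    also have "\<dots> \<le> exp (t * a ^ 2 + t ^ 2)" by (rule exp_ge_add_one_self)
    finally show ?thesis .
  qed
  have one: "1 = exp (t * (\<Sum>i\<in>I. X i (w1 i) (w2 i)) - t * (?n * a))" if q: "(w1, w2) \<in> ?Q" for w1 w2
  proof -
    let ?x = "\<lambda>i\<in>I. r i \<otimes> inv (w1 i) \<otimes> inv (w2 i)"
    have w: "w1 \<in> ?T" "w2 \<in> ?T" "?x \<in> ?T" using q by auto
    have "(\<Sum>i\<in>I. \<xi> (?x i)) = Z" unfolding Z_def by (rule words_sum_mset[OF w(3)])
    moreover have "\<xi> (?x i) = \<xi> (r i) * cnj (\<xi> (w1 i)) * cnj (\<xi> (w2 i))" if "i \<in> I" for i
      using that r[OF that] words_carrier[OF I(1) M(2) w(1) that] words_carrier[OF I(1) M(2) w(2) that]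
      by (simp add: char_mult[OF \<xi>] char_inv[OF \<xi>])
    ultimately have "(\<Sum>i\<in>I. \<xi> (r i) * cnj (\<xi> (w1 i)) * cnj (\<xi> (w2 i))) = Z" by simp
    then have "(\<Sum>i\<in>I. c * \<xi> (r i) * cnj (\<xi> (w1 i)) * cnj (\<xi> (w2 i))) = c * Z"
      by (simp add: sum_distrib_left[symmetric] mult.assoc)
    then have "(\<Sum>i\<in>I. X i (w1 i) (w2 i)) = Re (c * Z)" unfolding X_def Re_sum[symmetric] by (simp only:)
    then show ?thesis by (simp add: cZ Za)
  qed
  have TV: "?T \<subseteq> PiE I (\<lambda>_. ?V)" by (rule words_PiE[OF I(1) M(2)])
  have fP: "finite (PiE I (\<lambda>_. ?V))" using I finite_carrier by (auto intro!: finite_PiE)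
  have "real (card ?Q) * P0 ^ 2 = (\<Sum>q\<in>?Q. P0 ^ 2)" by simp
  also have "\<dots> = (\<Sum>(w1, w2)\<in>?Q. (\<Prod>i\<in>I. p (w1 i)) * (\<Prod>i\<in>I. p (w2 i)) * exp (t * (\<Sum>i\<in>I. X i (w1 i) (w2 i)) - t * (?n * a)))"
    by (intro sum.cong refl) (use one in \<open>auto simp: pw power2_eq_square\<close>)
  also have "\<dots> \<le> (\<Sum>(w1, w2)\<in>PiE I (\<lambda>_. ?V) \<times> PiE I (\<lambda>_. ?V). (\<Prod>i\<in>I. p (w1 i)) * (\<Prod>i\<in>I. p (w2 i)) * exp (t * (\<Sum>i\<in>I. X i (w1 i) (w2 i)) - t * (?n * a)))"
    by (rule sum_mono2) (use TV fP in \<open>auto intro!: mult_nonneg_nonneg prod_nonneg p0\<close>)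
  also have "\<dots> = exp (- t * (?n * a)) * (\<Sum>w1\<in>PiE I (\<lambda>_. ?V). \<Sum>w2\<in>PiE I (\<lambda>_. ?V). \<Prod>i\<in>I. p (w1 i) * p (w2 i) * exp (t * X i (w1 i) (w2 i)))"
    by (simp add: sum.cartesian_product[symmetric] sum_distrib_left exp_diff exp_minus exp_sum[OF I(1)] prod.distrib divide_inverse mult_ac)
  finally have up: "real (card ?Q) * P0 ^ 2 \<le> exp (- t * (?n * a)) *
    (\<Sum>w1\<in>PiE I (\<lambda>_. ?V). \<Sum>w2\<in>PiE I (\<lambda>_. ?V). \<Prod>i\<in>I. p (w1 i) * p (w2 i) * exp (t * X i (w1 i) (w2 i)))" .
  have "(\<Sum>w1\<in>PiE I (\<lambda>_. ?V). \<Sum>w2\<in>PiE I (\<lambda>_. ?V). \<Prod>i\<in>I. p (w1 i) * p (w2 i) * exp (t * X i (w1 i) (w2 i)))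
    = (\<Prod>i\<in>I. \<Sum>v1\<in>?V. \<Sum>v2\<in>?V. p v1 * p v2 * exp (t * X i v1 v2))"
  proof -
    have "(\<Sum>w2\<in>PiE I (\<lambda>_. ?V). \<Prod>i\<in>I. p (w1 i) * p (w2 i) * exp (t * X i (w1 i) (w2 i)))
      = (\<Prod>i\<in>I. \<Sum>v2\<in>?V. p (w1 i) * p v2 * exp (t * X i (w1 i) v2))" for w1
      by (rule sum_PiE_prod[OF I(1) finite_carrier, of "\<lambda>i v2. p (w1 i) * p v2 * exp (t * X i (w1 i) v2)"])
    then show ?thesis
      using sum_PiE_prod[OF I(1) finite_carrier, of "\<lambda>i v1. \<Sum>v2\<in>?V. p v1 * p v2 * exp (t * X i v1 v2)"] by simp
  qed
  also have "\<dots> \<le> (\<Prod>i\<in>I. exp (t * a ^ 2 + t ^ 2))"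
    by (intro prod_mono conjI factor sum_nonneg mult_nonneg_nonneg p0) auto
  also have "\<dots> = exp (?n * (t * a ^ 2 + t ^ 2))" by (simp add: exp_of_nat_mult)
  finally have "exp (- t * (?n * a)) * (\<Sum>w1\<in>PiE I (\<lambda>_. ?V). \<Sum>w2\<in>PiE I (\<lambda>_. ?V). \<Prod>i\<in>I. p (w1 i) * p (w2 i) * exp (t * X i (w1 i) (w2 i)))
    \<le> exp (- t * (?n * a)) * exp (?n * (t * a ^ 2 + t ^ 2))"
    by (rule mult_left_mono) simp
  note order_trans[OF up this]
  also have "\<dots> = exp (- ?n * (a - a ^ 2) ^ 2 / 4)"
    unfolding exp_add[symmetric] by (rule arg_cong[where f = exp]) (simp add: t_def field_simps power2_eq_square)
  finally have main: "real (card ?Q) * P0 ^ 2 \<le> exp (- ?n * (a - a ^ 2) ^ 2 / 4)" .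
  have "1 \<le> ((?n + 1) ^ order G * (real (card ?T) * P0)) ^ 2" using mt by simp
  then have "real (card ?Q) \<le> real (card ?Q) * ((?n + 1) ^ order G * (real (card ?T) * P0)) ^ 2"
    by (simp add: mult_left_le mult_le_cancel_left1)
  also have "\<dots> = ((?n + 1) ^ order G * real (card ?T)) ^ 2 * (real (card ?Q) * P0 ^ 2)"
    by (simp add: power_mult_distrib)
  also have "\<dots> \<le> ((?n + 1) ^ order G * real (card ?T)) ^ 2 * exp (- ?n * (a - a ^ 2) ^ 2 / 4)"
    by (intro mult_left_mono main) simp
  finally show ?thesis by (simp add: power_mult_distrib power_mult[symmetric] mult_ac)
qed

text \<open>
  The first word of a solution is determined by the others and has type \<open>M\<close>. Fixing
  all others but two leaves the situation of \<open>same_type_pair_bound\<close>, which is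
  available as soon as \<open>d \<ge> 3\<close>.
\<close>

lemma atypical_type_sum:
  fixes I :: "'i set"
  assumes I: "finite I" "I \<noteq> {}" and M: "size M = card I" "set_mset M \<subseteq> carrier G" and \<xi>: "\<xi> \<in> chars G" and d: "d \<ge> 3"
    and a: "a = norm (\<Sum>v\<in>#M. \<xi> v) / card I"
  shows "(\<Sum>g\<in>words I M. hit_prob d I g) \<le> (real (card I) + 1) ^ (2 * order G) * exp (- real (card I) * (a - a ^ 2) ^ 2 / 4)"
proof -
  let ?T = "words I M" and ?K = "{3..<d}"
  define \<epsilon> where "\<epsilon> = (real (card I) + 1) ^ (2 * order G) * exp (- real (card I) * (a - a ^ 2) ^ 2 / 4)"
  have N: "real (card ?T) > 0" using card_words_pos[OF I(1) M(1)] by simp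
  have fT: "finite ?T" by (rule finite_words[OF I(1)])
  have "hit_prob d I g \<le> \<epsilon> / card ?T" if g: "g \<in> ?T" for g
  proof -
    have gM: "image_mset g (mset_set I) = M" using g by (simp only: words_def mem_Collect_eq)
    have gc: "g i \<in> carrier G" if "i \<in> I" for i by (rule words_carrier[OF I(1) M(2) g that])
    define r where "r R i = g i [^] d \<otimes> inv (finprod G (\<lambda>k. R k i) ?K)" for R :: "nat \<Rightarrow> 'i \<Rightarrow> 'a" and i
    define Q where "Q R = {(w1, w2) \<in> ?T \<times> ?T. (\<lambda>i\<in>I. r R i \<otimes> inv (w1 i) \<otimes> inv (w2 i)) \<in> ?T}" for R
    let ?PK = "PiE ?K (\<lambda>_. ?T)"
    have finQ: "finite (Q R)" for R unfolding Q_def by (rule finite_subset[of _ "?T \<times> ?T"]) (use fT in auto)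
    have fPK: "finite ?PK" using fT by (auto intro!: finite_PiE)
    have Rc: "(\<lambda>k. R k i) \<in> ?K \<rightarrow> carrier G" if "R \<in> ?PK" "i \<in> I" for R i
    proof
      fix k assume "k \<in> ?K"
      then have "R k \<in> ?T" using that by auto
      then show "R k i \<in> carrier G" using words_carrier[OF I(1) M(2) _ that(2)] by blast
    qed
    let ?f = "\<lambda>ws :: nat \<Rightarrow> 'i \<Rightarrow> 'a. (restrict ws ?K, (ws 1, ws 2))"
    have ds: "{..<d} = insert 0 (insert 1 (insert 2 ?K))" using d by auto
    have key: "ws 0 = (\<lambda>i\<in>I. r (restrict ws ?K) i \<otimes> inv (ws 1 i) \<otimes> inv (ws 2 i)) \<and> ws 0 \<in> ?T \<and> ws 1 \<in> ?T \<and> ws 2 \<in> ?T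
      \<and> restrict ws ?K \<in> ?PK" if ws: "ws \<in> hits d I g" for ws
    proof -
      have wT: "ws k \<in> ?T" if "k < d" for k using ws that unfolding hits_def gM by auto
      have t: "ws 0 \<in> ?T" "ws 1 \<in> ?T" "ws 2 \<in> ?T" by (rule wT, use d in simp)+
      have R: "restrict ws ?K \<in> ?PK" using wT by auto
      have "ws 0 = (\<lambda>i\<in>I. r (restrict ws ?K) i \<otimes> inv (ws 1 i) \<otimes> inv (ws 2 i))"
      proof (rule extensionalityI[where A = I])
        show "ws 0 \<in> extensional I" using t by (simp only: words_def mem_Collect_eq)
        fix i assume i: "i \<in> I"
        let ?P = "finprod G (\<lambda>k. restrict ws ?K k i) ?K"
        have c: "ws 0 i \<in> carrier G" "ws 1 i \<in> carrier G" "ws 2 i \<in> carrier G"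
          using words_carrier[OF I(1) M(2) _ i] t by auto
        have kc: "(\<lambda>k. ws k i) \<in> ?K \<rightarrow> carrier G" using Rc[OF R i] by (auto simp: Pi_def)
        have P: "?P \<in> carrier G" by (rule finprod_closed[OF Rc[OF R i]])
        have Pe: "finprod G (\<lambda>k. ws k i) ?K = ?P"
          by (rule finprod_cong') (use Rc[OF R i] in auto)
        have "g i [^] d = finprod G (\<lambda>k. ws k i) {..<d}" using ws i by (simp add: hits_def)
        also have "\<dots> = ws 0 i \<otimes> (ws 1 i \<otimes> (ws 2 i \<otimes> ?P))"
          unfolding ds Pe[symmetric] using c kc by simp
        finally have "r (restrict ws ?K) i \<otimes> inv (ws 1 i) \<otimes> inv (ws 2 i) = ws 0 i \<otimes> (ws 1 i \<otimes> (ws 2 i \<otimes> ?P)) \<otimes> inv ?P \<otimes> inv (ws 1 i) \<otimes> inv (ws 2 i)"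
          by (simp only: r_def)
        also have "\<dots> = ws 0 i \<otimes> (ws 1 i \<otimes> inv (ws 1 i)) \<otimes> (ws 2 i \<otimes> inv (ws 2 i)) \<otimes> (?P \<otimes> inv ?P)"
          using c P by (simp only: m_ac m_closed inv_closed)
        also have "\<dots> = ws 0 i" using c P by simp
        finally show "ws 0 i = (\<lambda>i\<in>I. r (restrict ws ?K) i \<otimes> inv (ws 1 i) \<otimes> inv (ws 2 i)) i" using i by simp
      qed simp
      then show ?thesis using t R by blast
    qed
    have inj: "inj_on ?f (hits d I g)"
    proof (rule inj_onI)
      fix ws ws' assume h: "ws \<in> hits d I g" "ws' \<in> hits d I g" "?f ws = ?f ws'"
      have "ws 0 = ws' 0" using key[OF h(1)] key[OF h(2)] h(3) by simp
      moreover have "ws k = ws' k" if "k \<in> ?K" for k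
      proof -
        have "restrict ws ?K = restrict ws' ?K" using h(3) by blast
        then have "restrict ws ?K k = restrict ws' ?K k" by (rule arg_cong)
        then show ?thesis using that by (simp only: restrict_apply if_True)
      qed
      ultimately have "ws k = ws' k" if "k < d" for k
        using that h(3) ds by (cases "k \<in> ?K") (auto simp: not_le numeral_3_eq_3 less_Suc_eq numeral_2_eq_2)
      moreover have "ws \<in> extensional {..<d}" "ws' \<in> extensional {..<d}" using h by (auto simp: hits_def PiE_def)
      ultimately show "ws = ws'" by (intro extensionalityI[where A = "{..<d}"]) auto
    qed
    have sub: "?f ` hits d I g \<subseteq> Sigma ?PK Q"
    proof (intro image_subsetI SigmaI)
      fix ws assume ws: "ws \<in> hits d I g"
      note k = key[OF ws]
      show "restrict ws ?K \<in> ?PK" using k by blast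
      show "(ws 1, ws 2) \<in> Q (restrict ws ?K)" using k unfolding Q_def by auto
    qed
    have "card (hits d I g) \<le> card (Sigma ?PK Q)"
      by (rule card_inj_on_le[OF inj sub]) (use fPK finQ in auto)
    also have "\<dots> = (\<Sum>R\<in>?PK. card (Q R))" by (rule card_SigmaI[OF fPK]) (use finQ in auto)
    finally have "real (card (hits d I g)) \<le> (\<Sum>R\<in>?PK. real (card (Q R)))"
      by (metis of_nat_le_iff of_nat_sum)
    also have "\<dots> \<le> (\<Sum>R\<in>?PK. real (card ?T) ^ 2 * \<epsilon>)"
      unfolding Q_def \<epsilon>_def
      by (intro sum_mono same_type_pair_bound[OF I M \<xi> _ a]) (use Rc gc in \<open>auto simp: r_def\<close>)
    also have "\<dots> = real (card ?T) ^ (d - 3) * (real (card ?T) ^ 2 * \<epsilon>)" by (simp add: card_PiE)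
    finally have "real (card (hits d I g)) * card ?T \<le> real (card ?T) ^ (d - 3) * (real (card ?T) ^ 2 * \<epsilon>) * card ?T"
      by (rule mult_right_mono) simp
    also have "\<dots> = real (card ?T) ^ (d - 3 + 3) * \<epsilon>" by (simp only: power_add) (simp add: power2_eq_square power3_eq_cube)
    also have "d - 3 + 3 = d" using d by simp
    finally show ?thesis unfolding hit_prob_def gM using N by (simp add: field_simps)
  qed
  then have "(\<Sum>g\<in>?T. hit_prob d I g) \<le> (\<Sum>g\<in>?T. \<epsilon> / card ?T)" by (rule sum_mono)
  also have "\<dots> = \<epsilon>" using N by simp
  finally show ?thesis by (simp add: \<epsilon>_def)
qed

end

section \<open>Flatness, concentration and translation\<close>

context finite_comm_group
begin

text \<open>
  The finitely many values of characters different from 1 have real part bounded away from 1.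
\<close>

lemma char_gap: "\<exists>\<kappa>>0. \<forall>\<xi>\<in>chars G. \<forall>v\<in>carrier G. \<xi> v \<noteq> 1 \<longrightarrow> \<kappa> \<le> 1 - Re (\<xi> v)"
proof -
  let ?S = "insert 1 {1 - Re (\<xi> v) | \<xi> v. \<xi> \<in> chars G \<and> v \<in> carrier G \<and> \<xi> v \<noteq> 1}"
  have "{1 - Re (\<xi> v) | \<xi> v. \<xi> \<in> chars G \<and> v \<in> carrier G \<and> \<xi> v \<noteq> 1} \<subseteq> (\<lambda>(\<xi>, v). 1 - Re (\<xi> v)) ` (chars G \<times> carrier G)"
    by auto
  then have fin: "finite ?S" using finite_chars finite_carrier by (simp add: finite_subset)
  have pos: "s > 0" if s: "s \<in> ?S" for s
  proof (cases "s = 1")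
    case False
    then obtain \<xi> v where h: "s = 1 - Re (\<xi> v)" "\<xi> \<in> chars G" "v \<in> carrier G" "\<xi> v \<noteq> 1" using s by auto
    have n: "norm (\<xi> v) = 1" by (rule char_norm[OF h(2,3)])
    have "Re (\<xi> v) \<noteq> 1"
    proof
      assume r: "Re (\<xi> v) = 1"
      then have "Im (\<xi> v) = 0" using n by (simp add: cmod_def)
      then show False using r h(4) by (simp add: complex_eq_iff)
    qed
    moreover have "Re (\<xi> v) \<le> 1" using complex_Re_le_cmod[of "\<xi> v"] n by simp
    ultimately show ?thesis using h by simp
  qed simp
  have "Min ?S \<in> ?S" by (rule Min_in[OF fin]) simp
  then have "Min ?S > 0" by (rule pos)
  moreover have "Min ?S \<le> 1 - Re (\<xi> v)" if "\<xi> \<in> chars G" "v \<in> carrier G" "\<xi> v \<noteq> 1" for \<xi> v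
    by (rule Min_le[OF fin]) (use that in blast)
  ultimately show ?thesis by blast
qed

text \<open>
  The right side is the sum of \<open>1 - Re (\<xi> (g i \<otimes> inv (g j)))\<close> over all
  pairs of positions. The pairs with \<open>g i = v0\<close> and \<open>\<xi> (g j) \<noteq> \<xi>
  v0\<close> alone contribute the left side.
\<close>

lemma char_concentration:
  assumes I: "finite I" and g: "g \<in> PiE I (\<lambda>_. carrier G)" and \<xi>: "\<xi> \<in> chars G" and v0: "v0 \<in> carrier G"
    and \<kappa>: "\<kappa> > 0" "\<And>v. v \<in> carrier G \<Longrightarrow> \<xi> v \<noteq> 1 \<Longrightarrow> \<kappa> \<le> 1 - Re (\<xi> v)"
  shows "\<kappa> * card {i \<in> I. g i = v0} * card {i \<in> I. \<xi> (g i) \<noteq> \<xi> v0} \<le> real (card I) ^ 2 - norm (\<Sum>i\<in>I. \<xi> (g i)) ^ 2"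
proof -
  let ?A = "{i \<in> I. g i = v0}" and ?B = "{i \<in> I. \<xi> (g i) \<noteq> \<xi> v0}"
  have gc: "g i \<in> carrier G" if "i \<in> I" for i using g that by auto
  have re: "Re (\<xi> (g i) * cnj (\<xi> (g j))) = Re (\<xi> (g i \<otimes> inv (g j)))" if "i \<in> I" "j \<in> I" for i j
    using gc that by (simp only: char_mult[OF \<xi>] char_inv[OF \<xi>] inv_closed)
  have le1: "Re (\<xi> v) \<le> 1" for v using complex_Re_le_cmod[of "\<xi> v"] char_norm_le[OF \<xi>, of v] by linarith
  have "complex_of_real (norm (\<Sum>i\<in>I. \<xi> (g i)) ^ 2) = (\<Sum>i\<in>I. \<Sum>j\<in>I. \<xi> (g i) * cnj (\<xi> (g j)))"
    by (simp only: complex_norm_square cnj_sum sum_product)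
  then have "norm (\<Sum>i\<in>I. \<xi> (g i)) ^ 2 = Re (\<Sum>i\<in>I. \<Sum>j\<in>I. \<xi> (g i) * cnj (\<xi> (g j)))"
    by (metis Re_complex_of_real)
  also have "\<dots> = (\<Sum>i\<in>I. \<Sum>j\<in>I. Re (\<xi> (g i \<otimes> inv (g j))))"
    unfolding Re_sum by (intro sum.cong refl re)
  finally have "real (card I) ^ 2 - norm (\<Sum>i\<in>I. \<xi> (g i)) ^ 2 = (\<Sum>i\<in>I. \<Sum>j\<in>I. 1 - Re (\<xi> (g i \<otimes> inv (g j))))"
    by (simp add: sum_subtractf power2_eq_square)
  also have "\<dots> \<ge> (\<Sum>i\<in>?A. \<Sum>j\<in>?B. \<kappa>)"
  proof -
    have "(\<Sum>i\<in>?A. \<Sum>j\<in>?B. \<kappa>) \<le> (\<Sum>i\<in>?A. \<Sum>j\<in>?B. 1 - Re (\<xi> (g i \<otimes> inv (g j))))"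
    proof (intro sum_mono \<kappa>(2))
      fix i j assume ij: "i \<in> ?A" "j \<in> ?B"
      then have c: "g i \<in> carrier G" "g j \<in> carrier G" using gc by auto
      then show "g i \<otimes> inv (g j) \<in> carrier G" by simp
      show "\<xi> (g i \<otimes> inv (g j)) \<noteq> 1"
      proof
        assume e: "\<xi> (g i \<otimes> inv (g j)) = 1"
        have "\<xi> (g i) = \<xi> ((g i \<otimes> inv (g j)) \<otimes> g j)" using c by (simp add: m_assoc)
        also have "\<dots> = \<xi> (g j)" using c e by (simp only: char_mult[OF \<xi>] m_closed inv_closed mult_1)
        finally show False using ij by simp
      qed
    qed
    also have "\<dots> \<le> (\<Sum>i\<in>?A. \<Sum>j\<in>I. 1 - Re (\<xi> (g i \<otimes> inv (g j))))"
      by (intro sum_mono sum_mono2 I) (use le1 in auto)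
    also have "\<dots> \<le> (\<Sum>i\<in>I. \<Sum>j\<in>I. 1 - Re (\<xi> (g i \<otimes> inv (g j))))"
      by (intro sum_mono2 I sum_nonneg) (use le1 in auto)
    finally show ?thesis .
  qed
  finally show ?thesis by (simp add: mult_ac)
qed

text \<open>
  A mean \<open>a\<close> with \<open>a - a ^ 2 < \<delta>\<close> is less than \<open>2 *
  \<delta>\<close> away from 0 or from 1. If only the trivial character has a mean near 1, the
  word is flat. Otherwise each character with mean near 1 is constant at most positions. With
  \<open>v0\<close> the most frequent letter, nearly all letters lie in the coset \<open>v0
  W\<close> of the common kernel \<open>W\<close> of these characters. A nontrivial character of
  \<open>W\<close> extends to one that is not among them, so the word is flat inside the coset.
\<close>

lemma flat_or_near_coset:
  obtains C where "C > 0"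
    and "\<And>(I :: nat set) g (\<delta> :: real). finite I \<Longrightarrow> I \<noteq> {} \<Longrightarrow> g \<in> PiE I (\<lambda>_. carrier G) \<Longrightarrow>
      (\<And>\<xi>. \<xi> \<in> chars G \<Longrightarrow> norm (\<Sum>i\<in>I. \<xi> (g i)) / card I - (norm (\<Sum>i\<in>I. \<xi> (g i)) / card I) ^ 2 < \<delta>) \<Longrightarrow>
      (\<forall>\<xi>\<in>chars G. \<xi> \<noteq> triv_char G \<longrightarrow> norm (\<Sum>i\<in>I. \<xi> (g i)) \<le> 2 * \<delta> * card I) \<or>
      (\<exists>v0\<in>carrier G. \<exists>W. subgroup W G \<and> W \<noteq> carrier G \<and> card {i \<in> I. g i \<otimes> inv v0 \<notin> W} \<le> C * \<delta> * card I \<and>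
        (\<forall>\<psi>\<in>chars (G\<lparr>carrier := W\<rparr>). \<psi> \<noteq> triv_char (G\<lparr>carrier := W\<rparr>) \<longrightarrow>
          norm (\<Sum>i\<in>{i \<in> I. g i \<otimes> inv v0 \<in> W}. \<psi> (g i \<otimes> inv v0)) \<le> (C + 2) * \<delta> * card I))"
proof -
  obtain \<kappa> where \<kappa>: "\<kappa> > 0" "\<And>\<xi> v. \<xi> \<in> chars G \<Longrightarrow> v \<in> carrier G \<Longrightarrow> \<xi> v \<noteq> 1 \<Longrightarrow> \<kappa> \<le> 1 - Re (\<xi> v)"
    using char_gap by blast
  define k where "k = real (order G)"
  have k: "k > 0" using order_pos by (simp add: k_def)
  define C where "C = 4 * k ^ 2 / \<kappa>"
  have C: "C > 0" using k \<kappa> by (simp add: C_def)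
  have "(\<forall>\<xi>\<in>chars G. \<xi> \<noteq> triv_char G \<longrightarrow> norm (\<Sum>i\<in>I. \<xi> (g i)) \<le> 2 * \<delta> * card I) \<or>
    (\<exists>v0\<in>carrier G. \<exists>W. subgroup W G \<and> W \<noteq> carrier G \<and> card {i \<in> I. g i \<otimes> inv v0 \<notin> W} \<le> C * \<delta> * card I \<and>
      (\<forall>\<psi>\<in>chars (G\<lparr>carrier := W\<rparr>). \<psi> \<noteq> triv_char (G\<lparr>carrier := W\<rparr>) \<longrightarrow>
        norm (\<Sum>i\<in>{i \<in> I. g i \<otimes> inv v0 \<in> W}. \<psi> (g i \<otimes> inv v0)) \<le> (C + 2) * \<delta> * card I))"
    if I: "finite I" "I \<noteq> {}" and g: "g \<in> PiE I (\<lambda>_. carrier G)"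
      and dich: "\<And>\<xi>. \<xi> \<in> chars G \<Longrightarrow> norm (\<Sum>i\<in>I. \<xi> (g i)) / card I - (norm (\<Sum>i\<in>I. \<xi> (g i)) / card I) ^ 2 < \<delta>"
    for I :: "nat set" and g and \<delta> :: real
  proof -
    let ?n = "real (card I)"
    define a where "a \<xi> = norm (\<Sum>i\<in>I. \<xi> (g i)) / ?n" for \<xi> :: "'a \<Rightarrow> complex"
    have n: "?n > 0" using I by (simp add: card_gt_0_iff)
    have Za: "norm (\<Sum>i\<in>I. \<xi> (g i)) = a \<xi> * ?n" for \<xi> :: "'a \<Rightarrow> complex" using n by (simp add: a_def)
    have gc: "g i \<in> carrier G" if "i \<in> I" for i using g that by auto
    have a01: "0 \<le> a \<xi>" "a \<xi> \<le> 1" if "\<xi> \<in> chars G" for \<xi>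
    proof -
      have "norm (\<Sum>i\<in>I. \<xi> (g i)) \<le> (\<Sum>i\<in>I. 1)" by (rule sum_norm_le) (use char_norm_le[OF that] in auto)
      then show "a \<xi> \<le> 1" using n by (simp add: a_def)
    qed (simp add: a_def)
    have small: "a \<xi> \<le> 2 * \<delta>" if "\<xi> \<in> chars G" "a \<xi> < 1 / 2" for \<xi>
    proof -
      have "a \<xi> * (1 / 2) \<le> a \<xi> * (1 - a \<xi>)" using that a01[OF that(1)] by (intro mult_left_mono) auto
      moreover have "a \<xi> * (1 - a \<xi>) < \<delta>"
        using dich[OF that(1)] unfolding a_def[symmetric] by (simp add: power2_eq_square right_diff_distrib)
      ultimately show ?thesis by linarith
    qed
    have big: "1 - a \<xi> \<le> 2 * \<delta>" if "\<xi> \<in> chars G" "a \<xi> \<ge> 1 / 2" for \<xi>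
    proof -
      have "(1 / 2) * (1 - a \<xi>) \<le> a \<xi> * (1 - a \<xi>)" using that a01[OF that(1)] by (intro mult_right_mono) auto
      moreover have "a \<xi> * (1 - a \<xi>) < \<delta>"
        using dich[OF that(1)] unfolding a_def[symmetric] by (simp add: power2_eq_square right_diff_distrib)
      ultimately have "(1 / 2) * (1 - a \<xi>) < \<delta>" by (rule le_less_trans)
      then show ?thesis by simp
    qed
    define L where "L = {\<xi> \<in> chars G. a \<xi> \<ge> 1 / 2}"
    show ?thesis
    proof (cases "L \<subseteq> {triv_char G}")
      case True
      have "norm (\<Sum>i\<in>I. \<xi> (g i)) \<le> 2 * \<delta> * ?n" if "\<xi> \<in> chars G" "\<xi> \<noteq> triv_char G" for \<xi>
      proof -
        have "a \<xi> < 1 / 2" using True that by (auto simp: L_def)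
        then show ?thesis unfolding Za using small[OF that(1)] n by (intro mult_right_mono) auto
      qed
      then show ?thesis by blast
    next
      case False
      then obtain \<xi>1 where \<xi>1: "\<xi>1 \<in> L" "\<xi>1 \<noteq> triv_char G" by blast
      let ?c = "\<lambda>v. card {i \<in> I. g i = v}"
      have "\<exists>v0\<in>carrier G. ?n \<le> k * ?c v0"
      proof (rule ccontr)
        assume h: "\<not> (\<exists>v0\<in>carrier G. ?n \<le> k * ?c v0)"
        have "(\<Sum>v\<in>carrier G. ?c v) = card (\<Union>v\<in>carrier G. {i \<in> I. g i = v})"
          by (rule card_UN_disjoint[symmetric]) (use I finite_carrier in auto)
        also have "(\<Union>v\<in>carrier G. {i \<in> I. g i = v}) = I" using gc by auto
        finally have s: "(\<Sum>v\<in>carrier G. real (?c v)) = ?n" by (simp flip: of_nat_sum)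
        have "k * ?n = (\<Sum>v\<in>carrier G. k * ?c v)" unfolding s[symmetric] by (rule sum_distrib_left)
        also have "\<dots> < (\<Sum>v\<in>carrier G. ?n)"
          by (rule sum_strict_mono) (use h finite_carrier one_closed in \<open>auto simp: not_le\<close>)
        also have "\<dots> = k * ?n" by (simp add: k_def order_def)
        finally show False by simp
      qed
      then obtain v0 where v0: "v0 \<in> carrier G" "?n \<le> k * ?c v0" by blast
      define W where "W = {x \<in> carrier G. \<forall>\<xi>\<in>L. \<xi> x = 1}"
      have Lc: "\<xi> \<in> chars G" if "\<xi> \<in> L" for \<xi> using that by (simp add: L_def)
      have W1: "x \<in> W \<Longrightarrow> \<xi> \<in> L \<Longrightarrow> \<xi> x = 1" "x \<in> W \<Longrightarrow> x \<in> carrier G" for x \<xi>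
        by (auto simp: W_def)
      have W: "subgroup W G"
      proof (rule subgroupI)
        have "\<one> \<in> W" using char_one[OF Lc] by (simp add: W_def)
        then show "W \<noteq> {}" by blast
        show "inv x \<in> W" if x: "x \<in> W" for x
        proof -
          have "\<xi> (inv x) = 1" if "\<xi> \<in> L" for \<xi>
            using char_inv[OF Lc[OF that] W1(2)[OF x]] W1(1)[OF x that] by simp
          then show ?thesis using x by (simp add: W_def)
        qed
        show "x \<otimes> y \<in> W" if x: "x \<in> W" "y \<in> W" for x y
        proof -
          have "\<xi> (x \<otimes> y) = 1" if "\<xi> \<in> L" for \<xi>
            using char_mult[OF Lc[OF that] W1(2)[OF x(1)] W1(2)[OF x(2)]] W1(1)[OF x(1) that] W1(1)[OF x(2) that] by simp
          then show ?thesis using x by (simp add: W_def)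
        qed
      qed (auto simp: W_def)
      have Wp: "W \<noteq> carrier G"
      proof
        assume e: "W = carrier G"
        have "\<xi>1 = triv_char G"
          by (rule char_eqI[OF Lc[OF \<xi>1(1)] triv_char_in]) (use e \<xi>1 in \<open>auto simp: W_def triv_char_def\<close>)
        then show False using \<xi>1 by simp
      qed
      let ?g = "\<lambda>i. g i \<otimes> inv v0"
      have gtc: "?g i \<in> carrier G" if "i \<in> I" for i using gc[OF that] v0 by simp
      have xg: "\<xi> (?g i) = \<xi> (g i) * cnj (\<xi> v0)" if "\<xi> \<in> chars G" "i \<in> I" for \<xi> i
        using gc[OF that(2)] v0 by (simp only: char_mult[OF that(1)] char_inv[OF that(1)] inv_closed)
      have per: "real (card {i \<in> I. \<xi> (g i) \<noteq> \<xi> v0}) \<le> 4 * \<delta> * k * ?n / \<kappa>" if \<xi>: "\<xi> \<in> L" for \<xi>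
      proof -
        let ?b = "real (card {i \<in> I. \<xi> (g i) \<noteq> \<xi> v0})"
        have "\<kappa> * ?c v0 * ?b \<le> ?n ^ 2 - (a \<xi> * ?n) ^ 2"
          using char_concentration[OF I(1) g Lc[OF \<xi>] v0(1) \<kappa>(1) \<kappa>(2)[OF Lc[OF \<xi>]]] unfolding Za by blast
        also have "\<dots> = ((1 - a \<xi>) * (1 + a \<xi>)) * ?n ^ 2" by (simp add: power2_eq_square algebra_simps)
        also have "\<dots> \<le> ((2 * \<delta>) * 2) * ?n ^ 2"
        proof (rule mult_right_mono)
          have "1 / 2 \<le> a \<xi>" using \<xi> by (simp add: L_def)
          then show "(1 - a \<xi>) * (1 + a \<xi>) \<le> (2 * \<delta>) * 2"
            using big[OF Lc[OF \<xi>]] a01[OF Lc[OF \<xi>]] by (intro mult_mono) auto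
        qed simp
        finally have "\<kappa> * ?c v0 * ?b \<le> 4 * \<delta> * ?n ^ 2" by simp
        then have "k * (\<kappa> * ?c v0 * ?b) \<le> k * (4 * \<delta> * ?n ^ 2)" using k by (intro mult_left_mono) auto
        moreover have "?n * (\<kappa> * ?b) \<le> (k * ?c v0) * (\<kappa> * ?b)" using v0(2) \<kappa>(1) by (intro mult_right_mono) auto
        ultimately have "?n * (\<kappa> * ?b) \<le> ?n * (4 * \<delta> * k * ?n)" by (simp add: power2_eq_square mult_ac)
        then have "\<kappa> * ?b \<le> 4 * \<delta> * k * ?n" using n by (simp only: mult_le_cancel_left)
        then show ?thesis using \<kappa>(1) by (simp add: pos_le_divide_eq mult.commute)
      qed
      have fL: "finite L" using finite_chars by (simp add: L_def)
      have "{i \<in> I. ?g i \<notin> W} \<subseteq> (\<Union>\<xi>\<in>L. {i \<in> I. \<xi> (g i) \<noteq> \<xi> v0})"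
      proof
        fix i assume "i \<in> {i \<in> I. ?g i \<notin> W}"
        then obtain \<xi> where i: "i \<in> I" "\<xi> \<in> L" "\<xi> (?g i) \<noteq> 1" using gtc by (auto simp: W_def)
        then have "\<xi> (g i) \<noteq> \<xi> v0" using xg[OF Lc[OF i(2)] i(1)] char_cnj_self[OF Lc[OF i(2)] v0(1)] by auto
        then show "i \<in> (\<Union>\<xi>\<in>L. {i \<in> I. \<xi> (g i) \<noteq> \<xi> v0})" using i by blast
      qed
      then have "card {i \<in> I. ?g i \<notin> W} \<le> card (\<Union>\<xi>\<in>L. {i \<in> I. \<xi> (g i) \<noteq> \<xi> v0})"
        by (rule card_mono[rotated]) (use fL I in auto)
      also have "\<dots> \<le> (\<Sum>\<xi>\<in>L. card {i \<in> I. \<xi> (g i) \<noteq> \<xi> v0})" by (rule card_UN_le[OF fL])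
      finally have "real (card {i \<in> I. ?g i \<notin> W}) \<le> real (\<Sum>\<xi>\<in>L. card {i \<in> I. \<xi> (g i) \<noteq> \<xi> v0})"
        by (rule of_nat_mono)
      also have "\<dots> = (\<Sum>\<xi>\<in>L. real (card {i \<in> I. \<xi> (g i) \<noteq> \<xi> v0}))" by (rule of_nat_sum)
      also have "\<dots> \<le> (\<Sum>\<xi>\<in>L. 4 * \<delta> * k * ?n / \<kappa>)" by (rule sum_mono[OF per])
      also have "\<dots> = card L * (4 * \<delta> * k * ?n / \<kappa>)" by simp
      also have "\<dots> \<le> k * (4 * \<delta> * k * ?n / \<kappa>)"
      proof (rule mult_right_mono)
        have "card L \<le> card (chars G)" by (rule card_mono[OF finite_chars]) (auto simp: L_def)
        then show "real (card L) \<le> k" by (simp add: k_def order_def card_chars)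
        have "\<delta> \<ge> 0" using big[OF Lc[OF \<xi>1(1)]] a01[OF Lc[OF \<xi>1(1)]] \<xi>1(1) by (simp add: L_def)
        then show "0 \<le> 4 * \<delta> * k * ?n / \<kappa>" using k n \<kappa> by simp
      qed
      also have "\<dots> = C * \<delta> * ?n" by (simp add: C_def power2_eq_square)
      finally have off: "real (card {i \<in> I. ?g i \<notin> W}) \<le> C * \<delta> * ?n" .
      have "norm (\<Sum>i\<in>{i \<in> I. ?g i \<in> W}. \<psi> (?g i)) \<le> (C + 2) * \<delta> * ?n"
        if \<psi>: "\<psi> \<in> chars (G\<lparr>carrier := W\<rparr>)" "\<psi> \<noteq> triv_char (G\<lparr>carrier := W\<rparr>)" for \<psi>
      proof -
        obtain \<xi> where \<xi>: "\<xi> \<in> chars G" "\<And>x. x \<in> W \<Longrightarrow> \<xi> x = \<psi> x" using char_extend[OF W \<psi>(1)] by blast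
        have "\<xi> \<notin> L"
        proof
          assume l: "\<xi> \<in> L"
          interpret Ws: finite_comm_group "G\<lparr>carrier := W\<rparr>" by (rule sub_finite_comm_group[OF W])
          have "\<psi> = triv_char (G\<lparr>carrier := W\<rparr>)"
          proof (rule char_eqI[OF \<psi>(1) Ws.triv_char_in])
            fix x assume "x \<in> carrier (G\<lparr>carrier := W\<rparr>)"
            then have "x \<in> W" by simp
            then show "\<psi> x = triv_char (G\<lparr>carrier := W\<rparr>) x" using \<xi>(2)[of x] l by (auto simp: W_def triv_char_def)
          qed
          then show False using \<psi>(2) by simp
        qed
        then have s: "a \<xi> \<le> 2 * \<delta>" using small[OF \<xi>(1)] \<xi>(1) by (simp add: L_def not_le)
        have "(\<Sum>i\<in>{i \<in> I. ?g i \<in> W}. \<psi> (?g i)) = (\<Sum>i\<in>{i \<in> I. ?g i \<in> W}. \<xi> (?g i))"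
          using \<xi>(2) by (intro sum.cong refl) auto
        also have "\<dots> = (\<Sum>i\<in>I. \<xi> (?g i)) - (\<Sum>i\<in>{i \<in> I. ?g i \<notin> W}. \<xi> (?g i))"
        proof -
          have "I = {i \<in> I. ?g i \<in> W} \<union> {i \<in> I. ?g i \<notin> W}" by auto
          then have "(\<Sum>i\<in>I. \<xi> (?g i)) = (\<Sum>i\<in>{i \<in> I. ?g i \<in> W} \<union> {i \<in> I. ?g i \<notin> W}. \<xi> (?g i))" by (rule arg_cong)
          also have "\<dots> = (\<Sum>i\<in>{i \<in> I. ?g i \<in> W}. \<xi> (?g i)) + (\<Sum>i\<in>{i \<in> I. ?g i \<notin> W}. \<xi> (?g i))"
            by (rule sum.union_disjoint) (use I in auto)
          finally show ?thesis by simp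
        qed
        also have "norm \<dots> \<le> norm (\<Sum>i\<in>I. \<xi> (?g i)) + norm (\<Sum>i\<in>{i \<in> I. ?g i \<notin> W}. \<xi> (?g i))"
          by (rule norm_triangle_ineq4)
        also have "norm (\<Sum>i\<in>I. \<xi> (?g i)) = a \<xi> * ?n"
        proof -
          have "(\<Sum>i\<in>I. \<xi> (?g i)) = (\<Sum>i\<in>I. \<xi> (g i)) * cnj (\<xi> v0)"
            unfolding sum_distrib_right by (intro sum.cong refl xg[OF \<xi>(1)])
          then show ?thesis using char_norm[OF \<xi>(1) v0(1)] by (simp add: norm_mult Za)
        qed
        also have "norm (\<Sum>i\<in>{i \<in> I. ?g i \<notin> W}. \<xi> (?g i)) \<le> (\<Sum>i\<in>{i \<in> I. ?g i \<notin> W}. 1)"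
          by (rule sum_norm_le) (use char_norm_le[OF \<xi>(1)] in auto)
        finally have "norm (\<Sum>i\<in>{i \<in> I. ?g i \<in> W}. \<psi> (?g i)) \<le> a \<xi> * ?n + card {i \<in> I. ?g i \<notin> W}" by simp
        also have "\<dots> \<le> 2 * \<delta> * ?n + C * \<delta> * ?n"
          using off mult_right_mono[OF s, of ?n] by simp
        finally show ?thesis by (simp add: algebra_simps)
      qed
      then show ?thesis using v0(1) W Wp off by blast
    qed
  qed
  note main = this
  show thesis by (rule that[OF C main])
qed

lemma translate_hits_le:
  assumes I: "finite I" and g: "g \<in> PiE I (\<lambda>_. carrier G)" and v: "v \<in> carrier G"
  shows "card (hits d I g) \<le> card (hits d I (\<lambda>i\<in>I. g i \<otimes> v))"
    "card (words I (image_mset g (mset_set I))) \<le> card (words I (image_mset (\<lambda>i\<in>I. g i \<otimes> v) (mset_set I)))"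
proof -
  let ?M = "image_mset g (mset_set I)" and ?t = "\<lambda>w. (\<lambda>i\<in>I. w i \<otimes> v)"
  let ?M' = "image_mset (?t g) (mset_set I)"
  have Mc: "set_mset ?M \<subseteq> carrier G" using g I by auto
  have tw: "image_mset (?t w) (mset_set I) = image_mset (\<lambda>x. x \<otimes> v) (image_mset w (mset_set I))" for w :: "'c \<Rightarrow> 'a"
    unfolding multiset.map_comp o_def by (rule image_mset_cong) (use I in auto)
  have into: "?t w \<in> words I ?M'" if "w \<in> words I ?M" for w
  proof -
    have "image_mset w (mset_set I) = ?M" using that by (simp only: words_def mem_Collect_eq)
    then show ?thesis unfolding words_def mem_Collect_eq tw by (simp only: restrict_extensional)
  qed
  have inj: "inj_on ?t (words I ?M)"
  proof (rule inj_onI)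
    fix w w' assume h: "w \<in> words I ?M" "w' \<in> words I ?M" "?t w = ?t w'"
    show "w = w'"
    proof (rule extensionalityI[where A = I])
      fix i assume i: "i \<in> I"
      then have "w i \<otimes> v = w' i \<otimes> v" using fun_cong[OF h(3), of i] by simp
      then show "w i = w' i" using words_carrier[OF I Mc h(1) i] words_carrier[OF I Mc h(2) i] v by simp
    qed (use h in \<open>simp_all add: words_def\<close>)
  qed
  show "card (words I ?M) \<le> card (words I ?M')"
    by (rule card_inj_on_le[OF inj]) (use into finite_words[OF I] in auto)
  let ?s = "\<lambda>ws. (\<lambda>k\<in>{..<d}. ?t (ws k))"
  show "card (hits d I g) \<le> card (hits d I (?t g))"
  proof (rule card_inj_on_le)
    show "inj_on ?s (hits d I g)"
    proof (rule inj_onI)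
      fix ws ws' assume h: "ws \<in> hits d I g" "ws' \<in> hits d I g" "?s ws = ?s ws'"
      show "ws = ws'"
      proof (rule extensionalityI[where A = "{..<d}"])
        fix k assume k: "k \<in> {..<d}"
        then have "?t (ws k) = ?t (ws' k)" using fun_cong[OF h(3), of k] by (simp only: restrict_apply if_True)
        moreover have "ws k \<in> words I ?M" "ws' k \<in> words I ?M" using h k by (auto simp: hits_def)
        ultimately show "ws k = ws' k" by (rule inj_onD[OF inj])
      qed (use h in \<open>auto simp: hits_def PiE_def\<close>)
    qed
    show "?s ` hits d I g \<subseteq> hits d I (?t g)"
    proof (intro image_subsetI)
      fix ws assume ws: "ws \<in> hits d I g"
      then have wk: "ws k \<in> words I ?M" if "k \<in> {..<d}" for k using that by (auto simp: hits_def)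
      have "finprod G (\<lambda>k. ?s ws k i) {..<d} = ?t g i [^] d" if i: "i \<in> I" for i
      proof -
        have c: "(\<lambda>k. ws k i) \<in> {..<d} \<rightarrow> carrier G" using words_carrier[OF I Mc wk i] by auto
        have "finprod G (\<lambda>k. ?s ws k i) {..<d} = finprod G (\<lambda>k. ws k i \<otimes> v) {..<d}"
          by (rule finprod_cong') (use c v i in \<open>auto simp: Pi_def\<close>)
        also have "\<dots> = finprod G (\<lambda>k. ws k i) {..<d} \<otimes> finprod G (\<lambda>k. v) {..<d}"
          by (rule finprod_multf) (use c v in auto)
        also have "finprod G (\<lambda>k. ws k i) {..<d} = g i [^] d" using ws i by (simp add: hits_def)
        also have "finprod G (\<lambda>k. v) {..<d} = v [^] d" using finprod_const[OF v, of "{..<d}"] by simp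
        also have "g i [^] d \<otimes> v [^] d = (g i \<otimes> v) [^] d"
          using g i v by (intro pow_mult_distrib[symmetric] m_comm) auto
        also have "g i \<otimes> v = ?t g i" using i by simp
        finally show ?thesis .
      qed
      moreover have "?s ws \<in> PiE {..<d} (\<lambda>_. words I ?M')" using into[OF wk] by auto
      ultimately show "?s ws \<in> hits d I (?t g)" unfolding hits_def by blast
    qed
    show "finite (hits d I (?t g))"
      unfolding hits_def by (rule finite_subset[OF Collect_restrict]) (use finite_words[OF I] in \<open>auto intro!: finite_PiE\<close>)
  qed
qed

text \<open>
  Both sides of the equation \<open>A g = d g\<close> change by \<open>d v\<close> if
  \<open>v\<close> is added to every value, as \<open>A\<close> has row sums \<open>d\<close>.
\<close>

lemma hit_prob_translate:
  assumes I: "finite I" and g: "g \<in> PiE I (\<lambda>_. carrier G)" and v: "v \<in> carrier G"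
  shows "hit_prob d I (\<lambda>i\<in>I. g i \<otimes> v) = hit_prob d I g"
proof -
  let ?g = "\<lambda>i\<in>I. g i \<otimes> v"
  have g': "?g \<in> PiE I (\<lambda>_. carrier G)" using g v by auto
  have undo: "(\<lambda>i\<in>I. ?g i \<otimes> inv v) = g"
    by (rule extensionalityI[where A = I]) (use g v in \<open>auto simp: m_assoc PiE_def Pi_def\<close>)
  have "card (hits d I ?g) = card (hits d I g)"
    using translate_hits_le(1)[OF I g v, of d] translate_hits_le(1)[OF I g' inv_closed[OF v], of d] unfolding undo by simp
  moreover have "card (words I (image_mset ?g (mset_set I))) = card (words I (image_mset g (mset_set I)))"
    using translate_hits_le(2)[OF I g v] translate_hits_le(2)[OF I g' inv_closed[OF v]] unfolding undo by simp
  ultimately show ?thesis unfolding hit_prob_def by simp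
qed

text \<open>
  Fourier inversion with base point \<open>g\<close>: each of the \<open>order G\<close> constant
  families contributes exactly 1, because all rearrangements of \<open>g\<close> have the same
  product, and the others are small.
\<close>

lemma hit_prob_flat:
  fixes I :: "'i set"
  assumes I: "finite I" "I \<noteq> {}" and g: "g \<in> PiE I (\<lambda>_. carrier G)" and d: "d \<ge> 3"
    and small: "(\<Sum>\<psi>\<in>{\<psi> \<in> PiE I (\<lambda>_. chars G). \<forall>\<xi>\<in>chars G. \<exists>i\<in>I. \<psi> i \<noteq> \<xi>}. norm (ft I (image_mset g (mset_set I)) \<psi>) ^ 3) \<le> e"
  shows "\<bar>hit_prob d I g * real (order G) ^ card I - order G\<bar> \<le> e"
proof -
  let ?M = "image_mset g (mset_set I)" and ?P = "PiE I (\<lambda>_. chars G)"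
  let ?T = "words I ?M"
  let ?N = "{\<psi> \<in> ?P. \<forall>\<xi>\<in>chars G. \<exists>i\<in>I. \<psi> i \<noteq> \<xi>}"
  let ?c = "\<lambda>\<xi>. restrict (\<lambda>_. \<xi>) I"
  have M: "size ?M = card I" "set_mset ?M \<subseteq> carrier G" using g I by auto
  have gc: "g i \<in> carrier G" if "i \<in> I" for i using g that by auto
  have N: "card ?T > 0" by (rule card_words_pos[OF I(1) M(1)])
  have gT: "g \<in> ?T" by (rule self_in_words) (use g in \<open>simp add: PiE_iff\<close>)
  have fT: "finite ?T" by (rule finite_words[OF I(1)])
  have fP: "finite ?P" using I finite_chars by (auto intro!: finite_PiE)
  define S where "S \<psi> = (\<Sum>w\<in>?T. \<Prod>i\<in>I. \<psi> i (w i \<otimes> inv (g i)))" for \<psi> :: "'i \<Rightarrow> 'a \<Rightarrow> complex"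
  have chG: "chars (G\<lparr>carrier := carrier G\<rparr>) = chars G" by simp
  have hd: "hits d I g = {ws \<in> PiE {..<d} (\<lambda>_. ?T). \<forall>i\<in>I. finprod G (\<lambda>k. ws k i) {..<d} = g i [^] d}"
    by (simp add: hits_def)
  have "of_nat (card (hits d I g)) * of_nat (card (carrier G)) ^ card I
    = (\<Sum>\<psi>\<in>PiE I (\<lambda>_. chars (G\<lparr>carrier := carrier G\<rparr>)). \<Prod>k<d. \<Sum>w\<in>?T. \<Prod>i\<in>I. \<psi> i (w i \<otimes> inv (g i)))"
    unfolding hd
  proof (rule fiber_fourier[OF subgroup_self I(1)])
    show "finprod G (\<lambda>k. g i) {..<d} = g i [^] d" if "i \<in> I" for i
      using finprod_const[OF gc[OF that], of "{..<d}"] by simp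
  qed (use fT gc words_carrier[OF I(1) M(2)] in auto)
  then have four: "of_nat (card (hits d I g)) * of_nat (order G) ^ card I = (\<Sum>\<psi>\<in>?P. S \<psi> ^ d)"
    unfolding chG by (simp add: S_def order_def)
  have Sdec: "S \<psi> = (\<Prod>i\<in>I. \<psi> i (inv (g i))) * (\<Sum>w\<in>?T. \<Prod>i\<in>I. \<psi> i (w i))" if \<psi>: "\<psi> \<in> ?P" for \<psi>
  proof -
    have ch: "\<psi> i \<in> chars G" if "i \<in> I" for i using \<psi> that by auto
    have "(\<Prod>i\<in>I. \<psi> i (w i \<otimes> inv (g i))) = (\<Prod>i\<in>I. \<psi> i (inv (g i)) * \<psi> i (w i))" if w: "w \<in> ?T" for w
    proof (intro prod.cong refl)
      fix i assume i: "i \<in> I"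
      show "\<psi> i (w i \<otimes> inv (g i)) = \<psi> i (inv (g i)) * \<psi> i (w i)"
        using char_mult[OF ch[OF i] words_carrier[OF I(1) M(2) w i] inv_closed[OF gc[OF i]]] by (simp only: mult.commute)
    qed
    then show ?thesis unfolding S_def by (simp only: prod.distrib sum_distrib_left cong: sum.cong)
  qed
  have Snorm: "norm (S \<psi>) = card ?T * norm (ft I ?M \<psi>)" if \<psi>: "\<psi> \<in> ?P" for \<psi>
  proof -
    have "norm (\<Prod>i\<in>I. \<psi> i (inv (g i))) = 1"
      unfolding prod_norm[symmetric]
      by (rule prod.neutral) (use \<psi> gc in \<open>auto intro!: char_norm\<close>)
    then show ?thesis unfolding Sdec[OF \<psi>] norm_mult ft_def norm_divide using N by simp
  qed
  have Sconst: "S (?c \<xi>) = of_nat (card ?T)" if \<xi>: "\<xi> \<in> chars G" for \<xi>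
  proof -
    have "(\<Prod>i\<in>I. ?c \<xi> i (w i \<otimes> inv (g i))) = 1" if w: "w \<in> ?T" for w
    proof -
      have "(\<Prod>i\<in>I. ?c \<xi> i (w i \<otimes> inv (g i))) = (\<Prod>i\<in>I. \<xi> (w i) * cnj (\<xi> (g i)))"
      proof (intro prod.cong refl)
        fix i assume i: "i \<in> I"
        show "?c \<xi> i (w i \<otimes> inv (g i)) = \<xi> (w i) * cnj (\<xi> (g i))"
          using i char_mult[OF \<xi> words_carrier[OF I(1) M(2) w i] inv_closed[OF gc[OF i]]] char_inv[OF \<xi> gc[OF i]] by simp
      qed
      also have "\<dots> = (\<Prod>v\<in>#?M. \<xi> v) * cnj (\<Prod>v\<in>#?M. \<xi> v)"
        unfolding prod.distrib cnj_prod[symmetric] words_prod_mset[OF w] words_prod_mset[OF gT] ..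
      also have "\<dots> = 1" using prod_mset_char_norm[OF M(2) \<xi>] by (simp only: complex_norm_square[symmetric]) simp
      finally show ?thesis .
    qed
    then show ?thesis by (simp add: S_def)
  qed
  have PN: "?P - ?N = ?c ` chars G"
  proof (intro equalityI subsetI)
    fix \<psi> assume \<psi>: "\<psi> \<in> ?P - ?N"
    then obtain \<xi> where "\<xi> \<in> chars G" "\<forall>i\<in>I. \<psi> i = \<xi>" by auto
    then have "\<psi> = ?c \<xi>" using \<psi> by (auto simp: fun_eq_iff PiE_def extensional_def)
    then show "\<psi> \<in> ?c ` chars G" using \<open>\<xi> \<in> chars G\<close> by blast
  qed auto
  have inj: "inj_on ?c (chars G)"
  proof (rule inj_onI)
    fix \<xi> \<xi>' assume e: "?c \<xi> = ?c \<xi>'"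
    obtain i where i: "i \<in> I" using I by blast
    have "?c \<xi> i = ?c \<xi>' i" using e by (rule fun_cong)
    then show "\<xi> = \<xi>'" using i by (simp only: restrict_apply if_True)
  qed
  have "(\<Sum>\<psi>\<in>?P. S \<psi> ^ d) = (\<Sum>\<psi>\<in>?P - ?N. S \<psi> ^ d) + (\<Sum>\<psi>\<in>?N. S \<psi> ^ d)"
    by (rule sum.subset_diff) (use fP in auto)
  also have "(\<Sum>\<psi>\<in>?P - ?N. S \<psi> ^ d) = of_nat (order G) * of_nat (card ?T) ^ d"
    unfolding PN sum.reindex[OF inj] o_def by (simp add: Sconst card_chars order_def)
  finally have eq: "of_nat (card (hits d I g)) * of_nat (order G) ^ card I - of_nat (order G) * of_nat (card ?T) ^ d = (\<Sum>\<psi>\<in>?N. S \<psi> ^ d)"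
    using four by simp
  have "\<bar>real (card (hits d I g)) * real (order G) ^ card I - real (order G) * real (card ?T) ^ d\<bar>
    = norm (complex_of_real (real (card (hits d I g)) * real (order G) ^ card I - real (order G) * real (card ?T) ^ d))"
    by (simp only: norm_of_real)
  also have "\<dots> = norm (\<Sum>\<psi>\<in>?N. S \<psi> ^ d)" unfolding eq[symmetric] by simp
  also have "\<dots> \<le> (\<Sum>\<psi>\<in>?N. real (card ?T) ^ d * norm (ft I ?M \<psi>) ^ 3)"
  proof (rule sum_norm_le)
    fix \<psi> assume \<psi>: "\<psi> \<in> ?N"
    then have "norm (ft I ?M \<psi>) \<le> 1" by (intro ft_norm_le_1[OF I(1) M]) auto
    then have "norm (ft I ?M \<psi>) ^ d \<le> norm (ft I ?M \<psi>) ^ 3" using d by (intro power_decreasing) auto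
    then show "norm (S \<psi> ^ d) \<le> real (card ?T) ^ d * norm (ft I ?M \<psi>) ^ 3"
      using \<psi> by (simp add: norm_power Snorm power_mult_distrib mult_left_mono)
  qed
  also have "\<dots> \<le> real (card ?T) ^ d * e"
    unfolding sum_distrib_left[symmetric] using small by (rule mult_left_mono) simp
  finally have "\<bar>real (card (hits d I g)) * real (order G) ^ card I - real (order G) * real (card ?T) ^ d\<bar> \<le> real (card ?T) ^ d * e" .
  moreover have "real (card (hits d I g)) = hit_prob d I g * real (card ?T) ^ d" using N by (simp add: hit_prob_def)
  ultimately have "\<bar>(hit_prob d I g * real (order G) ^ card I - order G) * real (card ?T) ^ d\<bar> \<le> e * real (card ?T) ^ d"
    by (simp add: algebra_simps)
  then show ?thesis using N by (simp add: abs_mult)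
qed

end

section \<open>Surjections from the sandpile group as words\<close>

lemma reduced_laplacian_index:
  assumes "i < n - 1" "j < n - 1"
  shows "reduced_laplacian d n (perm_digraph d n \<pi>) $$ (i, j)
    = (\<Sum>k<d. if \<pi> k i = j then 1 else 0) - (if i = j then int d else 0)"
proof -
  have ij: "i < n" "j < n" using assms by auto
  have "reduced_laplacian d n (perm_digraph d n \<pi>) $$ (i, j)
    = (adj_mat n (perm_digraph d n \<pi>) - int d \<cdot>\<^sub>m 1\<^sub>m n) $$ (i, j)"
    using assms by (simp add: reduced_laplacian_def mat_delete_def adj_mat_def)
  also have "\<dots> = adj_mat n (perm_digraph d n \<pi>) $$ (i, j) - int d * (if i = j then 1 else 0)"
    using ij by (simp add: adj_mat_def)
  also have "adj_mat n (perm_digraph d n \<pi>) $$ (i, j) = (\<Sum>k<d. if \<pi> k i = j then 1 else 0)"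
    unfolding adj_mat_perm_digraph_index[OF ij] using ij by (simp add: perm_mat_def)
  finally show ?thesis by simp
qed

lemma reduced_laplacian_dim:
  "reduced_laplacian d n (perm_digraph d n \<pi>) \<in> carrier_mat (n - 1) (n - 1)"
  by (simp add: reduced_laplacian_def mat_delete_def adj_mat_def)

lemma power_int_sum:
  fixes x :: complex
  assumes "x \<noteq> 0"
  shows "x powi (\<Sum>k\<in>K. f k) = (\<Prod>k\<in>K. x powi f k)"
  by (induction K rule: infinite_finite_induct) (use assms in \<open>auto simp: power_int_add\<close>)

context finite_comm_group
begin

lemma char_int_pow:
  assumes \<xi>: "\<xi> \<in> chars G" and x: "x \<in> carrier G"
  shows "\<xi> (x [^] (z::int)) = \<xi> x powi z"
proof (cases "z < 0")
  case True
  have "inverse (\<xi> x) = cnj (\<xi> x)" by (rule inverse_unique) (rule char_cnj_self[OF \<xi> x])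
  then have p: "\<xi> x powi z = cnj (\<xi> x) ^ nat (- z)" using True by (simp only: power_int_def not_le[symmetric] if_False)
  have "\<xi> (x [^] z) = \<xi> (inv (x [^] nat (- z)))" using True by (simp only: int_pow_def2 if_True)
  also have "\<dots> = cnj (\<xi> (x [^] nat (- z)))" by (rule char_inv[OF \<xi> nat_pow_closed[OF x]])
  also have "\<dots> = cnj (\<xi> x) ^ nat (- z)" by (simp only: char_pow[OF \<xi> x] complex_cnj_power)
  finally show ?thesis using p by simp
next
  case False
  then have "\<xi> x powi z = \<xi> x ^ nat z" by (simp add: power_int_def)
  moreover have "\<xi> (x [^] z) = \<xi> (x [^] nat z)" using False by (simp only: int_pow_def2 if_False)
  ultimately show ?thesis by (simp only: char_pow[OF \<xi> x])
qed

text \<open>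
  Characters turn identities in the group into identities between products of complex numbers,
  where double products can be interchanged freely.
\<close>

lemma eq_by_chars:
  assumes "a \<in> carrier G" "b \<in> carrier G" "\<And>\<xi>. \<xi> \<in> chars G \<Longrightarrow> \<xi> a = \<xi> b"
  shows "a = b"
proof (rule ccontr)
  assume "a \<noteq> b"
  then have "a \<otimes> inv b \<noteq> \<one>" using assms(1,2) by (metis inv_equality inv_inv inv_closed)
  then obtain \<xi> where \<xi>: "\<xi> \<in> chars G" "\<xi> (a \<otimes> inv b) \<noteq> 1"
    using char_separates[of "a \<otimes> inv b"] assms(1,2) by auto
  have "\<xi> (a \<otimes> inv b) = \<xi> b * cnj (\<xi> b)"
    using assms(1,2) by (simp only: char_mult[OF \<xi>(1)] char_inv[OF \<xi>(1)] inv_closed assms(3)[OF \<xi>(1)])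
  then show False using \<xi> char_cnj_self[OF \<xi>(1) assms(2)] by simp
qed

lemma additive_eq_int_pow:
  fixes \<phi> :: "int \<Rightarrow> 'a"
  assumes c: "\<And>z. \<phi> z \<in> carrier G" and add: "\<And>y z. \<phi> (y + z) = \<phi> y \<otimes> \<phi> z"
  shows "\<phi> z = \<phi> 1 [^] z"
proof (induction z rule: int_induct[where k = 0])
  case base
  have "\<phi> 0 \<otimes> \<phi> 0 = \<phi> 0" using add[of 0 0] by simp
  then have "\<phi> 0 = \<one>" using c[of 0] by (metis l_one one_closed right_cancel)
  then show ?case by simp
next
  case (step1 i)
  then show ?case using add[of i 1] c int_pow_mult[of "\<phi> 1" i 1] by simp
next
  case (step2 i)
  have "\<phi> (i - 1) \<otimes> \<phi> 1 = \<phi> 1 [^] i" using add[of "i - 1" 1] step2 by simp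
  also have "\<dots> = \<phi> 1 [^] (i - 1) \<otimes> \<phi> 1" using c int_pow_mult[of "\<phi> 1" "i - 1" 1] by simp
  finally show ?case using c by (metis int_pow_closed right_cancel)
qed

text \<open>
  The homomorphism from integer vectors to the group with value \<open>g j\<close> at the unit
  vector \<open>j\<close>.
\<close>

definition lin :: "nat \<Rightarrow> (nat \<Rightarrow> 'a) \<Rightarrow> int vec \<Rightarrow> 'a"
  where "lin m g x = finprod G (\<lambda>j. g j [^] (x $ j)) {..<m}"

lemma lin_hom:
  assumes g: "\<And>j. j < m \<Longrightarrow> g j \<in> carrier G"
  shows "lin m g \<in> hom (monoid_vec TYPE(int) m) G"
proof (rule homI)
  fix x assume "x \<in> carrier (monoid_vec TYPE(int) m)"
  show "lin m g x \<in> carrier G" unfolding lin_def by (rule finprod_closed) (use g in auto)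
next
  fix x y assume "x \<in> carrier (monoid_vec TYPE(int) m)" "y \<in> carrier (monoid_vec TYPE(int) m)"
  then have xy: "x \<in> carrier_vec m" "y \<in> carrier_vec m" by (simp_all add: monoid_vec_simps)
  have "lin m g (x + y) = finprod G (\<lambda>j. g j [^] (x $ j) \<otimes> g j [^] (y $ j)) {..<m}"
    unfolding lin_def by (rule finprod_cong') (use g xy in \<open>auto simp: int_pow_mult\<close>)
  also have "\<dots> = lin m g x \<otimes> lin m g y"
    unfolding lin_def by (rule finprod_multf) (use g in auto)
  finally show "lin m g (x \<otimes>\<^bsub>monoid_vec TYPE(int) m\<^esub> y) = lin m g x \<otimes> lin m g y"
    by (simp add: monoid_vec_simps)
qed

lemma lin_unit:
  assumes g: "\<And>j. j < m \<Longrightarrow> g j \<in> carrier G" and i: "i < m"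
  shows "lin m g (unit_vec m i) = g i"
proof -
  have "lin m g (unit_vec m i) = finprod G (\<lambda>j. if i = j then g j else \<one>) {..<m}"
    unfolding lin_def by (rule finprod_cong') (use g i in auto)
  also have "\<dots> = g i" by (rule finprod_singleton) (use g i in auto)
  finally show ?thesis .
qed

text \<open>
  Build up the vector one coordinate at a time.
\<close>

lemma hom_eq_lin:
  assumes f: "f \<in> hom (monoid_vec TYPE(int) m) G" and x: "x \<in> carrier_vec m"
  shows "f x = lin m (\<lambda>j. f (unit_vec m j)) x"
proof -
  have fc: "f y \<in> carrier G" if "y \<in> carrier_vec m" for y
    using f that by (auto simp: hom_def monoid_vec_simps)
  have fa: "f (y + z) = f y \<otimes> f z" if "y \<in> carrier_vec m" "z \<in> carrier_vec m" for y z
    using hom_mult[OF f, of y z] that by (simp add: monoid_vec_simps)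
  define p where "p l = vec m (\<lambda>j. if j < l then x $ j else 0)" for l
  have "f (p l) = finprod G (\<lambda>j. f (unit_vec m j) [^] (x $ j)) {..<l}" if "l \<le> m" for l
    using that
  proof (induction l)
    case 0
    have p0: "p 0 = 0\<^sub>v m" by (auto simp: p_def)
    have "f (0\<^sub>v m) \<otimes> f (0\<^sub>v m) = f (0\<^sub>v m)" using fa[of "0\<^sub>v m" "0\<^sub>v m"] by simp
    then have "f (0\<^sub>v m) = \<one>" using fc[of "0\<^sub>v m"] by (metis l_one one_closed right_cancel zero_carrier_vec)
    then show ?case by (simp add: p0)
  next
    case (Suc l)
    have "p (Suc l) = p l + x $ l \<cdot>\<^sub>v unit_vec m l"
      using Suc.prems by (intro eq_vecI) (auto simp: p_def less_Suc_eq)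
    then have "f (p (Suc l)) = f (p l) \<otimes> f (x $ l \<cdot>\<^sub>v unit_vec m l)"
      using fa[of "p l" "x $ l \<cdot>\<^sub>v unit_vec m l"] by (simp add: p_def)
    also have "f (x $ l \<cdot>\<^sub>v unit_vec m l) = f (1 \<cdot>\<^sub>v unit_vec m l) [^] (x $ l)"
    proof (rule additive_eq_int_pow)
      show "f (z \<cdot>\<^sub>v unit_vec m l) \<in> carrier G" for z by (rule fc) simp
      show "f ((y + z) \<cdot>\<^sub>v unit_vec m l) = f (y \<cdot>\<^sub>v unit_vec m l) \<otimes> f (z \<cdot>\<^sub>v unit_vec m l)" for y z
        unfolding add_smult_distrib_vec by (rule fa) auto
    qed
    also have "1 \<cdot>\<^sub>v unit_vec m l = (unit_vec m l :: int vec)" by simp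
    finally have "f (p (Suc l)) = finprod G (\<lambda>j. f (unit_vec m j) [^] (x $ j)) {..<l} \<otimes> f (unit_vec m l) [^] (x $ l)"
      using Suc by simp
    also have "\<dots> = finprod G (\<lambda>j. f (unit_vec m j) [^] (x $ j)) {..<Suc l}"
      using fc by (simp add: lessThan_Suc Pi_def m_comm)
    finally show ?case .
  qed
  moreover have "p m = x" using x by (intro eq_vecI) (auto simp: p_def)
  ultimately show ?thesis by (metis lin_def order_refl)
qed

text \<open>
  Row \<open>i\<close> of the reduced Laplacian is the equation \<open>A g = d g\<close> at the
  vertex \<open>i\<close>: the diagonal matrix accounts for the right side, and the missing column
  of the deleted vertex does not matter because \<open>g\<close> is the identity there.
\<close>

lemma lin_row:
  assumes n: "n \<ge> 1" and \<pi>: "\<And>k. k < d \<Longrightarrow> \<pi> k permutes {..<n}" and g: "g \<in> PiE {..<n} (\<lambda>_. carrier G)"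
    and g1: "g (n - 1) = \<one>" and i: "i < n - 1"
  shows "lin (n - 1) g (row (reduced_laplacian d n (perm_digraph d n \<pi>)) i) \<otimes> g i [^] d
    = finprod G (\<lambda>k. g (\<pi> k i)) {..<d}"
proof (rule eq_by_chars)
  let ?r = "row (reduced_laplacian d n (perm_digraph d n \<pi>)) i"
  have gc: "g j \<in> carrier G" if "j < n" for j using g that by auto
  have pn: "\<pi> k i < n" if "k < d" for k using permutes_in_image[OF \<pi>[OF that], of i] i by auto
  show c1: "lin (n - 1) g ?r \<otimes> g i [^] d \<in> carrier G"
    using gc i unfolding lin_def by (intro m_closed finprod_closed) auto
  show "finprod G (\<lambda>k. g (\<pi> k i)) {..<d} \<in> carrier G"
    by (rule finprod_closed) (use gc pn in auto)
  fix \<xi> assume \<xi>: "\<xi> \<in> chars G"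
  have nz: "\<xi> (g j) \<noteq> 0" if "j < n" for j using char_norm[OF \<xi> gc[OF that]] by auto
  have rj: "?r $ j = (\<Sum>k<d. if \<pi> k i = j then 1 else 0) - (if i = j then int d else 0)" if "j < n - 1" for j
    using reduced_laplacian_index[OF i that, of d \<pi>] reduced_laplacian_dim[of d n \<pi>] i that by simp
  have "\<xi> (lin (n - 1) g ?r) = (\<Prod>j<n - 1. \<xi> (g j) powi (?r $ j))"
    unfolding lin_def
    by (subst char_finprod[OF \<xi>]) (use gc in \<open>auto intro!: prod.cong char_int_pow[OF \<xi>]\<close>)
  also have "\<dots> = (\<Prod>j<n - 1. (\<Prod>k<d. if \<pi> k i = j then \<xi> (g j) else 1) / (if i = j then \<xi> (g j) ^ d else 1))"
  proof (intro prod.cong refl)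
    fix j assume "j \<in> {..<n - 1}"
    then have j: "j < n - 1" "\<xi> (g j) \<noteq> 0" using nz[of j] by auto
    have "\<xi> (g j) powi (?r $ j) = \<xi> (g j) powi (\<Sum>k<d. if \<pi> k i = j then 1 else 0) / \<xi> (g j) powi (if i = j then int d else 0)"
      unfolding rj[OF j(1)] by (rule power_int_diff) (use j in simp)
    also have "\<xi> (g j) powi (\<Sum>k<d. if \<pi> k i = j then 1 else 0) = (\<Prod>k<d. if \<pi> k i = j then \<xi> (g j) else 1)"
      unfolding power_int_sum[OF j(2)] by (intro prod.cong refl) auto
    also have "\<xi> (g j) powi (if i = j then int d else 0) = (if i = j then \<xi> (g j) ^ d else 1)" by simp
    finally show "\<xi> (g j) powi (?r $ j) = (\<Prod>k<d. if \<pi> k i = j then \<xi> (g j) else 1) / (if i = j then \<xi> (g j) ^ d else 1)" .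
  qed
  also have "\<dots> = (\<Prod>j<n - 1. \<Prod>k<d. if \<pi> k i = j then \<xi> (g j) else 1) / \<xi> (g i) ^ d"
    unfolding prod_dividef using i by simp
  also have "(\<Prod>j<n - 1. \<Prod>k<d. if \<pi> k i = j then \<xi> (g j) else 1) = (\<Prod>k<d. \<Prod>j<n - 1. if \<pi> k i = j then \<xi> (g j) else 1)"
    by (rule prod.swap)
  also have "\<dots> = (\<Prod>k<d. \<xi> (g (\<pi> k i)))"
  proof (intro prod.cong refl)
    fix k assume "k \<in> {..<d}"
    then have k: "\<pi> k i < n" using pn by auto
    show "(\<Prod>j<n - 1. if \<pi> k i = j then \<xi> (g j) else 1) = \<xi> (g (\<pi> k i))"
    proof (cases "\<pi> k i < n - 1")
      case False
      then have "\<pi> k i = n - 1" using k by linarith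
      then show ?thesis using g1 char_one[OF \<xi>] by simp
    qed simp
  qed
  also have "\<dots> = \<xi> (finprod G (\<lambda>k. g (\<pi> k i)) {..<d})"
    by (rule char_finprod[OF \<xi>, symmetric]) (use gc pn in auto)
  finally have "\<xi> (lin (n - 1) g ?r) = \<xi> (finprod G (\<lambda>k. g (\<pi> k i)) {..<d}) / \<xi> (g i) ^ d" .
  moreover have "\<xi> (lin (n - 1) g ?r \<otimes> g i [^] d) = \<xi> (lin (n - 1) g ?r) * \<xi> (g i) ^ d"
  proof -
    have "lin (n - 1) g ?r \<in> carrier G" unfolding lin_def by (rule finprod_closed) (use gc in auto)
    then show ?thesis using gc[of i] i char_pow[OF \<xi>, of "g i" d] char_mult[OF \<xi>, of "lin (n - 1) g ?r" "g i [^] d"] by simp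
  qed
  ultimately show "\<xi> (lin (n - 1) g ?r \<otimes> g i [^] d) = \<xi> (finprod G (\<lambda>k. g (\<pi> k i)) {..<d})"
    using nz[of i] i by simp
qed

text \<open>
  The product of all equations holds for every \<open>g\<close>, because each permutation runs
  through all vertices. So the equation for the deleted vertex follows from the others.
\<close>

lemma last_row_automatic:
  fixes n d :: nat
  assumes n: "n \<ge> 1" and \<pi>: "\<And>k. k < d \<Longrightarrow> \<pi> k permutes {..<n}" and g: "g \<in> PiE {..<n} (\<lambda>_. carrier G)"
    and eq: "\<And>i. i < n - 1 \<Longrightarrow> finprod G (\<lambda>k. g (\<pi> k i)) {..<d} = g i [^] d"
  shows "finprod G (\<lambda>k. g (\<pi> k (n - 1))) {..<d} = g (n - 1) [^] d"
proof (rule eq_by_chars)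
  have gc: "g j \<in> carrier G" if "j < n" for j using g that by auto
  have pn: "\<pi> k i < n" if "k < d" "i < n" for k i using permutes_in_image[OF \<pi>[OF that(1)], of i] that by auto
  have pc: "(\<lambda>k. g (\<pi> k i)) \<in> {..<d} \<rightarrow> carrier G" if "i < n" for i using gc pn that by auto
  show "finprod G (\<lambda>k. g (\<pi> k (n - 1))) {..<d} \<in> carrier G" by (rule finprod_closed[OF pc]) (use n in linarith)
  show "g (n - 1) [^] d \<in> carrier G" using gc[of "n - 1"] n by simp
  fix \<xi> assume \<xi>: "\<xi> \<in> chars G"
  define P where "P i = \<xi> (finprod G (\<lambda>k. g (\<pi> k i)) {..<d})" for i
  have P: "P i = (\<Prod>k<d. \<xi> (g (\<pi> k i)))" if "i < n" for i
    unfolding P_def by (rule char_finprod[OF \<xi> pc[OF that]])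
  have nz: "\<xi> (g j) \<noteq> 0" if "j < n" for j using char_norm[OF \<xi> gc[OF that]] by auto
  have I: "{..<n} = insert (n - 1) {..<n - 1}" using n by auto
  have "(\<Prod>i<n. P i) = (\<Prod>k<d. \<Prod>i<n. \<xi> (g (\<pi> k i)))"
    by (subst prod.swap) (simp add: P)
  also have "\<dots> = (\<Prod>k<d. \<Prod>i<n. \<xi> (g i))"
    by (intro prod.cong refl prod.reindex_bij_betw permutes_imp_bij \<pi>) auto
  also have "\<dots> = (\<Prod>i<n. \<xi> (g i) ^ d)" by (simp add: prod_power_distrib)
  finally have A: "P (n - 1) * (\<Prod>i<n - 1. P i) = \<xi> (g (n - 1)) ^ d * (\<Prod>i<n - 1. \<xi> (g i) ^ d)"
    unfolding I by simp
  have B: "(\<Prod>i<n - 1. P i) = (\<Prod>i<n - 1. \<xi> (g i) ^ d)"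
    by (intro prod.cong refl) (use eq gc in \<open>auto simp: P_def char_pow[OF \<xi>]\<close>)
  have C: "(\<Prod>i<n - 1. \<xi> (g i) ^ d) \<noteq> 0" using nz by auto
  have "P (n - 1) = \<xi> (g (n - 1)) ^ d" by (rule iffD1[OF mult_right_cancel[OF C] A[unfolded B]])
  then show "\<xi> (finprod G (\<lambda>k. g (\<pi> k (n - 1))) {..<d}) = \<xi> (g (n - 1) [^] d)"
    using gc[of "n - 1"] n by (simp add: P_def char_pow[OF \<xi>])
qed

lemma finite_PiE_carrier: "finite (PiE {..<n::nat} (\<lambda>_. carrier G))"
  using finite_carrier by (auto intro!: finite_PiE)

text \<open>
  The value at the deleted vertex is normalised, since the reduced Laplacian has no column for it.
\<close>

definition generating :: "nat \<Rightarrow> (nat \<Rightarrow> 'a) set"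
  where "generating n = {g \<in> PiE {..<n} (\<lambda>_. carrier G). g (n - 1) = \<one> \<and> generate G (g ` {..<n}) = carrier G}"

text \<open>
  A homomorphism from the quotient is determined by its values at the unit vectors, and these
  values are arbitrary except that the rows have to be mapped to the identity.
\<close>

lemma card_Sur_sandpile_group:
  assumes n: "n \<ge> 1" and \<pi>: "\<And>k. k < d \<Longrightarrow> \<pi> k permutes {..<n}"
  shows "card (Sur (sandpile_group d n (perm_digraph d n \<pi>)) G)
    = card {g \<in> generating n. \<forall>i<n. finprod G (\<lambda>k. g (\<pi> k i)) {..<d} = g i [^] d}"
proof -
  let ?m = "n - 1" and ?\<Delta> = "reduced_laplacian d n (perm_digraph d n \<pi>)"
  let ?Z = "monoid_vec TYPE(int) ?m"
  let ?H = "generate ?Z (set (rows ?\<Delta>))"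
  let ?Q = "?Z Mod ?H"
  let ?E = "{g \<in> generating n. \<forall>i<n. finprod G (\<lambda>k. g (\<pi> k i)) {..<d} = g i [^] d}"
  interpret Z: comm_group ?Z by (rule comm_group_vec)
  have Zc: "carrier ?Z = carrier_vec ?m" by (simp add: monoid_vec_simps)
  have rows_in: "set (rows ?\<Delta>) \<subseteq> carrier ?Z"
    using rows_carrier[of ?\<Delta>] reduced_laplacian_dim[of d n \<pi>] by (simp add: monoid_vec_simps)
  have rows_set: "set (rows ?\<Delta>) = row ?\<Delta> ` {..<?m}"
    using reduced_laplacian_dim[of d n \<pi>] by (simp add: rows_def atLeast0LessThan)
  have sH: "subgroup ?H ?Z" by (rule Z.generate_is_subgroup[OF rows_in])
  have nH: "?H \<lhd> ?Z" by (rule Z.normal_iff_subgroup[THEN iffD2, OF sH])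
  have Qdef: "sandpile_group d n (perm_digraph d n \<pi>) = ?Q" unfolding sandpile_group_def Let_def ..
  have Qc: "carrier ?Q = (\<lambda>x. ?H #>\<^bsub>?Z\<^esub> x) ` carrier ?Z" by (rule carrier_FactGroup)
  have uc: "unit_vec ?m j \<in> carrier ?Z" for j unfolding Zc by (rule unit_vec_carrier)
  define \<alpha> where "\<alpha> F = (\<lambda>i\<in>{..<n}. if i < ?m then F (?H #>\<^bsub>?Z\<^esub> unit_vec ?m i) else \<one>)" for F :: "int vec set \<Rightarrow> 'a"
  have Fc: "F (?H #>\<^bsub>?Z\<^esub> unit_vec ?m j) \<in> carrier G" if F: "F \<in> hom ?Q G" for F j
  proof -
    have "?H #>\<^bsub>?Z\<^esub> unit_vec ?m j \<in> carrier ?Q" unfolding Qc by (rule imageI[OF uc])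
    then show ?thesis using F unfolding hom_def by blast
  qed
  have lift: "F (?H #>\<^bsub>?Z\<^esub> x) = lin ?m (\<alpha> F) x" if F: "F \<in> hom ?Q G" and x: "x \<in> carrier ?Z" for F x
  proof -
    have "F \<circ> (\<lambda>x. ?H #>\<^bsub>?Z\<^esub> x) \<in> hom ?Z G"
      by (rule Group.hom_compose[OF normal.r_coset_hom_Mod[OF nH] F])
    from hom_eq_lin[OF this x[unfolded Zc]]
    have "F (?H #>\<^bsub>?Z\<^esub> x) = lin ?m (\<lambda>j. F (?H #>\<^bsub>?Z\<^esub> unit_vec ?m j)) x" by (simp only: comp_apply)
    also have "\<dots> = lin ?m (\<alpha> F) x"
      unfolding lin_def by (rule finprod_cong') (use Fc[OF F] in \<open>auto simp: \<alpha>_def\<close>)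
    finally show ?thesis .
  qed
  have "bij_betw \<alpha> (Sur ?Q G) ?E"
    unfolding bij_betw_def
  proof (intro conjI equalityI subsetI)
    show "inj_on \<alpha> (Sur ?Q G)"
    proof (rule inj_onI)
      fix F F' assume h: "F \<in> Sur ?Q G" "F' \<in> Sur ?Q G" "\<alpha> F = \<alpha> F'"
      then have F: "F \<in> hom ?Q G" "F' \<in> hom ?Q G" by (auto simp: Sur_def epi_def)
      show "F = F'"
      proof (rule extensionalityI[where A = "carrier ?Q"])
        fix q assume "q \<in> carrier ?Q"
        then obtain x where x: "x \<in> carrier ?Z" "q = ?H #>\<^bsub>?Z\<^esub> x" unfolding Qc by blast
        show "F q = F' q" unfolding x(2) lift[OF F(1) x(1)] lift[OF F(2) x(1)] h(3) ..
      qed (use h in \<open>auto simp: Sur_def\<close>)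
    qed
  next
    fix g assume "g \<in> \<alpha> ` Sur ?Q G"
    then obtain F where FS: "F \<in> Sur ?Q G" and gF: "g = \<alpha> F" by blast
    have F: "F \<in> hom ?Q G" and surj: "F ` carrier ?Q = carrier G" using FS by (auto simp: Sur_def epi_def)
    have g: "g \<in> PiE {..<n} (\<lambda>_. carrier G)"
      using Fc[OF F] by (auto simp: gF \<alpha>_def)
    have g1: "g (n - 1) = \<one>" using n by (simp add: gF \<alpha>_def)
    have gc: "g j \<in> carrier G" if "j < n" for j using g that by auto
    have eq: "finprod G (\<lambda>k. g (\<pi> k i)) {..<d} = g i [^] d" if i: "i < n - 1" for i
    proof -
      have r: "row ?\<Delta> i \<in> set (rows ?\<Delta>)" using i by (simp add: rows_set)
      then have rH: "row ?\<Delta> i \<in> ?H" by (rule generate.incl)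
      have "lin ?m g (row ?\<Delta> i) = F (?H #>\<^bsub>?Z\<^esub> row ?\<Delta> i)"
        unfolding gF by (rule lift[OF F, symmetric]) (use r rows_in in blast)
      also have "?H #>\<^bsub>?Z\<^esub> row ?\<Delta> i = ?H"
        by (rule Z.coset_join2[OF _ sH rH]) (use r rows_in in blast)
      also have "F ?H = \<one>"
      proof -
        have "group ?Q" by (rule normal.factorgroup_is_group[OF nH])
        from hom_one[OF F this is_group] show ?thesis by simp
      qed
      finally have "lin ?m g (row ?\<Delta> i) = \<one>" .
      moreover have "lin ?m g (row ?\<Delta> i) \<otimes> g i [^] d = finprod G (\<lambda>k. g (\<pi> k i)) {..<d}"
        by (rule lin_row[OF n \<pi> g g1 i])
      moreover have "g i [^] d \<in> carrier G" using gc[of i] i by simp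
      ultimately show ?thesis by (metis l_one)
    qed
    have "carrier G \<subseteq> generate G (g ` {..<n})"
    proof
      fix v assume "v \<in> carrier G"
      then obtain q where q: "q \<in> carrier ?Q" "v = F q" using surj by blast
      then obtain x where x: "x \<in> carrier ?Z" "q = ?H #>\<^bsub>?Z\<^esub> x" unfolding Qc by blast
      have sg: "subgroup (generate G (g ` {..<n})) G" by (rule generate_is_subgroup) (use gc in auto)
      have gj: "g j [^] (x $ j) \<in> generate G (g ` {..<n})" if "j < ?m" for j
        by (rule subgroup_int_pow_closed[OF sg generate.incl]) (use that in auto)
      have "lin ?m g x \<in> generate G (g ` {..<n})"
        unfolding lin_def
        by (rule char_sub_finprod(1)[OF sg finite_comm_group.triv_char_in[OF sub_finite_comm_group[OF sg]]]) (use gj in auto)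
      then show "v \<in> generate G (g ` {..<n})" using lift[OF F x(1)] q x gF by simp
    qed
    moreover have "generate G (g ` {..<n}) \<subseteq> carrier G" by (rule generate_incl) (use gc in auto)
    ultimately have "g \<in> generating n" using g g1 by (simp add: generating_def)
    moreover have "finprod G (\<lambda>k. g (\<pi> k i)) {..<d} = g i [^] d" if "i < n" for i
    proof (cases "i < n - 1")
      case False
      then have "i = n - 1" using that by linarith
      then show ?thesis using last_row_automatic[OF n \<pi> g eq] by simp
    qed (rule eq)
    ultimately show "g \<in> ?E" by simp
  next
    fix g assume gE: "g \<in> ?E"
    then have g: "g \<in> PiE {..<n} (\<lambda>_. carrier G)" and g1: "g (n - 1) = \<one>" and gen: "generate G (g ` {..<n}) = carrier G"
      and eq: "\<And>i. i < n \<Longrightarrow> finprod G (\<lambda>k. g (\<pi> k i)) {..<d} = g i [^] d"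
      by (auto simp: generating_def)
    have gc: "g j \<in> carrier G" if "j < n" for j using g that by auto
    have gm: "g j \<in> carrier G" if "j < ?m" for j using gc that by simp
    let ?h = "lin ?m g"
    have h: "?h \<in> hom ?Z G" by (rule lin_hom[OF gm])
    interpret h: group_hom ?Z G ?h using h by unfold_locales
    have "set (rows ?\<Delta>) \<subseteq> kernel ?Z G ?h"
    proof
      fix r assume r: "r \<in> set (rows ?\<Delta>)"
      then obtain i where i: "i < ?m" "r = row ?\<Delta> i" by (auto simp: rows_set)
      have rc: "r \<in> carrier ?Z" using r rows_in by blast
      have "?h r \<otimes> g i [^] d = \<one> \<otimes> g i [^] d"
      proof -
        have "?h (row ?\<Delta> i) \<otimes> g i [^] d = finprod G (\<lambda>k. g (\<pi> k i)) {..<d}"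
          by (rule lin_row[OF n \<pi> g g1 i(1)])
        also have "\<dots> = g i [^] d" using eq[of i] i by simp
        finally show ?thesis using i gc[of i] by simp
      qed
      then have "?h r = \<one>" using gc[of i] i h.hom_closed[OF rc] by (metis gm nat_pow_closed one_closed right_cancel)
      then show "r \<in> kernel ?Z G ?h" using rc by (simp add: kernel_def)
    qed
    then have Hk: "?H \<subseteq> kernel ?Z G ?h" by (rule Z.generate_subgroup_incl[OF _ h.subgroup_kernel])
    have wd: "?h x = ?h y" if xy: "x \<in> carrier ?Z" "y \<in> carrier ?Z" "?H #>\<^bsub>?Z\<^esub> x = ?H #>\<^bsub>?Z\<^esub> y" for x y
    proof -
      have "x \<in> ?H #>\<^bsub>?Z\<^esub> y" using Z.rcos_self[OF xy(1) sH] xy(3) by simp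
      then obtain z where z: "z \<in> ?H" "x = z \<otimes>\<^bsub>?Z\<^esub> y" by (auto simp: r_coset_def)
      then have zk: "z \<in> carrier ?Z" "?h z = \<one>" using Hk by (auto simp: kernel_def)
      show ?thesis unfolding z(2) using h.hom_mult[OF zk(1) xy(2)] zk h.hom_closed[OF xy(2)] by simp
    qed
    obtain F0 where F0: "F0 \<in> hom ?Q G" "\<And>x. x \<in> carrier ?Z \<Longrightarrow> F0 (?H #>\<^bsub>?Z\<^esub> x) = ?h x"
      using FactGroup_universal[OF h nH wd] by blast
    define F where "F = restrict F0 (carrier ?Q)"
    have Qx: "?H #>\<^bsub>?Z\<^esub> x \<in> carrier ?Q" if "x \<in> carrier ?Z" for x unfolding Qc by (rule imageI[OF that])
    have FF: "F (?H #>\<^bsub>?Z\<^esub> x) = ?h x" if "x \<in> carrier ?Z" for x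
      using F0(2)[OF that] Qx[OF that] by (simp add: F_def)
    interpret Q: group ?Q by (rule normal.factorgroup_is_group[OF nH])
    have Fh: "F \<in> hom ?Q G"
    proof (rule homI)
      show "F q \<in> carrier G" if "q \<in> carrier ?Q" for q
        using that F0(1) unfolding F_def hom_def Pi_def by (simp only: restrict_apply if_True mem_Collect_eq)
      show "F (q \<otimes>\<^bsub>?Q\<^esub> q') = F q \<otimes> F q'" if "q \<in> carrier ?Q" "q' \<in> carrier ?Q" for q q'
        unfolding F_def restrict_apply using that Q.m_closed[OF that] hom_mult[OF F0(1) that] by (simp only: if_True)
    qed
    have "g = \<alpha> F"
    proof (rule extensionalityI[where A = "{..<n}"])
      fix i assume i: "i \<in> {..<n}"
      show "g i = \<alpha> F i"
      proof (cases "i < ?m")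
        case True
        then show ?thesis using i FF[OF uc] lin_unit[OF gm True] by (simp add: \<alpha>_def)
      next
        case False
        then have "i = n - 1" using i by auto
        then show ?thesis using g1 n by (simp add: \<alpha>_def)
      qed
    qed (use g in \<open>simp_all add: PiE_def \<alpha>_def\<close>)
    moreover have "F \<in> Sur ?Q G"
    proof -
      have im: "subgroup (F ` carrier ?Q) G"
        by (rule group_hom.img_is_subgroup) (use Fh in \<open>unfold_locales\<close>)
      have gin: "g j \<in> F ` carrier ?Q" if "j < n" for j
      proof (cases "j < ?m")
        case True
        then have "g j = F (?H #>\<^bsub>?Z\<^esub> unit_vec ?m j)" using FF[OF uc] lin_unit[OF gm True] by simp
        then show ?thesis using Qx[OF uc] by blast
      next
        case False
        then have "j = n - 1" using that by linarith
        then show ?thesis using g1 subgroup.one_closed[OF im] by simp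
      qed
      then have "generate G (g ` {..<n}) \<subseteq> F ` carrier ?Q" by (intro generate_subgroup_incl im) auto
      then have "carrier G \<subseteq> F ` carrier ?Q" using gen by simp
      then have "F \<in> epi ?Q G" using Fh by (simp add: epi_iff_subset)
      then show ?thesis by (simp add: Sur_def F_def)
    qed
    ultimately show "g \<in> \<alpha> ` Sur ?Q G" by blast
  qed
  then show ?thesis unfolding Qdef by (rule bij_betw_same_card)
qed

text \<open>
  Composition with a permutation carries the permutations that produce one word to those that
  produce any other.
\<close>

lemma card_perms_to_word:
  assumes I: "finite I" and g: "g \<in> extensional I" and w: "w \<in> words I (image_mset g (mset_set I))"
  shows "card {p. p permutes I \<and> restrict (g \<circ> p) I = w} * card (words I (image_mset g (mset_set I))) = fact (card I)"
proof -
  let ?T = "words I (image_mset g (mset_set I))" and ?P = "{p. p permutes I}"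
  let ?f = "\<lambda>p. restrict (g \<circ> p) I"
  have gT: "g \<in> ?T" by (rule self_in_words[OF g])
  have fP: "finite ?P" by (rule finite_permutations[OF I])
  have into: "?f p \<in> ?T" if "p permutes I" for p
    using bij_betwE[OF words_permute[OF I that]] gT by blast
  have same: "card {p. p permutes I \<and> ?f p = w'} \<le> card {p. p permutes I \<and> ?f p = w}"
    if w': "w' \<in> ?T" and w: "w \<in> ?T" for w w'
  proof -
    obtain q where q: "q permutes I" "\<And>i. i \<in> I \<Longrightarrow> w i = w' (q i)" using words_transitive[OF I w w'] by blast
    show ?thesis
    proof (rule card_inj_on_le[where f = "\<lambda>p. p \<circ> q"])
      show "inj_on (\<lambda>p. p \<circ> q) {p. p permutes I \<and> ?f p = w'}"
      proof (rule inj_onI)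
        fix p p' assume "p \<circ> q = p' \<circ> q"
        then have "p (q x) = p' (q x)" for x by (metis comp_apply)
        then show "p = p'" using permutes_surj[OF q(1)] by (metis surj_def ext)
      qed
      show "(\<lambda>p. p \<circ> q) ` {p. p permutes I \<and> ?f p = w'} \<subseteq> {p. p permutes I \<and> ?f p = w}"
      proof (intro image_subsetI CollectI conjI)
        fix p assume p: "p \<in> {p. p permutes I \<and> ?f p = w'}"
        show "p \<circ> q permutes I" using p q(1) permutes_compose by blast
        show "?f (p \<circ> q) = w"
        proof (rule extensionalityI[where A = I])
          fix i assume i: "i \<in> I"
          have qi: "q i \<in> I" using permutes_in_image[OF q(1)] i by simp
          have "w' (q i) = ?f p (q i)" using p by simp
          also have "\<dots> = g (p (q i))" using qi by simp
          finally show "?f (p \<circ> q) i = w i" using i q(2)[OF i] by simp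
        qed (use w in \<open>simp_all add: words_def\<close>)
      qed
      show "finite {p. p permutes I \<and> ?f p = w}" using fP by simp
    qed
  qed
  have "fact (card I) = card ?P" by (simp add: card_permutations[OF refl I])
  also have "\<dots> = (\<Sum>w'\<in>?T. card {p \<in> ?P. ?f p = w'})"
    unfolding card_eq_sum[of ?P] card_eq_sum[of "{p \<in> ?P. ?f p = _}"]
    by (rule sum.group[symmetric]) (use fP finite_words[OF I] into in auto)
  also have "\<dots> = (\<Sum>w'\<in>?T. card {p. p permutes I \<and> ?f p = w})"
    by (intro sum.cong refl) (use same w in \<open>auto intro: antisym\<close>)
  finally show ?thesis by (simp add: mult.commute)
qed

text \<open>
  A permutation \<open>\<pi> k\<close> acts through the word \<open>g \<circ> \<pi> k\<close>, and
  each rearrangement of \<open>g\<close> comes from the same number of permutations.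
\<close>

lemma card_hitting_permutations:
  assumes g: "g \<in> PiE {..<n} (\<lambda>_. carrier G)"
  shows "real (card {\<pi> \<in> PiE_dflt {..<d} id (\<lambda>_. {p. p permutes {..<n}}). \<forall>i<n. finprod G (\<lambda>k. g (\<pi> k i)) {..<d} = g i [^] d})
    = hit_prob d {..<n} g * fact n ^ d"
proof -
  let ?I = "{..<n}" and ?D = "{..<d}"
  let ?T = "words ?I (image_mset g (mset_set ?I))"
  let ?P = "PiE_dflt ?D id (\<lambda>_. {p. p permutes ?I})"
  let ?f = "\<lambda>p. restrict (g \<circ> p) ?I"
  let ?\<rho> = "\<lambda>\<pi>. \<lambda>k\<in>?D. ?f (\<pi> k)"
  let ?E = "{\<pi> \<in> ?P. \<forall>i<n. finprod G (\<lambda>k. g (\<pi> k i)) ?D = g i [^] d}"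
  have ge: "g \<in> extensional ?I" using g by (simp add: PiE_def)
  have gT: "g \<in> ?T" by (rule self_in_words[OF ge])
  define N where "N = card ?T"
  have N: "N > 0" unfolding N_def by (rule card_words_pos) auto
  have fp: "finite {p. p permutes ?I}" by (rule finite_permutations) simp
  have fP: "finite ?P" using fp by (intro finite_PiE_dflt) auto
  have into: "?f p \<in> ?T" if "p permutes ?I" for p
    using bij_betwE[OF words_permute[OF finite_lessThan that]] gT by blast
  have hitsfin: "finite (hits d ?I g)"
    unfolding hits_def by (rule finite_subset[OF Collect_restrict]) (auto intro!: finite_PiE finite_words)
  have mem: "\<pi> \<in> ?E \<longleftrightarrow> \<pi> \<in> ?P \<and> ?\<rho> \<pi> \<in> hits d ?I g" for \<pi>
  proof (cases "\<pi> \<in> ?P")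
    case True
    then have pk: "\<pi> k permutes ?I" if "k < d" for k using that by (auto simp: PiE_dflt_def)
    have "?\<rho> \<pi> \<in> PiE ?D (\<lambda>_. ?T)" using into pk by auto
    moreover have "finprod G (\<lambda>k. ?\<rho> \<pi> k i) ?D = finprod G (\<lambda>k. g (\<pi> k i)) ?D" if i: "i < n" for i
    proof (rule finprod_cong')
      show "(\<lambda>k. g (\<pi> k i)) \<in> ?D \<rightarrow> carrier G"
        using g permutes_in_image[OF pk, of _ i] i by auto
    qed (use i in auto)
    ultimately show ?thesis using True unfolding hits_def by auto
  qed simp
  have fiber: "card {\<pi> \<in> ?P. ?\<rho> \<pi> = ws} * N ^ d = fact n ^ d" if ws: "ws \<in> hits d ?I g" for ws
  proof -
    have wk: "ws k \<in> ?T" if "k < d" for k using ws that by (auto simp: hits_def)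
    have "{\<pi> \<in> ?P. ?\<rho> \<pi> = ws} = PiE_dflt ?D id (\<lambda>k. {p. p permutes ?I \<and> ?f p = ws k})"
    proof (intro equalityI subsetI)
      fix \<pi> assume h: "\<pi> \<in> {\<pi> \<in> ?P. ?\<rho> \<pi> = ws}"
      have "?f (\<pi> k) = ws k" if "k \<in> ?D" for k
      proof -
        have "?\<rho> \<pi> k = ws k" using h by blast
        then show ?thesis using that by (simp only: restrict_apply if_True)
      qed
      then show "\<pi> \<in> PiE_dflt ?D id (\<lambda>k. {p. p permutes ?I \<and> ?f p = ws k})"
        using h by (simp add: PiE_dflt_def)
    next
      fix \<pi> assume h: "\<pi> \<in> PiE_dflt ?D id (\<lambda>k. {p. p permutes ?I \<and> ?f p = ws k})"
      have "?\<rho> \<pi> = ws"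
      proof (rule extensionalityI[where A = ?D])
        show "ws \<in> extensional ?D" using ws by (auto simp: hits_def PiE_def)
        fix k assume k: "k \<in> ?D"
        then have "?f (\<pi> k) = ws k" using h by (simp add: PiE_dflt_def)
        then show "?\<rho> \<pi> k = ws k" using k by (simp only: restrict_apply if_True)
      qed simp
      then show "\<pi> \<in> {\<pi> \<in> ?P. ?\<rho> \<pi> = ws}" using h by (simp add: PiE_dflt_def)
    qed
    then have "card {\<pi> \<in> ?P. ?\<rho> \<pi> = ws} = (\<Prod>k\<in>?D. card {p. p permutes ?I \<and> ?f p = ws k})"
      using fp by (simp add: card_PiE_dflt)
    then have "card {\<pi> \<in> ?P. ?\<rho> \<pi> = ws} * N ^ d = (\<Prod>k\<in>?D. card {p. p permutes ?I \<and> ?f p = ws k} * N)"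
      by (simp add: prod.distrib)
    also have "\<dots> = (\<Prod>k\<in>?D. fact n)"
    proof (intro prod.cong refl)
      fix k assume "k \<in> ?D"
      then show "card {p. p permutes ?I \<and> ?f p = ws k} * N = fact n"
        using card_perms_to_word[OF finite_lessThan ge wk[of k]] by (simp add: N_def)
    qed
    finally show ?thesis by simp
  qed
  have "?E = {\<pi> \<in> ?P. ?\<rho> \<pi> \<in> hits d ?I g}" using mem by blast
  then have "card ?E = (\<Sum>ws\<in>hits d ?I g. card {\<pi> \<in> {\<pi> \<in> ?P. ?\<rho> \<pi> \<in> hits d ?I g}. ?\<rho> \<pi> = ws})"
    unfolding card_eq_sum
    by (simp only:) (rule sum.group[symmetric], use fP hitsfin in auto)
  also have "\<dots> = (\<Sum>ws\<in>hits d ?I g. card {\<pi> \<in> ?P. ?\<rho> \<pi> = ws})"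
    by (intro sum.cong refl arg_cong[where f = card]) auto
  finally have "card ?E * N ^ d = (\<Sum>ws\<in>hits d ?I g. fact n ^ d)"
    by (simp only: sum_distrib_right fiber cong: sum.cong)
  then have "real (card ?E * N ^ d) = real (card (hits d ?I g) * fact n ^ d)"
    by (simp only: sum_constant of_nat_id)
  then have "real (card ?E) * real N ^ d = real (card (hits d ?I g)) * fact n ^ d"
    by (simp only: of_nat_mult of_nat_power of_nat_fact)
  then show ?thesis using N by (simp add: hit_prob_def N_def field_simps)
qed

lemma expectation_Sur:
  assumes n: "n \<ge> 1"
  shows "measure_pmf.expectation (random_digraph d n) (\<lambda>D. real (card (Sur (sandpile_group d n D) G)))
    = (\<Sum>g\<in>generating n. hit_prob d {..<n} g)"
proof -
  let ?I = "{..<n}" and ?D = "{..<d}"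
  let ?P = "PiE_dflt ?D id (\<lambda>_. {p. p permutes ?I})"
  let ?R = "\<lambda>\<pi> g. \<forall>i<n. finprod G (\<lambda>k. g (\<pi> k i)) ?D = g i [^] d"
  have fp: "finite {p. p permutes ?I}" by (rule finite_permutations) simp
  have ne: "{p. p permutes ?I} \<noteq> {}" using permutes_id by blast
  have fP: "finite ?P" using fp by (intro finite_PiE_dflt) auto
  have cP: "card ?P = fact n ^ d" using fp by (simp add: card_PiE_dflt card_permutations[OF refl])
  then have "card ?P \<noteq> 0" by simp
  then have nP: "?P \<noteq> {}" by (rule contrapos_nn) (simp only: card.empty)
  have fG: "finite (generating n)"
    unfolding generating_def by (rule finite_subset[OF Collect_restrict finite_PiE_carrier])
  have rd: "random_digraph d n = map_pmf (perm_digraph d n) (pmf_of_set ?P)"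
    unfolding random_digraph_def atLeast0LessThan using Pi_pmf_of_set[of ?D "\<lambda>_. {p. p permutes ?I}" id] fp ne by simp
  have "measure_pmf.expectation (random_digraph d n) (\<lambda>D. real (card (Sur (sandpile_group d n D) G)))
    = (\<Sum>\<pi>\<in>?P. real (card (Sur (sandpile_group d n (perm_digraph d n \<pi>)) G))) / card ?P"
    unfolding rd by (simp add: integral_pmf_of_set[OF nP fP])
  also have "(\<Sum>\<pi>\<in>?P. real (card (Sur (sandpile_group d n (perm_digraph d n \<pi>)) G)))
    = (\<Sum>\<pi>\<in>?P. \<Sum>g\<in>generating n. if ?R \<pi> g then 1 else 0)"
  proof (intro sum.cong refl)
    fix \<pi> assume "\<pi> \<in> ?P"
    then have "\<pi> k permutes ?I" if "k < d" for k using that by (auto simp: PiE_dflt_def)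
    from card_Sur_sandpile_group[OF n this]
    show "real (card (Sur (sandpile_group d n (perm_digraph d n \<pi>)) G)) = (\<Sum>g\<in>generating n. if ?R \<pi> g then 1 else 0)"
      using fG by (simp add: sum.If_cases Int_def)
  qed
  also have "\<dots> = (\<Sum>g\<in>generating n. \<Sum>\<pi>\<in>?P. if ?R \<pi> g then 1 else 0)" by (rule sum.swap)
  also have "\<dots> = (\<Sum>g\<in>generating n. hit_prob d ?I g * fact n ^ d)"
  proof (intro sum.cong refl)
    fix g assume "g \<in> generating n"
    then have g: "g \<in> PiE ?I (\<lambda>_. carrier G)" by (simp add: generating_def)
    have "(\<Sum>\<pi>\<in>?P. if ?R \<pi> g then 1 else 0) = real (card {\<pi> \<in> ?P. ?R \<pi> g})"
      using fP by (simp add: sum.If_cases Int_def)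
    then show "(\<Sum>\<pi>\<in>?P. if ?R \<pi> g then 1 else 0) = hit_prob d ?I g * fact n ^ d"
      using card_hitting_permutations[OF g, of d] by simp
  qed
  finally show ?thesis unfolding cP sum_distrib_right[symmetric] by simp
qed

end

section \<open>The limit of the expectation\<close>

context finite_comm_group
begin

lemma hit_prob_nonneg: "hit_prob d I g \<ge> 0"
  by (simp add: hit_prob_def)

lemma rooted_words_eq:
  fixes n :: nat
  assumes n: "n \<ge> 1"
  shows "{g \<in> PiE {..<n} (\<lambda>_. carrier G). g (n - 1) = \<one>} = PiE {..<n} (\<lambda>i. if i = n - 1 then {\<one>} else carrier G)"
proof (intro equalityI subsetI)
  fix g assume g: "g \<in> {g \<in> PiE {..<n} (\<lambda>_. carrier G). g (n - 1) = \<one>}"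
  show "g \<in> PiE {..<n} (\<lambda>i. if i = n - 1 then {\<one>} else carrier G)"
  proof (rule PiE_I)
    fix i assume "i \<in> {..<n}"
    then show "g i \<in> (if i = n - 1 then {\<one>} else carrier G)" using g by (cases "i = n - 1") auto
  qed (use g in \<open>auto simp: PiE_def extensional_def\<close>)
next
  fix g assume h: "g \<in> PiE {..<n} (\<lambda>i. if i = n - 1 then {\<one>} else carrier G)"
  have g1: "g (n - 1) = \<one>" using PiE_mem[OF h, of "n - 1"] n by simp
  have "g \<in> PiE {..<n} (\<lambda>_. carrier G)"
  proof (rule PiE_I)
    fix i assume i: "i \<in> {..<n}"
    show "g i \<in> carrier G" using PiE_mem[OF h i] g1 by (cases "i = n - 1") auto
  qed (use h in \<open>auto simp: PiE_def extensional_def\<close>)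
  with g1 show "g \<in> {g \<in> PiE {..<n} (\<lambda>_. carrier G). g (n - 1) = \<one>}" by simp
qed

lemma card_rooted_words:
  fixes n :: nat
  assumes n: "n \<ge> 1"
  shows "card {g \<in> PiE {..<n} (\<lambda>_. carrier G). g (n - 1) = \<one>} = order G ^ (n - 1)"
proof -
  have "card {g \<in> PiE {..<n} (\<lambda>_. carrier G). g (n - 1) = \<one>} = (\<Prod>i<n. card (if i = n - 1 then {\<one>} else carrier G))"
    unfolding rooted_words_eq[OF n] by (rule card_PiE) simp
  also have "\<dots> = (\<Prod>i\<in>{..<n} - {n - 1}. card (if i = n - 1 then {\<one>} else carrier G))"
    by (subst prod.remove[of _ "n - 1"]) (use n in auto)
  also have "\<dots> = (\<Prod>i\<in>{..<n} - {n - 1}. order G)"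
    by (rule prod.cong) (auto simp: order_def)
  also have "\<dots> = order G ^ (n - 1)" using n by simp
  finally show ?thesis .
qed

text \<open>
  Orthogonality: for two different positions, at least one of them is not the last one and its
  letter is free, so the mixed term vanishes.
\<close>

lemma char_sum_second_moment:
  assumes n: "n \<ge> 1" and \<xi>: "\<xi> \<in> chars G" "\<xi> \<noteq> triv_char G"
  shows "(\<Sum>g\<in>{g \<in> PiE {..<n} (\<lambda>_. carrier G). g (n - 1) = \<one>}. norm (\<Sum>i<n. \<xi> (g i)) ^ 2) = n * real (order G) ^ (n - 1)"
proof -
  let ?F = "\<lambda>i. if i = n - 1 then {\<one>} else carrier G"
  let ?B = "{g \<in> PiE {..<n} (\<lambda>_. carrier G). g (n - 1) = \<one>}"
  have B: "?B = PiE {..<n} ?F" by (rule rooted_words_eq[OF n])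
  have cB: "card ?B = order G ^ (n - 1)" by (rule card_rooted_words[OF n])
  have gc: "g i \<in> carrier G" if "g \<in> ?B" "i < n" for g i using that by auto
  have off: "(\<Sum>g\<in>?B. \<xi> (g i) * cnj (\<xi> (g j))) = 0" if ij: "i < n" "j < n" "i \<noteq> j" for i j
  proof -
    let ?h = "\<lambda>l v. (if l = i then \<xi> v else 1) * (if l = j then cnj (\<xi> v) else 1)"
    have "(\<Sum>g\<in>?B. \<xi> (g i) * cnj (\<xi> (g j))) = (\<Sum>g\<in>PiE {..<n} ?F. \<Prod>l<n. ?h l (g l))"
      unfolding B using ij by (intro sum.cong refl) (simp add: prod.distrib)
    also have "\<dots> = (\<Prod>l<n. \<Sum>v\<in>?F l. ?h l v)"
      by (rule sum_PiE_prod) (use finite_carrier in auto)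
    also have "\<dots> = 0"
    proof (cases "i = n - 1")
      case False
      have "(\<Sum>v\<in>?F i. ?h i v) = 0" using False ij sum_char[OF \<xi>] by simp
      then have "\<exists>l\<in>{..<n}. (\<Sum>v\<in>?F l. ?h l v) = 0" by (rule bexI) (use ij in simp)
      then show ?thesis by (rule prod_zero[OF finite_lessThan])
    next
      case True
      then have j: "j \<noteq> n - 1" using ij by simp
      have "(\<Sum>v\<in>?F j. ?h j v) = cnj (\<Sum>v\<in>carrier G. \<xi> v)" using j ij by simp
      also have "\<dots> = 0" using sum_char[OF \<xi>] by simp
      finally have "\<exists>l\<in>{..<n}. (\<Sum>v\<in>?F l. ?h l v) = 0" by (rule bexI) (use ij in simp)
      then show ?thesis by (rule prod_zero[OF finite_lessThan])
    qed
    finally show ?thesis .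
  qed
  have "complex_of_real (\<Sum>g\<in>?B. norm (\<Sum>i<n. \<xi> (g i)) ^ 2) = (\<Sum>g\<in>?B. \<Sum>i<n. \<Sum>j<n. \<xi> (g i) * cnj (\<xi> (g j)))"
    by (simp only: of_real_sum complex_norm_square cnj_sum sum_product)
  also have "\<dots> = (\<Sum>i<n. \<Sum>j<n. \<Sum>g\<in>?B. \<xi> (g i) * cnj (\<xi> (g j)))"
    by (subst sum.swap) (intro sum.cong refl sum.swap)
  also have "\<dots> = (\<Sum>i<n. \<Sum>j<n. if i = j then of_nat (card ?B) else 0)"
  proof (intro sum.cong refl)
    fix i j assume "i \<in> {..<n}" "j \<in> {..<n}"
    then show "(\<Sum>g\<in>?B. \<xi> (g i) * cnj (\<xi> (g j))) = (if i = j then of_nat (card ?B) else 0)"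
      using off[of i j] char_cnj_self[OF \<xi>(1) gc] by simp
  qed
  also have "\<dots> = (\<Sum>i<n. of_nat (card ?B))" by simp
  also have "\<dots> = of_nat n * of_nat (order G ^ (n - 1))" by (simp only: sum_constant card_lessThan cB)
  also have "\<dots> = complex_of_real (n * real (order G) ^ (n - 1))" by simp
  finally show "(\<Sum>g\<in>?B. norm (\<Sum>i<n. \<xi> (g i)) ^ 2) = n * real (order G) ^ (n - 1)"
    by (simp only: of_real_eq_iff)
qed

text \<open>
  The bound \<open>2 n ^ (3/5)\<close> is \<open>2 \<delta> n\<close> for \<open>\<delta> = n ^
  (-2/5)\<close>. This \<open>\<delta>\<close> is large enough for \<open>n \<delta> ^ 2\<close>
  to dominate every multiple of \<open>log n\<close>, and small enough for flat types to have
  small Fourier coefficients.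
\<close>

definition flat :: "nat \<Rightarrow> (nat \<Rightarrow> 'a) set"
  where "flat n = {g \<in> PiE {..<n} (\<lambda>_. carrier G). g (n - 1) = \<one> \<and>
    (\<forall>\<xi>\<in>chars G. \<xi> \<noteq> triv_char G \<longrightarrow> norm (\<Sum>i<n. \<xi> (g i)) \<le> 2 * real n powr (3/5))}"

text \<open>
  By Chebyshev, almost all words that are normalised at the last position are flat.
\<close>

lemma card_flat_limit: "(\<lambda>n. card (flat n) / real (order G) ^ (n - 1)) \<longlonglongrightarrow> 1"
proof (rule tendsto_sandwich)
  let ?k = "real (order G)"
  have k: "?k > 0" using order_pos by simp
  let ?B = "\<lambda>n. {g \<in> PiE {..<n} (\<lambda>_. carrier G). g (n - 1) = \<one>}"
  have ge1: "\<forall>\<^sub>F n in sequentially. n \<ge> (1::nat)" by (rule eventually_ge_at_top)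
  have fB: "finite (?B n)" for n :: nat by (rule finite_subset[OF Collect_restrict finite_PiE_carrier])
  have cB: "card (?B n) = order G ^ (n - 1)" if "n \<ge> 1" for n :: nat by (rule card_rooted_words[OF that])
  show "\<forall>\<^sub>F n in sequentially. card (flat n) / ?k ^ (n - 1) \<le> 1"
    using ge1
  proof eventually_elim
    case (elim n)
    have "card (flat n) \<le> card (?B n)" by (rule card_mono[OF fB]) (auto simp: flat_def)
    then have "real (card (flat n)) \<le> ?k ^ (n - 1)" unfolding cB[OF elim] by (metis of_nat_le_iff of_nat_power)
    then show ?case using k by simp
  qed
  show "\<forall>\<^sub>F n in sequentially. 1 - ?k * (real n powr (-1/5)) \<le> card (flat n) / ?k ^ (n - 1)"
    using ge1
  proof eventually_elim
    case (elim n)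
    let ?t = "2 * real n powr (3/5)"
    let ?X = "\<lambda>\<xi>. {g \<in> ?B n. norm (\<Sum>i<n. \<xi> (g i)) > ?t}"
    have n0: "real n > 0" using elim by simp
    have X: "real (card (?X \<xi>)) \<le> real n powr (-1/5) * ?k ^ (n - 1)" if \<xi>: "\<xi> \<in> chars G" "\<xi> \<noteq> triv_char G" for \<xi>
    proof -
      have "card (?X \<xi>) * ?t ^ 2 = (\<Sum>g\<in>?X \<xi>. ?t ^ 2)" by simp
      also have "\<dots> \<le> (\<Sum>g\<in>?X \<xi>. norm (\<Sum>i<n. \<xi> (g i)) ^ 2)" by (intro sum_mono power_mono) auto
      also have "\<dots> \<le> (\<Sum>g\<in>?B n. norm (\<Sum>i<n. \<xi> (g i)) ^ 2)" by (rule sum_mono2[OF fB]) auto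
      also have "\<dots> = n * ?k ^ (n - 1)" by (rule char_sum_second_moment[OF elim \<xi>])
      finally have "card (?X \<xi>) * ?t ^ 2 \<le> real n * ?k ^ (n - 1)" .
      also have "\<dots> \<le> (real n powr (-1/5) * ?k ^ (n - 1)) * ?t ^ 2"
      proof -
        have e: "real n powr (-1/5) * (real n powr (3/5) * real n powr (3/5)) = real n"
          unfolding powr_add[symmetric] using n0 by simp
        have "(real n powr (-1/5) * ?k ^ (n - 1)) * ?t ^ 2
          = 4 * ((real n powr (-1/5) * (real n powr (3/5) * real n powr (3/5))) * ?k ^ (n - 1))"
          by (simp add: power2_eq_square)
        also have "\<dots> = 4 * (real n * ?k ^ (n - 1))" by (simp only: e)
        finally show ?thesis using k n0 by simp
      qed
      finally show ?thesis by (rule mult_right_le_imp_le) (use n0 in simp)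
    qed
    have sub: "?B n \<subseteq> flat n \<union> (\<Union>\<xi>\<in>chars G - {triv_char G}. ?X \<xi>)"
      by (auto simp: flat_def not_le)
    have fX: "finite (?X \<xi>)" for \<xi> by (rule finite_subset[OF Collect_restrict fB])
    have fU: "finite (\<Union>\<xi>\<in>chars G - {triv_char G}. ?X \<xi>)"
      by (intro finite_UN_I finite_Diff finite_chars fX)
    have ff: "finite (flat n)" by (rule finite_subset[OF _ fB[of n]]) (auto simp: flat_def)
    have "order G ^ (n - 1) = card (?B n)" by (rule cB[OF elim, symmetric])
    also have "\<dots> \<le> card (flat n) + card (\<Union>\<xi>\<in>chars G - {triv_char G}. ?X \<xi>)"
      by (rule order_trans[OF card_mono[OF _ sub] card_Un_le]) (use ff fU in auto)
    also have "\<dots> \<le> card (flat n) + (\<Sum>\<xi>\<in>chars G - {triv_char G}. card (?X \<xi>))"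
      by (intro add_left_mono card_UN_le) (use finite_chars in auto)
    finally have "real (order G ^ (n - 1)) \<le> real (card (flat n) + (\<Sum>\<xi>\<in>chars G - {triv_char G}. card (?X \<xi>)))"
      by (rule of_nat_mono)
    then have "?k ^ (n - 1) \<le> real (card (flat n)) + (\<Sum>\<xi>\<in>chars G - {triv_char G}. real (card (?X \<xi>)))"
      by (simp only: of_nat_add of_nat_sum of_nat_power)
    also have "(\<Sum>\<xi>\<in>chars G - {triv_char G}. real (card (?X \<xi>))) \<le> (\<Sum>\<xi>\<in>chars G - {triv_char G}. real n powr (-1/5) * ?k ^ (n - 1))"
      by (rule sum_mono, rule X) auto
    also have "\<dots> \<le> ?k * (real n powr (-1/5) * ?k ^ (n - 1))"
      unfolding sum_constant
      by (rule mult_right_mono) (use finite_chars triv_char_in in \<open>simp_all add: card_Diff_singleton card_chars order_def\<close>)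
    finally have fin: "?k ^ (n - 1) \<le> real (card (flat n)) + ?k * (real n powr (-1/5) * ?k ^ (n - 1))" by simp
    have kp: "?k ^ (n - 1) > 0" using k by simp
    have "(1 - ?k * (real n powr (-1/5))) * ?k ^ (n - 1) \<le> real (card (flat n))" using fin by (simp add: algebra_simps)
    then show ?case using kp by (simp add: pos_le_divide_eq)
  qed
  show "(\<lambda>n. 1 - ?k * (real n powr (-1/5))) \<longlonglongrightarrow> 1" using k by real_asymp
qed simp

text \<open>
  Each flat word contributes \<open>order G ^ (1 - n)\<close> up to a relative error that tends to
  zero, uniformly in the word.
\<close>

lemma flat_sum_limit:
  assumes d: "d \<ge> 3"
  shows "(\<lambda>n. \<Sum>g\<in>flat n. hit_prob d {..<n} g) \<longlonglongrightarrow> 1"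
proof -
  let ?k = "real (order G)"
  have k: "?k > 0" "?k \<ge> 1" using order_pos by auto
  have "(\<lambda>n. (\<Sum>g\<in>flat n. hit_prob d {..<n} g) - card (flat n) / ?k ^ (n - 1)) \<longlonglongrightarrow> 0"
  proof (rule tendstoI)
    fix e :: real assume e: "e > 0"
    have e2: "e / 2 > 0" using e by simp
    from ft_cube_sum_eventually_small[OF zero_less_numeral[of "num.Bit0 num.One"] e2] eventually_ge_at_top[of "1::nat"]
    show "\<forall>\<^sub>F n in sequentially. dist ((\<Sum>g\<in>flat n. hit_prob d {..<n} g) - card (flat n) / ?k ^ (n - 1)) 0 < e"
    proof eventually_elim
      case (elim n)
      have n: "n \<ge> 1" using elim by simp
      have kn: "?k ^ n = ?k * ?k ^ (n - 1)" using n by (cases n) auto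
      have kp: "?k ^ n > 0" "?k ^ (n - 1) > 0" using k by auto
      have fB: "finite {g \<in> PiE {..<n} (\<lambda>_. carrier G). g (n - 1) = \<one>}" by (rule finite_subset[OF Collect_restrict finite_PiE_carrier])
      have each: "\<bar>hit_prob d {..<n} g - 1 / ?k ^ (n - 1)\<bar> \<le> (e / 2) / ?k ^ n" if g: "g \<in> flat n" for g
      proof -
        have gP: "g \<in> PiE {..<n} (\<lambda>_. carrier G)" using g by (simp add: flat_def)
        let ?M = "image_mset g (mset_set {..<n})"
        have gT: "g \<in> words {..<n} ?M" by (rule self_in_words) (use gP in \<open>simp add: PiE_iff\<close>)
        have "\<bar>hit_prob d {..<n} g * ?k ^ card {..<n} - order G\<bar> \<le> e / 2"
        proof (rule hit_prob_flat[OF _ _ gP d])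
          have "size ?M = n" "set_mset ?M \<subseteq> carrier G" using gP by auto
          moreover have "norm (\<Sum>v\<in>#?M. \<xi> v) \<le> 2 * real n powr (3/5)" if "\<xi> \<in> chars G" "\<xi> \<noteq> triv_char G" for \<xi>
            using g that words_sum_mset[OF gT, of \<xi>] by (auto simp: flat_def)
          ultimately show "(\<Sum>\<psi>\<in>{\<psi> \<in> PiE {..<n} (\<lambda>_. chars G). \<forall>\<xi>\<in>chars G. \<exists>i\<in>{..<n}. \<psi> i \<noteq> \<xi>}. norm (ft {..<n} ?M \<psi>) ^ 3) \<le> e / 2"
            using elim(1)[rule_format, of "{..<n}" ?M] by simp
        qed (use n in \<open>auto simp: lessThan_empty_iff\<close>)
        moreover have "(hit_prob d {..<n} g - 1 / ?k ^ (n - 1)) * ?k ^ n = hit_prob d {..<n} g * ?k ^ card {..<n} - order G"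
        proof -
          have q: "1 / ?k ^ (n - 1) * ?k ^ n = ?k" using kp(2) unfolding kn by simp
          show ?thesis unfolding left_diff_distrib q card_lessThan ..
        qed
        ultimately have "\<bar>(hit_prob d {..<n} g - 1 / ?k ^ (n - 1)) * ?k ^ n\<bar> \<le> e / 2" by simp
        then show ?thesis using kp by (simp add: abs_mult pos_le_divide_eq)
      qed
      have "\<bar>(\<Sum>g\<in>flat n. hit_prob d {..<n} g) - card (flat n) / ?k ^ (n - 1)\<bar> = \<bar>\<Sum>g\<in>flat n. hit_prob d {..<n} g - 1 / ?k ^ (n - 1)\<bar>"
        by (simp add: sum_subtractf)
      also have "\<dots> \<le> (\<Sum>g\<in>flat n. (e / 2) / ?k ^ n)"
        by (rule order_trans[OF sum_abs sum_mono[OF each]])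
      also have "\<dots> = real (card (flat n)) * ((e / 2) / ?k ^ n)" by simp
      also have "\<dots> \<le> ?k ^ n * ((e / 2) / ?k ^ n)"
      proof (rule mult_right_mono)
        have "card (flat n) \<le> card (PiE {..<n} (\<lambda>_. carrier G))"
          by (rule card_mono[OF finite_PiE_carrier]) (auto simp: flat_def)
        also have "\<dots> = order G ^ n" by (simp add: card_PiE order_def)
        finally show "real (card (flat n)) \<le> ?k ^ n" by (metis of_nat_le_iff of_nat_power)
      qed (use e kp in simp)
      also have "\<dots> = e / 2" using kp by simp
      finally show ?case using e by (simp add: dist_real_def)
    qed
  qed
  from tendsto_add[OF this card_flat_limit] show ?thesis by simp
qed

text \<open>
  The frequency of a letter can be recovered from the character sums by Fourier inversion, so a
  flat word uses every letter.
\<close>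

lemma flat_generating: "\<forall>\<^sub>F n in sequentially. flat n \<subseteq> generating n"
proof -
  let ?k = "real (order G)"
  have k: "?k > 0" using order_pos by simp
  have "\<forall>\<^sub>F n in sequentially. ?k * (2 * real n powr (3/5)) < real n" using k by real_asymp
  then show ?thesis
  proof eventually_elim
    case (elim n)
    show ?case
    proof
      fix g assume g: "g \<in> flat n"
      have gc: "g i \<in> carrier G" if "i < n" for i using g that by (auto simp: flat_def)
      have surj: "v \<in> g ` {..<n}" if v: "v \<in> carrier G" for v
      proof (rule ccontr)
        assume h: "v \<notin> g ` {..<n}"
        have "(\<Sum>\<xi>\<in>chars G. \<xi> (inv v) * (\<Sum>i<n. \<xi> (g i))) = (\<Sum>i<n. \<Sum>\<xi>\<in>chars G. \<xi> (g i \<otimes> inv v))"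
          unfolding sum_distrib_left
          by (subst sum.swap) (intro sum.cong refl, use gc v in \<open>simp add: char_mult mult.commute\<close>)
        also have "\<dots> = 0"
        proof (rule sum.neutral, rule ballI)
          fix i assume i: "i \<in> {..<n}"
          have "g i \<otimes> inv v \<noteq> \<one>"
          proof
            assume "g i \<otimes> inv v = \<one>"
            then have "g i = v" using gc[of i] i v by (metis inv_equality inv_inv inv_closed lessThan_iff)
            then show False using h i by blast
          qed
          then show "(\<Sum>\<xi>\<in>chars G. \<xi> (g i \<otimes> inv v)) = 0" using gc[of i] i v by (simp add: sum_over_chars)
        qed
        finally have z: "(\<Sum>\<xi>\<in>chars G. \<xi> (inv v) * (\<Sum>i<n. \<xi> (g i))) = 0" .
        have "(\<Sum>\<xi>\<in>chars G. \<xi> (inv v) * (\<Sum>i<n. \<xi> (g i))) = triv_char G (inv v) * (\<Sum>i<n. triv_char G (g i))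
            + (\<Sum>\<xi>\<in>chars G - {triv_char G}. \<xi> (inv v) * (\<Sum>i<n. \<xi> (g i)))"
          by (rule sum.remove[OF finite_chars triv_char_in])
        also have "triv_char G (inv v) * (\<Sum>i<n. triv_char G (g i)) = of_nat n" using gc v by (simp add: triv_char_def)
        finally have "complex_of_real n = - (\<Sum>\<xi>\<in>chars G - {triv_char G}. \<xi> (inv v) * (\<Sum>i<n. \<xi> (g i)))"
          using z by (simp add: eq_neg_iff_add_eq_0)
        then have "norm (complex_of_real n) = norm (- (\<Sum>\<xi>\<in>chars G - {triv_char G}. \<xi> (inv v) * (\<Sum>i<n. \<xi> (g i))))"
          by (rule arg_cong)
        also have "\<dots> = norm (\<Sum>\<xi>\<in>chars G - {triv_char G}. \<xi> (inv v) * (\<Sum>i<n. \<xi> (g i)))"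
          by (rule norm_minus_cancel)
        also have "\<dots> \<le> (\<Sum>\<xi>\<in>chars G - {triv_char G}. 2 * real n powr (3/5))"
        proof (rule sum_norm_le)
          fix \<xi> assume x: "\<xi> \<in> chars G - {triv_char G}"
          then have "norm (\<xi> (inv v)) = 1" using v by (intro char_norm) auto
          then show "norm (\<xi> (inv v) * (\<Sum>i<n. \<xi> (g i))) \<le> 2 * real n powr (3/5)"
            using g x by (simp add: norm_mult flat_def)
        qed
        also have "\<dots> \<le> ?k * (2 * real n powr (3/5))"
          unfolding sum_constant
          by (rule mult_right_mono) (use finite_chars triv_char_in in \<open>simp_all add: card_Diff_singleton card_chars order_def\<close>)
        finally show False using elim by simp
      qed
      have "carrier G \<subseteq> generate G (g ` {..<n})" using surj generate.incl[of _ "g ` {..<n}" G] by blast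
      moreover have "generate G (g ` {..<n}) \<subseteq> carrier G" by (rule generate_incl) (use gc in auto)
      ultimately show "g \<in> generating n" using g by (simp add: flat_def generating_def)
    qed
  qed
qed

definition intermediate :: "nat \<Rightarrow> (nat \<Rightarrow> 'a) set"
  where "intermediate n = {g \<in> PiE {..<n} (\<lambda>_. carrier G). \<exists>\<xi>\<in>chars G.
    norm (\<Sum>i<n. \<xi> (g i)) / n - (norm (\<Sum>i<n. \<xi> (g i)) / n) ^ 2 \<ge> real n powr (-2/5)}"

text \<open>
  Polynomially many types, each with a contribution of at most \<open>exp (- n ^ (1/5) /
  4)\<close> up to a polynomial factor.
\<close>

lemma intermediate_sum_limit:
  assumes d: "d \<ge> 3"
  shows "(\<lambda>n. \<Sum>g\<in>intermediate n. hit_prob d {..<n} g) \<longlonglongrightarrow> 0"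
proof (rule tendsto_sandwich[where f = "\<lambda>_. 0"])
  let ?k = "real (order G)"
  have k: "?k > 0" using order_pos by simp
  show "(\<lambda>n. (real n + 1) powr (3 * ?k) * exp (- (real n powr (1/5)) / 4)) \<longlonglongrightarrow> 0" using k by real_asymp
  show "\<forall>\<^sub>F n in sequentially. 0 \<le> (\<Sum>g\<in>intermediate n. hit_prob d {..<n} g)"
    by (simp add: sum_nonneg hit_prob_nonneg)
  show "\<forall>\<^sub>F n in sequentially. (\<Sum>g\<in>intermediate n. hit_prob d {..<n} g) \<le> (real n + 1) powr (3 * ?k) * exp (- (real n powr (1/5)) / 4)"
    using eventually_ge_at_top[of "1::nat"]
  proof eventually_elim
    case (elim n)
    let ?I = "{..<n}" and ?\<delta> = "real n powr (-2/5)"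
    let ?a = "\<lambda>M \<xi>. norm (\<Sum>v\<in>#M. \<xi> v) / n"
    let ?A = "{M. set_mset M \<subseteq> carrier G \<and> size M = n}"
    let ?B = "{M \<in> ?A. \<exists>\<xi>\<in>chars G. ?a M \<xi> - ?a M \<xi> ^ 2 \<ge> ?\<delta>}"
    have fA: "finite ?A" "card ?A \<le> (n + 1) ^ order G" using card_types[OF finite_carrier, of n] by (auto simp: order_def)
    have fB: "finite ?B" by (rule finite_subset[OF Collect_restrict fA(1)])
    have fU: "finite (\<Union>M\<in>?B. words ?I M)" by (rule finite_UN_I[OF fB]) (rule finite_words[OF finite_lessThan])
    have "intermediate n \<subseteq> (\<Union>M\<in>?B. words ?I M)"
    proof
      fix g assume g: "g \<in> intermediate n"
      let ?M = "image_mset g (mset_set ?I)"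
      have gP: "g \<in> PiE ?I (\<lambda>_. carrier G)" using g by (simp add: intermediate_def)
      have gT: "g \<in> words ?I ?M" by (rule self_in_words) (use gP in \<open>simp add: PiE_iff\<close>)
      have "?M \<in> ?A" using gP by auto
      moreover have "\<exists>\<xi>\<in>chars G. ?a ?M \<xi> - ?a ?M \<xi> ^ 2 \<ge> ?\<delta>"
      proof -
        have "(\<Sum>v\<in>#?M. \<xi> v) = (\<Sum>i<n. \<xi> (g i))" for \<xi> :: "'a \<Rightarrow> complex"
          by (rule words_sum_mset[OF gT, symmetric])
        then show ?thesis using g unfolding intermediate_def by (simp only: mem_Collect_eq)
      qed
      ultimately show "g \<in> (\<Union>M\<in>?B. words ?I M)" using gT by blast
    qed
    then have "(\<Sum>g\<in>intermediate n. hit_prob d ?I g) \<le> (\<Sum>g\<in>(\<Union>M\<in>?B. words ?I M). hit_prob d ?I g)"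
      by (rule sum_mono2[OF fU]) (rule hit_prob_nonneg)
    also have "\<dots> \<le> (\<Sum>M\<in>?B. \<Sum>g\<in>words ?I M. hit_prob d ?I g)"
      by (rule sum_UN_le[OF fB]) (rule finite_words[OF finite_lessThan], rule hit_prob_nonneg)
    also have "\<dots> \<le> (\<Sum>M\<in>?B. (real n + 1) ^ (2 * order G) * exp (- (real n powr (1/5)) / 4))"
    proof (rule sum_mono)
      fix M assume M: "M \<in> ?B"
      then obtain \<xi> where \<xi>: "\<xi> \<in> chars G" "?\<delta> \<le> ?a M \<xi> - ?a M \<xi> ^ 2" by blast
      have "(\<Sum>g\<in>words ?I M. hit_prob d ?I g) \<le> (real (card ?I) + 1) ^ (2 * order G) * exp (- real (card ?I) * (?a M \<xi> - ?a M \<xi> ^ 2) ^ 2 / 4)"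
        by (rule atypical_type_sum[OF _ _ _ _ \<xi>(1) d]) (use M elim in \<open>auto simp: lessThan_empty_iff\<close>)
      also have "\<dots> \<le> (real n + 1) ^ (2 * order G) * exp (- (real n powr (1/5)) / 4)"
      proof -
        have "real n powr (1/5) = real n * (?\<delta> * ?\<delta>)"
        proof -
          have "real n * (?\<delta> * ?\<delta>) = real n powr 1 * (?\<delta> * ?\<delta>)" using elim by simp
          also have "\<dots> = real n powr (1/5)" unfolding powr_add[symmetric] by simp
          finally show ?thesis by simp
        qed
        also have "\<dots> \<le> real n * ((?a M \<xi> - ?a M \<xi> ^ 2) * (?a M \<xi> - ?a M \<xi> ^ 2))"
          by (intro mult_left_mono mult_mono \<xi>(2) order_trans[OF powr_ge_zero \<xi>(2)] powr_ge_zero of_nat_0_le_iff)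
        finally have "- real (card ?I) * (?a M \<xi> - ?a M \<xi> ^ 2) ^ 2 / 4 \<le> - (real n powr (1/5)) / 4"
          by (simp add: power2_eq_square)
        then show ?thesis by (intro mult_mono) auto
      qed
      finally show "(\<Sum>g\<in>words ?I M. hit_prob d ?I g) \<le> (real n + 1) ^ (2 * order G) * exp (- (real n powr (1/5)) / 4)" .
    qed
    also have "\<dots> = real (card ?B) * ((real n + 1) ^ (2 * order G) * exp (- (real n powr (1/5)) / 4))" by simp
    also have "\<dots> \<le> (real n + 1) ^ order G * ((real n + 1) ^ (2 * order G) * exp (- (real n powr (1/5)) / 4))"
    proof (rule mult_right_mono)
      have "card ?B \<le> card ?A" by (rule card_mono[OF fA(1)]) auto
      then have "card ?B \<le> (n + 1) ^ order G" using fA(2) by linarith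
      then have "real (card ?B) \<le> real ((n + 1) ^ order G)" by (rule of_nat_mono)
      then show "real (card ?B) \<le> (real n + 1) ^ order G" by (simp only: of_nat_power of_nat_add of_nat_1)
    qed simp
    also have "\<dots> = (real n + 1) ^ (3 * order G) * exp (- (real n powr (1/5)) / 4)"
      unfolding mult.assoc[symmetric] power_add[symmetric] by simp
    also have "(real n + 1) ^ (3 * order G) = (real n + 1) powr (3 * ?k)"
      by (simp add: powr_realpow[symmetric])
    finally show ?case .
  qed
qed simp

definition near_coset :: "real \<Rightarrow> nat \<Rightarrow> 'a set \<Rightarrow> nat \<Rightarrow> (nat \<Rightarrow> 'a) set"
  where "near_coset C n W m = {g \<in> PiE {..<n} (\<lambda>_. carrier G). card {i \<in> {..<n}. g i \<notin> W} = m \<and>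
    (\<forall>\<psi>\<in>chars (G\<lparr>carrier := W\<rparr>). \<psi> \<noteq> triv_char (G\<lparr>carrier := W\<rparr>) \<longrightarrow>
      norm (\<Sum>i\<in>{i \<in> {..<n}. g i \<in> W}. \<psi> (g i)) \<le> (C + 2) * real n powr (3/5))}"

text \<open>
  The letters in \<open>W\<close> occupy more than half of the positions, so flatness with respect
  to \<open>n\<close> is flatness with respect to their number up to a factor of 2.
\<close>

lemma near_coset_sum_bound:
  assumes d: "d \<ge> 3" and C: "C > 0" and W: "subgroup W G"
  shows "\<forall>\<^sub>F n in sequentially. \<forall>m\<ge>1. real m \<le> C * real n powr (3/5) \<longrightarrow>
    (\<Sum>g\<in>near_coset C n W m. hit_prob d {..<n} g)
      \<le> d * (order G + 1) * (order G * (exp 1 * d) ^ d * sqrt (C * real n powr (-2/5))) ^ m"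
proof -
  interpret Ws: finite_comm_group "G\<lparr>carrier := W\<rparr>" by (rule sub_finite_comm_group[OF W])
  have C2: "2 * (C + 2) > 0" using C by simp
  obtain N0 where N0: "\<And>N. N \<ge> N0 \<Longrightarrow> \<forall>I M. finite (I :: nat set) \<longrightarrow> card I = N \<longrightarrow> size M = N \<longrightarrow> set_mset M \<subseteq> carrier (G\<lparr>carrier := W\<rparr>) \<longrightarrow>
    (\<forall>\<xi>\<in>chars (G\<lparr>carrier := W\<rparr>). \<xi> \<noteq> triv_char (G\<lparr>carrier := W\<rparr>) \<longrightarrow> norm (\<Sum>v\<in>#M. \<xi> v) \<le> (2 * (C + 2)) * real N powr (3/5)) \<longrightarrow>
    (\<Sum>\<psi>\<in>{\<psi> \<in> PiE I (\<lambda>_. chars (G\<lparr>carrier := W\<rparr>)). \<forall>\<xi>\<in>chars (G\<lparr>carrier := W\<rparr>). \<exists>i\<in>I. \<psi> i \<noteq> \<xi>}. norm (ft I M \<psi>) ^ 3) \<le> 1"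
    using Ws.ft_cube_sum_eventually_small[OF C2, of 1] unfolding eventually_sequentially by auto
  have "\<forall>\<^sub>F n in sequentially. (2 + real d) * (C * real n powr (3/5)) \<le> real n" using C by real_asymp
  then show ?thesis using eventually_ge_at_top[of "2 * N0 + 1"]
  proof eventually_elim
    case (elim n)
    show ?case
    proof (intro allI impI)
      fix m assume m: "m \<ge> 1" and mC: "real m \<le> C * real n powr (3/5)"
      have n0: "real n > 0" using elim by simp
      have "(2 + real d) * real m \<le> (2 + real d) * (C * real n powr (3/5))" using mC by (intro mult_left_mono) auto
      then have "(2 + real d) * real m \<le> real n" using elim by linarith
      then have "real ((2 + d) * m) \<le> real n" by (simp only: of_nat_mult of_nat_add of_nat_numeral)
      then have mn: "(2 + d) * m \<le> n" by (simp only: of_nat_le_iff)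
      then have m2: "2 * m + d * m \<le> n" by (simp add: algebra_simps)
      have "(\<Sum>g\<in>near_coset C n W m. hit_prob d {..<n} g) \<le> d * (card W + 1) * (order G * (exp 1 * d) ^ d * sqrt (m / n)) ^ m"
      proof (rule near_coset_sum[OF W _ _ d m])
        show "m + d * m div 2 \<le> n" using m2 by linarith
        show "near_coset C n W m \<subseteq> {g \<in> PiE {..<n} (\<lambda>_. carrier G). card {i \<in> {..<n}. g i \<notin> W} = m}"
          by (auto simp: near_coset_def)
        fix g J assume g: "g \<in> near_coset C n W m" and J: "J \<subseteq> {..<n}" "card J = card {i \<in> {..<n}. g i \<in> W}"
        let ?M = "image_mset g (mset_set {..<n})"
        let ?MW = "filter_mset (\<lambda>v. v \<in> W) ?M"
        have "{..<n} = {i \<in> {..<n}. g i \<in> W} \<union> {i \<in> {..<n}. g i \<notin> W}" by auto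
        then have "card {..<n} = card ({i \<in> {..<n}. g i \<in> W} \<union> {i \<in> {..<n}. g i \<notin> W})" by (rule arg_cong)
        also have "\<dots> = card {i \<in> {..<n}. g i \<in> W} + card {i \<in> {..<n}. g i \<notin> W}"
          by (rule card_Un_disjoint) auto
        finally have cn: "n = card J + m" using g J by (simp add: near_coset_def)
        have big: "n \<le> 2 * card J" using cn m2 by linarith
        have MW: "?MW = image_mset g (mset_set {i \<in> {..<n}. g i \<in> W})"
          by (simp add: filter_mset_image_mset)
        have "norm (\<Sum>v\<in>#?MW. \<psi> v) \<le> (2 * (C + 2)) * real (card J) powr (3/5)"
          if \<psi>: "\<psi> \<in> chars (G\<lparr>carrier := W\<rparr>)" "\<psi> \<noteq> triv_char (G\<lparr>carrier := W\<rparr>)" for \<psi>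
        proof -
          have "(\<Sum>v\<in>#?MW. \<psi> v) = (\<Sum>i\<in>{i \<in> {..<n}. g i \<in> W}. \<psi> (g i))"
            unfolding MW by (simp add: sum_unfold_sum_mset multiset.map_comp o_def)
          then have "norm (\<Sum>v\<in>#?MW. \<psi> v) \<le> (C + 2) * real n powr (3/5)"
            using g \<psi> by (simp add: near_coset_def)
          also have "\<dots> \<le> (C + 2) * (2 * real (card J) powr (3/5))"
          proof (rule mult_left_mono)
            have "real n powr (3/5) \<le> (2 * real (card J)) powr (3/5)" using big by (intro powr_mono2) auto
            also have "\<dots> = 2 powr (3/5) * real (card J) powr (3/5)" by (simp add: powr_mult)
            also have "\<dots> \<le> 2 powr 1 * real (card J) powr (3/5)" by (intro mult_right_mono powr_mono) auto
            finally show "real n powr (3/5) \<le> 2 * real (card J) powr (3/5)" by simp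
          qed (use C in simp)
          finally show ?thesis by (simp add: algebra_simps)
        qed
        moreover have "card J \<ge> N0" using big elim by linarith
        moreover have "finite J" using J finite_subset by blast
        moreover have "size ?MW = card J" unfolding MW using J by simp
        moreover have "set_mset ?MW \<subseteq> carrier (G\<lparr>carrier := W\<rparr>)" by auto
        ultimately show "(\<Sum>\<psi>\<in>{\<psi> \<in> PiE J (\<lambda>_. chars (G\<lparr>carrier := W\<rparr>)). \<forall>\<xi>\<in>chars (G\<lparr>carrier := W\<rparr>). \<exists>i\<in>J. \<psi> i \<noteq> \<xi>}.
          norm (ft J ?MW \<psi>) ^ 3) \<le> 1"
          using N0[of "card J"] by blast
      qed simp_all
      also have "\<dots> \<le> d * (order G + 1) * (order G * (exp 1 * d) ^ d * sqrt (C * real n powr (-2/5))) ^ m"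
      proof (rule mult_mono)
        have "card W \<le> order G" unfolding order_def by (rule card_mono[OF finite_carrier subgroup.subset[OF W]])
        then show "real (d * (card W + 1)) \<le> real (d * (order G + 1))" by (intro of_nat_mono mult_left_mono) auto
        have "real m / n \<le> (C * real n powr (3/5)) / real n powr 1" using mC n0 by (simp add: divide_right_mono)
        also have "\<dots> = C * real n powr (-2/5)" unfolding times_divide_eq_right[symmetric] powr_diff[symmetric] by simp
        finally show "(order G * (exp 1 * d) ^ d * sqrt (m / n)) ^ m \<le> (order G * (exp 1 * d) ^ d * sqrt (C * real n powr (-2/5))) ^ m"
          by (intro power_mono mult_left_mono real_sqrt_le_mono) auto
      qed auto
      finally show "(\<Sum>g\<in>near_coset C n W m. hit_prob d {..<n} g)
        \<le> d * (order G + 1) * (order G * (exp 1 * d) ^ d * sqrt (C * real n powr (-2/5))) ^ m" .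
    qed
  qed
qed

text \<open>
  The words of which some translate lies in a subgroup \<open>W\<close> up to few exceptions, of
  which there is at least one, and is flat inside \<open>W\<close>.
\<close>

definition translates_near_coset :: "real \<Rightarrow> nat \<Rightarrow> (nat \<Rightarrow> 'a) set"
  where "translates_near_coset C n = (\<Union>v\<in>carrier G. \<Union>W\<in>{W. subgroup W G}. \<Union>m\<in>{1..nat \<lfloor>C * real n powr (3/5)\<rfloor>}.
    {g \<in> PiE {..<n} (\<lambda>_. carrier G). (\<lambda>i\<in>{..<n}. g i \<otimes> v) \<in> near_coset C n W m})"

text \<open>
  The number \<open>m\<close> of exceptions runs from 1 to \<open>C n ^ (3/5)\<close>, so the
  contributions are dominated by a geometric series without its constant term, with ratio of the
  order \<open>n ^ (-1/5)\<close>.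
\<close>

lemma translates_near_coset_sum_limit:
  assumes d: "d \<ge> 3" and C: "C > 0"
  shows "(\<lambda>n. \<Sum>g\<in>translates_near_coset C n. hit_prob d {..<n} g) \<longlonglongrightarrow> 0"
proof -
  let ?k = "real (order G)" and ?S = "{W. subgroup W G}"
  have k: "?k > 0" using order_pos by simp
  have fS: "finite ?S" by (rule finite_subset[of _ "Pow (carrier G)"]) (use finite_carrier subgroup.subset in auto)
  define E where "E = ?k * (exp 1 * d) ^ d * sqrt C"
  have E: "E > 0" using k d C by (simp add: E_def)
  define x where "x n = E * sqrt (real n powr (-2/5))" for n :: nat
  define K where "K = ?k * (card ?S * (real (d * (order G + 1)) * 2))"
  have K: "K \<ge> 0" by (simp add: K_def)
  show ?thesis
  proof (rule tendsto_sandwich[where f = "\<lambda>_. 0"])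
    show "(\<lambda>n. K * x n) \<longlonglongrightarrow> 0"
    proof -
      have "x \<longlonglongrightarrow> 0" unfolding x_def using E by real_asymp
      then show ?thesis by (rule tendsto_mult_right_zero)
    qed
    show "\<forall>\<^sub>F n in sequentially. 0 \<le> (\<Sum>g\<in>translates_near_coset C n. hit_prob d {..<n} g)"
      by (simp add: sum_nonneg hit_prob_nonneg)
    have ev: "\<forall>\<^sub>F n in sequentially. \<forall>W\<in>?S. \<forall>m\<ge>1. real m \<le> C * real n powr (3/5) \<longrightarrow>
      (\<Sum>g\<in>near_coset C n W m. hit_prob d {..<n} g)
      \<le> d * (order G + 1) * (order G * (exp 1 * d) ^ d * sqrt (C * real n powr (-2/5))) ^ m"
      unfolding eventually_ball_finite_distrib[OF fS] using near_coset_sum_bound[OF d C] by auto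
    have x2: "\<forall>\<^sub>F n in sequentially. x n \<le> 1 / 2" unfolding x_def using E by real_asymp
    show "\<forall>\<^sub>F n in sequentially. (\<Sum>g\<in>translates_near_coset C n. hit_prob d {..<n} g) \<le> K * x n"
      using ev x2
    proof eventually_elim
      case (elim n)
      let ?L = "nat \<lfloor>C * real n powr (3/5)\<rfloor>" and ?I = "{..<n}"
      let ?X = "\<lambda>v W m. {g \<in> PiE ?I (\<lambda>_. carrier G). (\<lambda>i\<in>?I. g i \<otimes> v) \<in> near_coset C n W m}"
      let ?D = "real (d * (order G + 1))"
      have x0: "x n \<ge> 0" using E by (simp add: x_def)
      have fX: "finite (?X v W m)" for v W m by (rule finite_subset[OF Collect_restrict finite_PiE_carrier])
      have one: "(\<Sum>g\<in>?X v W m. hit_prob d ?I g) \<le> ?D * x n ^ m"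
        if v: "v \<in> carrier G" and W: "W \<in> ?S" and m: "m \<in> {1..?L}" for v W m
      proof -
        let ?t = "\<lambda>g. (\<lambda>i\<in>?I. g i \<otimes> v)"
        have inj: "inj_on ?t (?X v W m)"
        proof (rule inj_onI)
          fix g g' assume h: "g \<in> ?X v W m" "g' \<in> ?X v W m" "?t g = ?t g'"
          then have gP: "g \<in> PiE ?I (\<lambda>_. carrier G)" "g' \<in> PiE ?I (\<lambda>_. carrier G)" by simp_all
          show "g = g'"
          proof (rule PiE_ext[OF gP])
            fix i assume i: "i \<in> ?I"
            have "?t g i = ?t g' i" using h(3) by (rule fun_cong)
            then have "g i \<otimes> v = g' i \<otimes> v" using i by (simp only: restrict_apply if_True)
            then show "g i = g' i" using PiE_mem[OF gP(1) i] PiE_mem[OF gP(2) i] v by simp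
          qed
        qed
        have "(\<Sum>g\<in>?X v W m. hit_prob d ?I g) = (\<Sum>g\<in>?X v W m. hit_prob d ?I (?t g))"
        proof (rule sum.cong[OF refl])
          fix g assume "g \<in> ?X v W m"
          then have "g \<in> PiE ?I (\<lambda>_. carrier G)" by simp
          from hit_prob_translate[OF finite_lessThan this v] show "hit_prob d ?I g = hit_prob d ?I (?t g)" by simp
        qed
        also have "\<dots> = (\<Sum>g\<in>?t ` ?X v W m. hit_prob d ?I g)" by (simp add: sum.reindex[OF inj])
        also have "\<dots> \<le> (\<Sum>g\<in>near_coset C n W m. hit_prob d ?I g)"
        proof (rule sum_mono2)
          show "finite (near_coset C n W m)"
            unfolding near_coset_def by (rule finite_subset[OF Collect_restrict finite_PiE_carrier])
        qed (auto simp: hit_prob_nonneg)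
        also have "\<dots> \<le> d * (order G + 1) * (order G * (exp 1 * d) ^ d * sqrt (C * real n powr (-2/5))) ^ m"
        proof -
          have "real m \<le> real ?L" using m by simp
          also have "\<dots> \<le> C * real n powr (3/5)" using C by simp
          finally show ?thesis using elim(1) W m by simp
        qed
        also have "order G * (exp 1 * d) ^ d * sqrt (C * real n powr (-2/5)) = x n"
          by (simp add: x_def E_def real_sqrt_mult)
        finally show ?thesis .
      qed
      have geo: "(\<Sum>m\<in>{1..L}. x n ^ m) \<le> 2 * x n" for L :: nat
      proof -
        have "(\<Sum>m=1..L. x n ^ m) \<le> 2 * x n * (1 - x n ^ L)"
        proof (induction L)
          case (Suc L)
          have "x n * x n ^ L * x n \<le> x n * x n ^ L * (1 / 2)" using x0 elim(2) by (intro mult_left_mono) auto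
          then show ?case using Suc by (simp add: algebra_simps)
        qed simp
        also have "\<dots> \<le> 2 * x n" using x0 by (simp add: mult_left_le)
        finally show ?thesis .
      qed
      have "(\<Sum>g\<in>translates_near_coset C n. hit_prob d ?I g)
        \<le> (\<Sum>v\<in>carrier G. \<Sum>g\<in>(\<Union>W\<in>?S. \<Union>m\<in>{1..?L}. ?X v W m). hit_prob d ?I g)"
        unfolding translates_near_coset_def
        by (rule sum_UN_le[OF finite_carrier]) (use fX fS in \<open>auto simp: hit_prob_nonneg\<close>)
      also have "\<dots> \<le> (\<Sum>v\<in>carrier G. \<Sum>W\<in>?S. \<Sum>g\<in>(\<Union>m\<in>{1..?L}. ?X v W m). hit_prob d ?I g)"
        by (rule sum_mono, rule sum_UN_le[OF fS]) (use fX in \<open>auto simp: hit_prob_nonneg\<close>)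
      also have "\<dots> \<le> (\<Sum>v\<in>carrier G. \<Sum>W\<in>?S. \<Sum>m\<in>{1..?L}. \<Sum>g\<in>?X v W m. hit_prob d ?I g)"
        by (rule sum_mono, rule sum_mono, rule sum_UN_le) (use fX in \<open>auto simp: hit_prob_nonneg\<close>)
      also have "\<dots> \<le> (\<Sum>v\<in>carrier G. \<Sum>W\<in>?S. \<Sum>m\<in>{1..?L}. ?D * x n ^ m)"
        by (intro sum_mono one)
      also have "\<dots> \<le> (\<Sum>v\<in>carrier G. \<Sum>W\<in>?S. ?D * (2 * x n))"
      proof (rule sum_mono, rule sum_mono)
        have "(\<Sum>m\<in>{1..?L}. ?D * x n ^ m) = ?D * (\<Sum>m\<in>{1..?L}. x n ^ m)" by (rule sum_distrib_left[symmetric])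
        also have "\<dots> \<le> ?D * (2 * x n)" by (rule mult_left_mono[OF geo]) simp
        finally show "(\<Sum>m\<in>{1..?L}. ?D * x n ^ m) \<le> ?D * (2 * x n)" .
      qed
      also have "\<dots> = K * x n" by (simp add: K_def order_def)
      finally show ?case .
    qed
  qed simp
qed

text \<open>
  A word that is equal to the identity at the last position and lies in a coset of
  \<open>W\<close> without exception lies in \<open>W\<close> itself, and then generates no more
  than \<open>W\<close>. This is what makes at least one exception necessary.
\<close>

lemma generating_cover:
  "\<exists>C>0. \<forall>n\<ge>1. generating n \<subseteq> flat n \<union> intermediate n \<union> translates_near_coset C n"
proof (rule flat_or_near_coset)
  fix C :: real
  assume C: "C > 0" and cl: "\<And>(I :: nat set) g (\<delta> :: real). finite I \<Longrightarrow> I \<noteq> {} \<Longrightarrow> g \<in> PiE I (\<lambda>_. carrier G) \<Longrightarrow>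
    (\<And>\<xi>. \<xi> \<in> chars G \<Longrightarrow> norm (\<Sum>i\<in>I. \<xi> (g i)) / card I - (norm (\<Sum>i\<in>I. \<xi> (g i)) / card I) ^ 2 < \<delta>) \<Longrightarrow>
    (\<forall>\<xi>\<in>chars G. \<xi> \<noteq> triv_char G \<longrightarrow> norm (\<Sum>i\<in>I. \<xi> (g i)) \<le> 2 * \<delta> * card I) \<or>
    (\<exists>v0\<in>carrier G. \<exists>W. subgroup W G \<and> W \<noteq> carrier G \<and> card {i \<in> I. g i \<otimes> inv v0 \<notin> W} \<le> C * \<delta> * card I \<and>
      (\<forall>\<psi>\<in>chars (G\<lparr>carrier := W\<rparr>). \<psi> \<noteq> triv_char (G\<lparr>carrier := W\<rparr>) \<longrightarrow>
        norm (\<Sum>i\<in>{i \<in> I. g i \<otimes> inv v0 \<in> W}. \<psi> (g i \<otimes> inv v0)) \<le> (C + 2) * \<delta> * card I))"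
  have "generating n \<subseteq> flat n \<union> intermediate n \<union> translates_near_coset C n" if n: "n \<ge> 1" for n
  proof
    fix g assume g: "g \<in> generating n"
    let ?I = "{..<n}" and ?\<delta> = "real n powr (-2/5)"
    have gP: "g \<in> PiE ?I (\<lambda>_. carrier G)" and g1: "g (n - 1) = \<one>" and gen: "generate G (g ` ?I) = carrier G"
      using g by (auto simp: generating_def)
    have gc: "g i \<in> carrier G" if "i < n" for i using gP that by auto
    have dn: "?\<delta> * real n = real n powr (3/5)"
    proof -
      have "?\<delta> * real n = ?\<delta> * real n powr 1" using n by simp
      also have "\<dots> = real n powr (3/5)" unfolding powr_add[symmetric] by simp
      finally show ?thesis .
    qed
    show "g \<in> flat n \<union> intermediate n \<union> translates_near_coset C n"
    proof (cases "g \<in> intermediate n")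
      case False
      have lt: "norm (\<Sum>i\<in>?I. \<xi> (g i)) / card ?I - (norm (\<Sum>i\<in>?I. \<xi> (g i)) / card ?I) ^ 2 < ?\<delta>" if "\<xi> \<in> chars G" for \<xi>
        using False gP that unfolding intermediate_def by (simp add: not_le)
      have ne: "?I \<noteq> {}" using n by (auto simp: lessThan_empty_iff)
      from cl[OF finite_lessThan ne gP lt] show ?thesis
      proof
        assume "\<forall>\<xi>\<in>chars G. \<xi> \<noteq> triv_char G \<longrightarrow> norm (\<Sum>i\<in>?I. \<xi> (g i)) \<le> 2 * ?\<delta> * card ?I"
        then have "g \<in> flat n" using gP g1 dn by (simp add: flat_def mult.assoc)
        then show ?thesis by blast
      next
        assume "\<exists>v0\<in>carrier G. \<exists>W. subgroup W G \<and> W \<noteq> carrier G \<and> card {i \<in> ?I. g i \<otimes> inv v0 \<notin> W} \<le> C * ?\<delta> * card ?I \<and>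
          (\<forall>\<psi>\<in>chars (G\<lparr>carrier := W\<rparr>). \<psi> \<noteq> triv_char (G\<lparr>carrier := W\<rparr>) \<longrightarrow>
            norm (\<Sum>i\<in>{i \<in> ?I. g i \<otimes> inv v0 \<in> W}. \<psi> (g i \<otimes> inv v0)) \<le> (C + 2) * ?\<delta> * card ?I)"
        then obtain v0 W where v0: "v0 \<in> carrier G" and W: "subgroup W G" "W \<noteq> carrier G"
          and off: "card {i \<in> ?I. g i \<otimes> inv v0 \<notin> W} \<le> C * ?\<delta> * card ?I"
          and fl: "\<And>\<psi>. \<psi> \<in> chars (G\<lparr>carrier := W\<rparr>) \<Longrightarrow> \<psi> \<noteq> triv_char (G\<lparr>carrier := W\<rparr>) \<Longrightarrow>
            norm (\<Sum>i\<in>{i \<in> ?I. g i \<otimes> inv v0 \<in> W}. \<psi> (g i \<otimes> inv v0)) \<le> (C + 2) * ?\<delta> * card ?I" by blast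
        let ?g = "\<lambda>i\<in>?I. g i \<otimes> inv v0"
        define m where "m = card {i \<in> ?I. g i \<otimes> inv v0 \<notin> W}"
        have off': "real m \<le> C * real n powr (3/5)" using off dn by (simp add: m_def mult.assoc)
        have m1: "m \<ge> 1"
        proof (rule ccontr)
          assume "\<not> m \<ge> 1"
          then have "card {i \<in> ?I. g i \<otimes> inv v0 \<notin> W} = 0" unfolding m_def by linarith
          then have "{i \<in> ?I. g i \<otimes> inv v0 \<notin> W} = {}" by (subst (asm) card_0_eq) simp_all
          then have all: "g i \<otimes> inv v0 \<in> W" if "i < n" for i using that by auto
          have "inv v0 \<in> W" using all[of "n - 1"] n g1 v0 by simp
          then have v0W: "v0 \<in> W" using subgroup.m_inv_closed[OF W(1), of "inv v0"] v0 by simp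
          have "g i \<in> W" if "i < n" for i
          proof -
            have "(g i \<otimes> inv v0) \<otimes> v0 \<in> W" by (rule subgroup.m_closed[OF W(1) all[OF that] v0W])
            then show ?thesis using gc[OF that] v0 by (simp add: m_assoc)
          qed
          then have "generate G (g ` ?I) \<subseteq> W" by (intro generate_subgroup_incl W(1)) auto
          then show False using gen W subgroup.subset[OF W(1)] by blast
        qed
        have "?g \<in> near_coset C n W m"
          unfolding near_coset_def
        proof (intro CollectI conjI ballI impI)
          show "?g \<in> PiE ?I (\<lambda>_. carrier G)" using gc v0 by auto
          have e: "{i \<in> ?I. ?g i \<notin> W} = {i \<in> ?I. g i \<otimes> inv v0 \<notin> W}" "{i \<in> ?I. ?g i \<in> W} = {i \<in> ?I. g i \<otimes> inv v0 \<in> W}"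
            by auto
          show "card {i \<in> ?I. ?g i \<notin> W} = m" unfolding e m_def ..
          fix \<psi> assume \<psi>: "\<psi> \<in> chars (G\<lparr>carrier := W\<rparr>)" "\<psi> \<noteq> triv_char (G\<lparr>carrier := W\<rparr>)"
          have "(\<Sum>i\<in>{i \<in> ?I. ?g i \<in> W}. \<psi> (?g i)) = (\<Sum>i\<in>{i \<in> ?I. g i \<otimes> inv v0 \<in> W}. \<psi> (g i \<otimes> inv v0))"
            unfolding e by (rule sum.cong) auto
          then show "norm (\<Sum>i\<in>{i \<in> ?I. ?g i \<in> W}. \<psi> (?g i)) \<le> (C + 2) * real n powr (3/5)"
            using fl[OF \<psi>] dn by (simp add: mult.assoc)
        qed
        moreover have "m \<in> {1..nat \<lfloor>C * real n powr (3/5)\<rfloor>}"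
          using m1 off' by (simp add: le_nat_floor)
        ultimately have "g \<in> translates_near_coset C n"
          unfolding translates_near_coset_def using gP W(1) inv_closed[OF v0] by blast
        then show ?thesis by blast
      qed
    qed blast
  qed
  then show "\<exists>C>0. \<forall>n\<ge>1. generating n \<subseteq> flat n \<union> intermediate n \<union> translates_near_coset C n"
    by (intro exI[of _ C] conjI C allI impI)
qed

lemma generating_sum_limit:
  assumes d: "d \<ge> 3"
  shows "(\<lambda>n. \<Sum>g\<in>generating n. hit_prob d {..<n} g) \<longlonglongrightarrow> 1"
proof -
  obtain C where C: "C > 0" "\<And>n. n \<ge> 1 \<Longrightarrow> generating n \<subseteq> flat n \<union> intermediate n \<union> translates_near_coset C n"
    using generating_cover by blast
  let ?s = "\<lambda>A n. \<Sum>g\<in>A. hit_prob d {..<n} g"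
  have fin: "finite (generating n)" "finite (flat n)" "finite (intermediate n)" "finite (translates_near_coset C n)" for n
    by (rule finite_subset[OF _ finite_PiE_carrier[of n]];
        auto simp: generating_def flat_def intermediate_def translates_near_coset_def)+
  have un: "?s (A \<union> B) n \<le> ?s A n + ?s B n" if "finite A" "finite B" for A B n
    using sum.union_inter[OF that, of "hit_prob d {..<n}"] sum_nonneg[of "A \<inter> B" "hit_prob d {..<n}"] hit_prob_nonneg[of d "{..<n}"] by simp
  show ?thesis
  proof (rule tendsto_sandwich)
    show "(\<lambda>n. ?s (flat n) n) \<longlonglongrightarrow> 1" by (rule flat_sum_limit[OF d])
    show "\<forall>\<^sub>F n in sequentially. ?s (flat n) n \<le> ?s (generating n) n"
      using flat_generating by eventually_elim (rule sum_mono2[OF fin(1)], auto simp: hit_prob_nonneg)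
    have "(\<lambda>n. ?s (flat n) n + ?s (intermediate n) n + ?s (translates_near_coset C n) n) \<longlonglongrightarrow> 1 + 0 + 0"
      by (intro tendsto_add flat_sum_limit[OF d] intermediate_sum_limit[OF d] translates_near_coset_sum_limit[OF d C(1)])
    then show "(\<lambda>n. ?s (flat n) n + ?s (intermediate n) n + ?s (translates_near_coset C n) n) \<longlonglongrightarrow> 1" by simp
    show "\<forall>\<^sub>F n in sequentially. ?s (generating n) n \<le> ?s (flat n) n + ?s (intermediate n) n + ?s (translates_near_coset C n) n"
      using eventually_ge_at_top[of "1::nat"]
    proof eventually_elim
      case (elim n)
      have "?s (generating n) n \<le> ?s (flat n \<union> intermediate n \<union> translates_near_coset C n) n"
        by (rule sum_mono2) (use fin C(2)[OF elim] in \<open>auto simp: hit_prob_nonneg\<close>)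
      also have "\<dots> \<le> ?s (flat n \<union> intermediate n) n + ?s (translates_near_coset C n) n"
        by (rule un) (use fin in auto)
      also have "?s (flat n \<union> intermediate n) n \<le> ?s (flat n) n + ?s (intermediate n) n"
        by (rule un) (use fin in auto)
      finally show ?case by simp
    qed
  qed
qed

end

theorem theorem1p3:
  fixes d :: nat and V :: "('v, 'm) monoid_scheme"
  assumes "d \<ge> 3"
    and "comm_group V"
    and "finite (carrier V)"
  shows "(\<lambda>n. measure_pmf.expectation (random_digraph d n)
           (\<lambda>D. real (card (Sur (sandpile_group d n D) V)))) \<longlonglongrightarrow> 1"
proof -
  interpret V: finite_comm_group V
    using assms(2,3) by (simp add: finite_comm_group_def finite_comm_group_axioms_def)
  show ?thesis
  proof (rule Lim_transform_eventually[OF V.generating_sum_limit[OF assms(1)]])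
    show "\<forall>\<^sub>F n in sequentially. (\<Sum>g\<in>V.generating n. V.hit_prob d {..<n} g)
      = measure_pmf.expectation (random_digraph d n) (\<lambda>D. real (card (Sur (sandpile_group d n D) V)))"
      using eventually_ge_at_top[of "1::nat"] by eventually_elim (rule V.expectation_Sur[symmetric])
  qed
qed

end
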